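(* Let $S\subset\mathbb{P}^9$ be an anticanonically embedded Severi-Brauer surface over $\mathbb{Q}$, let $L_0=L(S_0,\mathbb{Q})$ and $L=L(S,\mathbb{Q})$, and assume that $L_0$ and $L$ are isomorphic Lie algebras. Let $K=\mathfrak{sl}_3(\mathbb{Q})$ and let $\varphi_0:K\to L_0$ and $\varphi:K\to L$ be injective Lie algebra homomorphisms obtained from isomorphisms of $K$ with the traceless part of $L_0$ and of $L$, respectively; view them as representations of $K$ on $\mathbb{Q}^{10}$. Let $H\subset K$ be a Cartan subalgebra with basis $h_1,h_2$ which are part of a Chevalley basis of $K$, and let $\tau$ be an automorphism of $K$ such that $\tau(h_1)=h_2$ and $\tau(h_2)=h_1$. Then the representation $\varphi_0$ of $K$ is isomorphic either to $\varphi$ or to $\varphi\circ\tau$. Let $V_0$ be the $10$-dimensional $K$-module corresponding to $\varphi_0$. If $\varphi_0$ is isomorphic to $\varphi$, let $V$ be the $10$-dimensional $K$-module corresponding to $\varphi$; otherwise let $V$ be the $K$-module corresponding to $\varphi\circ\tau$. Let $f:V_0\to V$ be an isomorphism of $K$-modules. Then $f$ modulo scalar multiplication (i.e. the projective transformation of $\mathbb{P}^9$ induced by $f$) is also an isomorphism from $S_0$ to $S$.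
   Context: A Severi-Brauer surface over $\mathbb{Q}$ is a surface that becomes isomorphic to $\mathbb{P}^2$ over $\mathbb{C}$. Such a surface is anticanonically embedded in $\mathbb{P}^9$ if it is the image of the map to $\mathbb{P}^9$ given by a basis of the ($10$-dimensional) space of sections of its anticanonical bundle (the determinant of the tangent bundle). The surface $S_0\subset\mathbb{P}^9$ is the image of $\mathbb{P}^2$ under $(s:t:u)\mapsto(s^3:t^3:u^3:s^2t:t^2u:u^2s:st^2:tu^2:us^2:stu)$. The ideal of an anticanonically embedded Severi-Brauer surface $S\subset\mathbb{P}^9$ is generated by $27$ linearly independent quadrics $x^TA_ix$, with $A_1,\dots,A_{27}$ symmetric $10\times10$ matrices. For a field $F\subset\mathbb{C}$ over which the $A_i$ are defined, put $$L(S,F)=\Big\{X\in\mathfrak{gl}_{10}(F)\ \Big|\ \exists\,\lambda_{ij}\in F\text{ such that }X^TA_i+A_iX=\sum_{j=1}^{27}\lambda_{ij}A_j\text{ for }1\le i\le 27\Big\}.$$ The traceless part of $L$ is the ideal $\{x\in L\mid \mathrm{Tr}(x)=0\}$, and similarly for $L_0$. *)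

theory Defs
  imports "HOL-Analysis.Analysis" "HOL-Library.Poly_Mapping"
begin

text \<open>
  Varieties over a field \<open>k \<subseteq> \<complex>\<close> are given by their sets of complex points in projective space
  together with a \<open>k\<close>-structure: "over \<open>k\<close>" always means "by polynomials with coefficients in \<open>k\<close>".
  Fields \<open>k \<subseteq> \<complex>\<close> are sets of complex numbers; in particular \<open>\<rat>\<close> is the field of rational numbers
  inside \<open>\<complex>\<close>, and the field \<open>\<complex>\<close> is \<open>UNIV\<close>.
\<close>

subsection \<open>Projective space and polynomials\<close>

text \<open>\<open>'n proj\<close> is the complex projective space of dimension \<open>CARD('n) - 1\<close>.
  The value of \<open>pt\<close> at the zero vector is meaningless and is guarded against everywhere.\<close>

quotient_type 'n proj =
  "complex ^ 'n::finite" / partial: "\<lambda>v w. v \<noteq> 0 \<and> w \<noteq> 0 \<and> (\<exists>c. w = c *s v)"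
  morphisms rep pt
proof (rule part_equivpI)
  show "\<exists>v::complex ^ 'n. v \<noteq> 0 \<and> v \<noteq> 0 \<and> (\<exists>c. v = c *s v)"
    by (rule exI[of _ "\<chi> i. 1"]) (auto simp: vec_eq_iff intro: exI[of _ 1])
  have "\<exists>c. v = c *s w" if "w \<noteq> 0" "w = c *s v" for v w :: "complex ^ 'n" and c :: complex
    using that by (intro exI[of _ "inverse c"]) (auto simp: vector_smult_assoc)
  then show "symp (\<lambda>v w::complex ^ 'n. v \<noteq> 0 \<and> w \<noteq> 0 \<and> (\<exists>c. w = c *s v))"
    unfolding symp_def by blast
  show "transp (\<lambda>v w::complex ^ 'n. v \<noteq> 0 \<and> w \<noteq> 0 \<and> (\<exists>c. w = c *s v))"
    by (rule transpI) (auto simp: vector_smult_assoc)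
qed

type_synonym 'n poly_ring = "('n \<Rightarrow>\<^sub>0 nat) \<Rightarrow>\<^sub>0 complex"

definition eval :: "'n::finite poly_ring \<Rightarrow> complex ^ 'n \<Rightarrow> complex" where
  "eval p v = (\<Sum>m\<in>Poly_Mapping.keys p.
     Poly_Mapping.lookup p m * (\<Prod>i\<in>UNIV. (v $ i) ^ Poly_Mapping.lookup m i))"

definition forms :: "complex set \<Rightarrow> nat \<Rightarrow> 'n::finite poly_ring set" where
  "forms k d = {p. (\<forall>m. Poly_Mapping.lookup p m \<in> k) \<and>
     (\<forall>m\<in>Poly_Mapping.keys p. (\<Sum>i\<in>UNIV. Poly_Mapping.lookup m i) = d)}"

definition zero_locus :: "'n::finite poly_ring set \<Rightarrow> 'n proj set" where
  "zero_locus G = {pt v | v. v \<noteq> 0 \<and> (\<forall>p\<in>G. eval p v = 0)}"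

definition vanishing_ideal :: "'n::finite proj set \<Rightarrow> 'n poly_ring set" where
  "vanishing_ideal S = {p. \<forall>v. v \<noteq> 0 \<and> pt v \<in> S \<longrightarrow> eval p v = 0}"

text \<open>The ideal generated by a set is its span in the ring, viewed as a module over itself.\<close>

definition ideal_generated :: "'n::finite poly_ring set \<Rightarrow> 'n poly_ring set" where
  "ideal_generated G = module.span (*) G"


subsection \<open>Varieties, regular functions and morphisms over a field\<close>

text \<open>A closed subset is defined over \<open>k\<close> if its (radical) homogeneous ideal in \<open>\<complex>[x]\<close> is generated
  by forms with coefficients in \<open>k\<close>. These are the geometrically reduced closed subschemes of
  projective space over \<open>k\<close>.\<close>

definition projective_variety :: "complex set \<Rightarrow> 'n::finite proj set \<Rightarrow> bool" where
  "projective_variety k S \<longleftrightarrow> (\<exists>G. G \<subseteq> (\<Union>d. forms k d) \<and> S = zero_locus G \<and>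
     vanishing_ideal S = ideal_generated G)"

text \<open>Regular functions are handled through germs: \<open>regular_at k S f x\<close> says that, on the Zariski
  neighbourhood \<open>q \<noteq> 0\<close> of \<open>x\<close> in \<open>S\<close>, the total function \<open>f\<close> is the quotient \<open>p/q\<close> of two forms of
  the same degree. The values of \<open>f\<close> elsewhere are arbitrary.\<close>

definition regular_at ::
  "complex set \<Rightarrow> 'n::finite proj set \<Rightarrow> ('n proj \<Rightarrow> complex) \<Rightarrow> 'n proj \<Rightarrow> bool" where
  "regular_at k S f x \<longleftrightarrow> (\<exists>d. \<exists>p\<in>forms k d. \<exists>q\<in>forms k d. eval q (rep x) \<noteq> 0 \<and>
     (\<forall>v. v \<noteq> 0 \<and> pt v \<in> S \<and> eval q v \<noteq> 0 \<longrightarrow> f (pt v) = eval p v / eval q v))"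

definition regular_map ::
  "complex set \<Rightarrow> 'n::finite proj set \<Rightarrow> ('n proj \<Rightarrow> 'm::finite proj) \<Rightarrow> bool" where
  "regular_map k S \<phi> \<longleftrightarrow> (\<forall>x\<in>S. \<exists>d P. (\<forall>j. P j \<in> forms k d) \<and>
     (\<chi> j. eval (P j) (rep x)) \<noteq> 0 \<and>
     (\<forall>v. v \<noteq> 0 \<and> pt v \<in> S \<and> (\<chi> j. eval (P j) v) \<noteq> 0 \<longrightarrow>
        \<phi> (pt v) = pt (\<chi> j. eval (P j) v)))"

definition variety_iso ::
  "complex set \<Rightarrow> 'n::finite proj set \<Rightarrow> 'm::finite proj set \<Rightarrow> ('n proj \<Rightarrow> 'm proj) \<Rightarrow> bool" where
  "variety_iso k S T \<phi> \<longleftrightarrow>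
     bij_betw \<phi> S T \<and> regular_map k S \<phi> \<and> regular_map k T (inv_into S \<phi>)"

definition severi_brauer_surface :: "complex set \<Rightarrow> 'n::finite proj set \<Rightarrow> bool" where
  "severi_brauer_surface k S \<longleftrightarrow> projective_variety k S \<and>
     (\<exists>\<phi>. variety_iso UNIV (UNIV :: 3 proj set) S \<phi>)"


subsection \<open>The anticanonical bundle\<close>

text \<open>
  On a smooth surface \<open>S\<close> the determinant of the tangent bundle is \<open>\<Lambda>\<^sup>2T\<close>, whose
  global sections are the alternating biderivations of the structure sheaf (the elements of
  \<open>Hom(\<Lambda>\<^sup>2\<Omega>, O)\<close>). Such a section \<open>\<sigma>\<close> is encoded by an operation on total functions;
  \<open>\<sigma> f g x\<close> is meaningful if \<open>f\<close> and \<open>g\<close> are regular at \<open>x \<in> S\<close>. That it depends only on the germs of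
  \<open>f\<close> and \<open>g\<close> at \<open>x\<close> follows from the axioms: if \<open>f = f'\<close> on the part of \<open>S\<close> where \<open>q \<noteq> 0\<close>, apply the
  Leibniz rule to the product of \<open>f - f'\<close> with the indicator function of that part, which is
  regular at \<open>x\<close>. The section is defined over \<open>k\<close> if it maps \<open>k\<close>-regular functions to \<open>k\<close>-regular
  functions; for \<open>S\<close> over \<open>k\<close> these are the sections of the bundle of the \<open>k\<close>-variety.
\<close>

type_synonym 'n biderivation =
  "('n proj \<Rightarrow> complex) \<Rightarrow> ('n proj \<Rightarrow> complex) \<Rightarrow> 'n proj \<Rightarrow> complex"

definition anticanonical_section ::
  "complex set \<Rightarrow> 'n::finite proj set \<Rightarrow> 'n biderivation \<Rightarrow> bool" where
  "anticanonical_section k S \<sigma> \<longleftrightarrow> (\<forall>x\<in>S.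
     (\<forall>f g. regular_at UNIV S f x \<and> regular_at UNIV S g x \<longrightarrow>
        regular_at UNIV S (\<sigma> f g) x \<and>
        \<sigma> f f x = 0 \<and>
        \<sigma> f g x = - \<sigma> g f x \<and>
        (\<forall>c. \<sigma> (\<lambda>y. c * f y) g x = c * \<sigma> f g x) \<and>
        (\<forall>h. regular_at UNIV S h x \<longrightarrow>
           \<sigma> (\<lambda>y. f y + h y) g x = \<sigma> f g x + \<sigma> h g x \<and>
           \<sigma> (\<lambda>y. f y * h y) g x = f x * \<sigma> h g x + h x * \<sigma> f g x)) \<and>
     (\<forall>f g. regular_at k S f x \<and> regular_at k S g x \<longrightarrow> regular_at k S (\<sigma> f g) x))"

text \<open>A basis of the \<open>k\<close>-vector space of sections over \<open>k\<close>, two sections being equal if they agree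
  on all germs of regular functions.\<close>

definition anticanonical_basis ::
  "complex set \<Rightarrow> 'n::finite proj set \<Rightarrow> ('m::finite \<Rightarrow> 'n biderivation) \<Rightarrow> bool" where
  "anticanonical_basis k S s \<longleftrightarrow> (\<forall>i. anticanonical_section k S (s i)) \<and>
     (\<forall>\<sigma>. anticanonical_section k S \<sigma> \<longrightarrow>
        (\<exists>!c. (\<forall>i. c i \<in> k) \<and>
           (\<forall>x\<in>S. \<forall>f g. regular_at UNIV S f x \<and> regular_at UNIV S g x \<longrightarrow>
              \<sigma> f g x = (\<Sum>i\<in>UNIV. c i * s i f g x))))"

text \<open>The map given by sections \<open>s\<^sub>i\<close> sends \<open>x\<close> to the point with coordinates \<open>s\<^sub>i(x)\<close>, computed in the
  one-dimensional fibre at \<open>x\<close>. Evaluation at \<open>(f, g)\<close> is a linear functional on that fibre, and the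
  coordinates do not depend on the choice of \<open>f, g\<close> up to a common factor.\<close>

definition anticanonical_image ::
  "'n::finite proj set \<Rightarrow> ('m::finite \<Rightarrow> 'n biderivation) \<Rightarrow> 'm proj set" where
  "anticanonical_image S s = {pt (\<chi> i. s i f g x) | f g x.
     x \<in> S \<and> regular_at UNIV S f x \<and> regular_at UNIV S g x \<and> (\<chi> i. s i f g x) \<noteq> 0}"

text \<open>No generality is lost by taking the abstract surface to be \<open>S\<close> itself: if \<open>S\<close> is the
  image of some Severi-Brauer surface \<open>S'\<close> under its anticanonical map, then that map is an
  isomorphism from \<open>S'\<close> to \<open>S\<close> (the anticanonical bundle is very ample), along which the
  basis can be transported.\<close>

definition anticanonically_embedded_severi_brauer_surface :: "complex set \<Rightarrow> 10 proj set \<Rightarrow> bool" where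
  "anticanonically_embedded_severi_brauer_surface k S \<longleftrightarrow> severi_brauer_surface k S \<and>
     (\<exists>s :: 10 \<Rightarrow> 10 biderivation. anticanonical_basis k S s \<and> S = anticanonical_image S s)"

definition veronese :: "complex ^ 3 \<Rightarrow> complex ^ 10" where
  "veronese v = (let s = v $ 1; t = v $ 2; u = v $ 3 in
     vector [s^3, t^3, u^3, s^2 * t, t^2 * u, u^2 * s, s * t^2, t * u^2, u * s^2, s * t * u])"

definition S0 :: "10 proj set" where
  "S0 = {pt (veronese v) | v. v \<noteq> 0}"


subsection \<open>Lie algebras of matrices over a field\<close>

definition matrices :: "complex set \<Rightarrow> (complex ^ 'n ^ 'm) set" where
  "matrices F = {X. \<forall>i j. X $ i $ j \<in> F}"

definition scale :: "complex \<Rightarrow> complex ^ 'n ^ 'm \<Rightarrow> complex ^ 'n ^ 'm" where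
  "scale c X = (\<chi> i j. c * X $ i $ j)"

definition bracket :: "complex ^ 'n ^ 'n \<Rightarrow> complex ^ 'n ^ 'n \<Rightarrow> complex ^ 'n ^ 'n" where
  "bracket X Y = X ** Y - Y ** X"

definition sl :: "complex set \<Rightarrow> (complex ^ 'n ^ 'n) set" where
  "sl F = {X \<in> matrices F. trace X = 0}"

definition traceless :: "(complex ^ 'n ^ 'n) set \<Rightarrow> (complex ^ 'n ^ 'n) set" where
  "traceless L = {X \<in> L. trace X = 0}"

definition lie_iso :: "complex set \<Rightarrow> (complex ^ 'n ^ 'n) set \<Rightarrow> (complex ^ 'm ^ 'm) set \<Rightarrow>
    (complex ^ 'n ^ 'n \<Rightarrow> complex ^ 'm ^ 'm) \<Rightarrow> bool" where
  "lie_iso F K L f \<longleftrightarrow> bij_betw f K L \<and>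
     (\<forall>X\<in>K. \<forall>Y\<in>K. f (X + Y) = f X + f Y \<and> f (bracket X Y) = bracket (f X) (f Y)) \<and>
     (\<forall>c\<in>F. \<forall>X\<in>K. f (scale c X) = scale c (f X))"

definition linear_combination ::
  "(complex ^ 'n ^ 'm \<Rightarrow> complex) \<Rightarrow> (complex ^ 'n ^ 'm) set \<Rightarrow> complex ^ 'n ^ 'm" where
  "linear_combination c B = (\<Sum>b\<in>B. scale (c b) b)"

definition lin_indep :: "complex set \<Rightarrow> (complex ^ 'n ^ 'm) set \<Rightarrow> bool" where
  "lin_indep F B \<longleftrightarrow> finite B \<and>
     (\<forall>c. (\<forall>b\<in>B. c b \<in> F) \<and> linear_combination c B = 0 \<longrightarrow> (\<forall>b\<in>B. c b = 0))"

definition is_basis :: "complex set \<Rightarrow> (complex ^ 'n ^ 'm) set \<Rightarrow> (complex ^ 'n ^ 'm) set \<Rightarrow> bool" where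
  "is_basis F V B \<longleftrightarrow> lin_indep F B \<and> V = {linear_combination c B | c. \<forall>b\<in>B. c b \<in> F}"

definition lie_subalgebra :: "complex set \<Rightarrow> (complex ^ 'n ^ 'n) set \<Rightarrow> (complex ^ 'n ^ 'n) set \<Rightarrow> bool" where
  "lie_subalgebra F K H \<longleftrightarrow> H \<subseteq> K \<and> 0 \<in> H \<and>
     (\<forall>X\<in>H. \<forall>Y\<in>H. X + Y \<in> H \<and> bracket X Y \<in> H) \<and> (\<forall>c\<in>F. \<forall>X\<in>H. scale c X \<in> H)"

text \<open>The terms of the lower central series are spanned by the iterated brackets of a fixed length.\<close>

definition nilpotent_lie :: "(complex ^ 'n ^ 'n) set \<Rightarrow> bool" where
  "nilpotent_lie H \<longleftrightarrow>
     (\<exists>r. \<forall>Xs Y. length Xs = r \<and> set Xs \<subseteq> H \<and> Y \<in> H \<longrightarrow> foldr bracket Xs Y = 0)"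

definition cartan_subalgebra ::
  "complex set \<Rightarrow> (complex ^ 'n ^ 'n) set \<Rightarrow> (complex ^ 'n ^ 'n) set \<Rightarrow> bool" where
  "cartan_subalgebra F K H \<longleftrightarrow> lie_subalgebra F K H \<and> nilpotent_lie H \<and>
     (\<forall>X\<in>K. (\<forall>Y\<in>H. bracket X Y \<in> H) \<longrightarrow> X \<in> H)"

text \<open>Linear functionals \<open>\<alpha>\<close> on \<open>H\<close> are given by their values \<open>\<alpha> i\<close> on the elements \<open>h i\<close> of a
  basis of \<open>H\<close>.\<close>

definition root_space ::
  "(complex ^ 'n ^ 'n) set \<Rightarrow> ('l \<Rightarrow> complex ^ 'n ^ 'n) \<Rightarrow> ('l \<Rightarrow> complex) \<Rightarrow> (complex ^ 'n ^ 'n) set" where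
  "root_space K h \<alpha> = {X \<in> K. \<forall>i. bracket (h i) X = scale (\<alpha> i) X}"

definition roots ::
  "complex set \<Rightarrow> (complex ^ 'n ^ 'n) set \<Rightarrow> ('l \<Rightarrow> complex ^ 'n ^ 'n) \<Rightarrow> ('l \<Rightarrow> complex) set" where
  "roots F K h = {\<alpha>. (\<forall>i. \<alpha> i \<in> F) \<and> (\<exists>i. \<alpha> i \<noteq> 0) \<and> (\<exists>X\<in>root_space K h \<alpha>. X \<noteq> 0)}"

definition root_base :: "complex set \<Rightarrow> ('l::finite \<Rightarrow> complex) set \<Rightarrow> ('l \<Rightarrow> 'l \<Rightarrow> complex) \<Rightarrow> bool" where
  "root_base F R a \<longleftrightarrow> (\<forall>j. a j \<in> R) \<and>
     (\<forall>c. (\<forall>j. c j \<in> F) \<and> (\<forall>i. (\<Sum>j\<in>UNIV. c j * a j i) = 0) \<longrightarrow> (\<forall>j. c j = 0)) \<and>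
     (\<forall>\<alpha>\<in>R. \<exists>n :: 'l \<Rightarrow> int. (\<forall>i. \<alpha> i = (\<Sum>j\<in>UNIV. of_int (n j) * a j i)) \<and>
        ((\<forall>j. n j \<ge> 0) \<or> (\<forall>j. n j \<le> 0)))"

text \<open>A Chevalley basis \<open>{h\<^sub>i} \<union> {x\<^sub>\<alpha>}\<close> with respect to \<open>H\<close>, as in Humphreys, Section 25.2:
  \<open>[x\<^sub>\<alpha>, x\<^bsub>-\<alpha>\<^esub>] = h\<^sub>\<alpha>\<close> is the coroot of \<open>\<alpha>\<close> (the element of \<open>[K\<^sub>\<alpha>, K\<^bsub>-\<alpha>\<^esub>]\<close> with \<open>\<alpha>(h\<^sub>\<alpha>) = 2\<close>),
  the \<open>h\<^sub>i\<close> are the coroots of a base of the root system, and if \<open>[x\<^sub>\<alpha>, x\<^sub>\<beta>] = c x\<^bsub>\<alpha>+\<beta>\<^esub>\<close> then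
  \<open>[x\<^bsub>-\<alpha>\<^esub>, x\<^bsub>-\<beta>\<^esub>] = -c x\<^bsub>-\<alpha>-\<beta>\<^esub>\<close>.\<close>

definition chevalley_basis :: "complex set \<Rightarrow> (complex ^ 'n ^ 'n) set \<Rightarrow> (complex ^ 'n ^ 'n) set \<Rightarrow>
    ('l::finite \<Rightarrow> complex ^ 'n ^ 'n) \<Rightarrow> (('l \<Rightarrow> complex) \<Rightarrow> complex ^ 'n ^ 'n) \<Rightarrow> bool" where
  "chevalley_basis F K H h x \<longleftrightarrow>
     inj h \<and> is_basis F H (range h) \<and>
     is_basis F K (range h \<union> x ` roots F K h) \<and>
     (\<forall>\<alpha>\<in>roots F K h. x \<alpha> \<in> root_space K h \<alpha> \<and>
        bracket (x \<alpha>) (x (\<lambda>i. - \<alpha> i)) \<in> H \<and>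
        bracket (bracket (x \<alpha>) (x (\<lambda>i. - \<alpha> i))) (x \<alpha>) = scale 2 (x \<alpha>)) \<and>
     (\<exists>a. root_base F (roots F K h) a \<and> (\<forall>j. h j = bracket (x (a j)) (x (\<lambda>i. - a j i)))) \<and>
     (\<forall>\<alpha>\<in>roots F K h. \<forall>\<beta>\<in>roots F K h. (\<lambda>i. \<alpha> i + \<beta> i) \<in> roots F K h \<longrightarrow>
        (\<exists>c\<in>F. bracket (x \<alpha>) (x \<beta>) = scale c (x (\<lambda>i. \<alpha> i + \<beta> i)) \<and>
           bracket (x (\<lambda>i. - \<alpha> i)) (x (\<lambda>i. - \<beta> i)) = scale (- c) (x (\<lambda>i. - \<alpha> i - \<beta> i))))"

text \<open>An isomorphism \<open>F\<^sup>n \<rightarrow> F\<^sup>n\<close> of the \<open>K\<close>-modules given by two representations is an invertible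
  matrix \<open>f\<close> over \<open>F\<close>; its inverse then has entries in \<open>F\<close> as well.\<close>

definition module_iso :: "complex set \<Rightarrow> (complex ^ 'm ^ 'm) set \<Rightarrow>
    (complex ^ 'm ^ 'm \<Rightarrow> complex ^ 'n ^ 'n) \<Rightarrow> (complex ^ 'm ^ 'm \<Rightarrow> complex ^ 'n ^ 'n) \<Rightarrow>
    complex ^ 'n ^ 'n \<Rightarrow> bool" where
  "module_iso F K \<rho> \<rho>' f \<longleftrightarrow> f \<in> matrices F \<and> invertible f \<and>
     (\<forall>X\<in>K. \<forall>v. f *v (\<rho> X *v v) = \<rho>' X *v (f *v v))"

definition reps_isomorphic :: "complex set \<Rightarrow> (complex ^ 'm ^ 'm) set \<Rightarrow>
    (complex ^ 'm ^ 'm \<Rightarrow> complex ^ 'n ^ 'n) \<Rightarrow> (complex ^ 'm ^ 'm \<Rightarrow> complex ^ 'n ^ 'n) \<Rightarrow> bool" where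
  "reps_isomorphic F K \<rho> \<rho>' \<longleftrightarrow> (\<exists>f. module_iso F K \<rho> \<rho>' f)"

definition proj_map :: "complex ^ 'n ^ 'n \<Rightarrow> 'n::finite proj \<Rightarrow> 'n proj" where
  "proj_map f p = pt (f *v rep p)"


subsection \<open>The Lie algebra of a surface\<close>

definition quadric :: "complex ^ 'n ^ 'n \<Rightarrow> 'n::finite poly_ring" where
  "quadric A = (\<Sum>i\<in>UNIV. \<Sum>j\<in>UNIV.
     Poly_Mapping.single (Poly_Mapping.single i 1 + Poly_Mapping.single j 1) (A $ i $ j))"

definition quadric_generators ::
  "complex set \<Rightarrow> 10 proj set \<Rightarrow> (27 \<Rightarrow> complex ^ 10 ^ 10) \<Rightarrow> bool" where
  "quadric_generators F S A \<longleftrightarrow> (\<forall>i. A i \<in> matrices F \<and> transpose (A i) = A i) \<and>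
     inj A \<and> lin_indep F (range A) \<and>
     vanishing_ideal S = ideal_generated (range (\<lambda>i. quadric (A i)))"

text \<open>The condition on \<open>X\<close> depends only on the span of the \<open>A\<^sub>i\<close>, which is the space of quadrics
  vanishing on \<open>S\<close>; so it does not matter which generators \<open>A\<^sub>i\<close> are used.\<close>

definition lie_algebra_of :: "10 proj set \<Rightarrow> complex set \<Rightarrow> (complex ^ 10 ^ 10) set" where
  "lie_algebra_of S F = {X \<in> matrices F. \<exists>A. quadric_generators F S A \<and>
     (\<exists>l :: 27 \<Rightarrow> 27 \<Rightarrow> complex. (\<forall>i j. l i j \<in> F) \<and>
       (\<forall>i. transpose X ** A i + A i ** X = (\<Sum>j\<in>UNIV. scale (l i j) (A j))))}"

end

theory Submission
  imports Defs "HOL-Complex_Analysis.Complex_Analysis"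
begin

text \<open>Over the complex numbers a Severi-Brauer surface \<open>S\<close> is a projective plane, and sections of its anticanonical
  bundle become cubic forms in three variables. So \<open>S\<close> is \<open>g S0\<close> for a complex matrix \<open>g\<close>, which is
  invertible because the ideal of \<open>S\<close> is generated by quadrics and therefore contains no linear form
  (\<open>anticanonical_image_eq_veronese_image\<close>, \<open>quadric_generators_nondegenerate\<close>).

  The matrices in the Lie algebra of \<open>S\<close> are the linear vector fields that are tangent to the cone over \<open>S\<close>.
  For the Veronese cone these are only the fields \<open>rho Y\<close> that come from linear substitutions of the three
  variables (\<open>tangent_to_cone_imp_rho\<close>). So \<open>\<phi>\<close> has the form \<open>g rho(\<gamma> X) g\<inverse>\<close>, where \<open>\<gamma>\<close> is an injective
  homomorphism from \<open>sl\<^sub>3(\<rat>)\<close> to the complex \<open>3 \<times> 3\<close> matrices. Such a homomorphism is conjugate to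
  the inclusion \<open>X \<mapsto> X\<close> or to its dual \<open>X \<mapsto> - X\<^sup>T\<close> (\<open>sl3_hom_classification\<close>). The conjugating matrix
  acts on cubic forms by a transformation that maps \<open>S0\<close> to itself, so it can be absorbed into \<open>g\<close>. The result is a
  normal form \<open>\<phi> X = a rho(X) a\<inverse>\<close> or \<open>\<phi> X = a rho(- X\<^sup>T) a\<inverse>\<close> with \<open>S = a S0\<close>
  (\<open>normal_form_exists\<close>), and it applies to \<open>S0\<close> and \<open>\<phi>0\<close> as well.

  The type of a normal form, inclusion or dual, is determined by \<open>\<phi>\<close>, because \<open>rho\<close> is not isomorphic to its
  dual. The automorphism \<open>\<tau>\<close> exchanges the two types: an inner automorphism would preserve the trace of
  \<open>h\<^sub>1\<^sup>2 h\<^sub>2\<close>, which differs from the trace of \<open>h\<^sub>2\<^sup>2 h\<^sub>1\<close> (\<open>chevalley_basis_cubic_trace\<close>). So \<open>\<phi>0\<close> has the same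
  type as exactly one of \<open>\<phi>\<close> and \<open>\<phi> \<circ> \<tau>\<close>. If the normal forms of two representations have the same type
  and matrices \<open>a0\<close> and \<open>a\<close>, then \<open>a a0\<inverse>\<close> is an intertwiner over the complex numbers. As \<open>rho\<close> is irreducible,
  Schur's lemma shows that it is the only one up to scalars. Applying a \<open>\<rat>\<close>-linear functional to its entries gives
  a rational intertwiner (\<open>normal_forms_isomorphic\<close>). Conversely, every intertwiner \<open>f\<close> is a multiple of \<open>a a0\<inverse>\<close>,
  so it maps \<open>S0 = a0 S0\<close> onto \<open>S = a S0\<close> (\<open>module_iso_variety_iso\<close>).\<close>

(* With two meanings of the dollar sign the parse trees multiply in long formulas. *)
no_notation fps_nth (infixl "$" 75)

section \<open>The Veronese surface and the representation on cubic forms\<close>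

lemma matrix_inv_mult:
  assumes "invertible A"
  shows "A ** matrix_inv A = mat 1" "matrix_inv A ** A = mat 1"
proof -
  from assms obtain B where "A ** B = mat 1 \<and> B ** A = mat 1" unfolding invertible_def by blast
  from someI[of "\<lambda>B. A ** B = mat 1 \<and> B ** A = mat 1", OF this]
  show "A ** matrix_inv A = mat 1" "matrix_inv A ** A = mat 1" unfolding matrix_inv_def by auto
qed

lemma invertible_mult_nonzero: "invertible g \<Longrightarrow> x \<noteq> 0 \<Longrightarrow> g *v x \<noteq> 0" for g :: "complex ^ 'n ^ 'n"
  using matrix_left_invertible_ker[of g] unfolding invertible_def by blast

lemma exhaust_10: "m = 1 \<or> m = 2 \<or> m = 3 \<or> m = 4 \<or> m = 5 \<or> m = 6 \<or> m = 7 \<or> m = 8 \<or> m = 9 \<or> m = 10" for m :: 10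
proof (induct m)
  case (of_int z)
  then have "z = 0 \<or> z = 1 \<or> z = 2 \<or> z = 3 \<or> z = 4 \<or> z = 5 \<or> z = 6 \<or> z = 7 \<or> z = 8 \<or> z = 9" by simp presburger
  then show ?case by auto
qed

lemma UNIV_10: "(UNIV :: 10 set) = {1, 2, 3, 4, 5, 6, 7, 8, 9, 10}"
  using exhaust_10 by blast

lemma sum_10: "sum f (UNIV :: 10 set) = f 1 + f 2 + f 3 + f 4 + f 5 + f 6 + f 7 + f 8 + f 9 + f 10"
  for f :: "10 \<Rightarrow> 'a :: comm_monoid_add"
  unfolding UNIV_10 by (simp add: ac_simps)

lemma veronese_nth:
  "veronese v $ 1 = v $ 1 ^ 3" "veronese v $ 2 = v $ 2 ^ 3" "veronese v $ 3 = v $ 3 ^ 3"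
  "veronese v $ 4 = v $ 1 ^ 2 * v $ 2" "veronese v $ 5 = v $ 2 ^ 2 * v $ 3" "veronese v $ 6 = v $ 3 ^ 2 * v $ 1"
  "veronese v $ 7 = v $ 1 * v $ 2 ^ 2" "veronese v $ 8 = v $ 2 * v $ 3 ^ 2" "veronese v $ 9 = v $ 3 * v $ 1 ^ 2"
  "veronese v $ 10 = v $ 1 * v $ 2 * v $ 3"
  unfolding veronese_def Let_def vector_def by simp_all

text \<open>The ten monomials take different values at \<open>(2, 3, 5)\<close>, by unique factorization.\<close>

lemma veronese_separates:
  assumes "\<And>v. veronese v $ m = veronese v $ n"
  shows "m = n"
  using assms[of "vector [2, 3, 5]"] exhaust_10[of m] exhaust_10[of n]
  by (elim disjE) (simp_all add: veronese_nth del: One_nat_def)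

text \<open>The coordinate of \<open>\<complex>\<^sup>1\<^sup>0\<close> that restricts to the monomial \<open>v\<^sub>i v\<^sub>j v\<^sub>k\<close>. Indexing the ten coordinates by
  symmetric triples makes the formulas for the group and Lie algebra actions uniform.\<close>

definition idx :: "3 \<Rightarrow> 3 \<Rightarrow> 3 \<Rightarrow> 10" where
  "idx i j k = (THE m. \<forall>v. veronese v $ m = v $ i * v $ j * v $ k)"

lemma idx_eqI:
  assumes "\<And>v. veronese v $ m = v $ i * v $ j * v $ k"
  shows "idx i j k = m"
  unfolding idx_def using assms by (intro the_equality) (auto intro: veronese_separates)

lemma idx_table:
  "idx 1 1 1 = 1" "idx 2 2 2 = 2" "idx 3 3 3 = 3"
  "idx 1 1 2 = 4" "idx 1 2 1 = 4" "idx 2 1 1 = 4"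
  "idx 2 2 3 = 5" "idx 2 3 2 = 5" "idx 3 2 2 = 5"
  "idx 3 3 1 = 6" "idx 3 1 3 = 6" "idx 1 3 3 = 6"
  "idx 1 2 2 = 7" "idx 2 1 2 = 7" "idx 2 2 1 = 7"
  "idx 2 3 3 = 8" "idx 3 2 3 = 8" "idx 3 3 2 = 8"
  "idx 3 1 1 = 9" "idx 1 3 1 = 9" "idx 1 1 3 = 9"
  "idx 1 2 3 = 10" "idx 1 3 2 = 10" "idx 2 1 3 = 10" "idx 2 3 1 = 10" "idx 3 1 2 = 10" "idx 3 2 1 = 10"
  by (rule idx_eqI, simp add: veronese_nth power2_eq_square power3_eq_cube mult_ac)+

lemma veronese_idx: "veronese v $ idx i j k = v $ i * v $ j * v $ k"
  using exhaust_3[of i] exhaust_3[of j] exhaust_3[of k]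
  by (elim disjE) (simp_all add: idx_table veronese_nth power2_eq_square power3_eq_cube mult_ac)

lemma idx_swap: "idx j i k = idx i j k" "idx i k j = idx i j k"
  by (rule idx_eqI, simp add: veronese_idx)+

lemma idx_cases: obtains i j k where "m = idx i j k"
  using exhaust_10[of m] idx_table by metis

lemma poly_zero_off_origin:
  fixes p :: "complex poly"
  assumes "\<And>x. x \<noteq> 0 \<Longrightarrow> poly p x = 0"
  shows "p = 0"
proof (rule ccontr)
  assume "p \<noteq> 0"
  then have "finite {x. poly p x = 0}" by (rule poly_roots_finite)
  moreover have "UNIV - {0} \<subseteq> {x. poly p x = 0}" using assms by auto
  ultimately have "finite (UNIV - {0::complex})" using finite_subset by blast
  then show False by (simp add: infinite_UNIV_char_0)
qed

lemma cubic_zero_off_origin: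
  fixes a b c d :: complex
  assumes "\<And>x. x \<noteq> 0 \<Longrightarrow> a + b * x + c * x ^ 2 + d * x ^ 3 = 0"
  shows "a = 0 \<and> b = 0 \<and> c = 0 \<and> d = 0"
proof -
  have "[:a, b, c, d:] = 0"
    by (rule poly_zero_off_origin) (use assms in \<open>simp add: algebra_simps power2_eq_square power3_eq_cube\<close>)
  then show ?thesis by simp
qed

text \<open>The monomials are linearly independent already as functions on the torus where no coordinate vanishes; the
  coefficients are split off one variable at a time.\<close>

lemma veronese_independent:
  assumes "\<And>v. (\<And>i. v $ i \<noteq> 0) \<Longrightarrow> (\<Sum>n\<in>UNIV. r n * veronese v $ n) = 0"
  shows "r n = 0"
proof -
  have eq: "r 1 * s ^ 3 + r 2 * t ^ 3 + r 3 * u ^ 3 + r 4 * (s ^ 2 * t) + r 5 * (t ^ 2 * u) + r 6 * (u ^ 2 * s) +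
      r 7 * (s * t ^ 2) + r 8 * (t * u ^ 2) + r 9 * (u * s ^ 2) + r 10 * (s * t * u) = 0"
    if "s \<noteq> 0" "t \<noteq> 0" "u \<noteq> 0" for s t u
  proof -
    have "(vector [s, t, u] :: complex ^ 3) $ i \<noteq> 0" for i
      using exhaust_3[of i] that by auto
    from assms[OF this] show ?thesis by (simp only: sum_10 veronese_nth vector_3)
  qed
  have 1: "(r 2 * t ^ 3 + r 3 * u ^ 3 + r 5 * (t ^ 2 * u) + r 8 * (t * u ^ 2)) = 0 \<and>
     (r 6 * u ^ 2 + r 7 * t ^ 2 + r 10 * t * u) = 0 \<and> (r 4 * t + r 9 * u) = 0 \<and> r 1 = 0"
    if "t \<noteq> 0" "u \<noteq> 0" for t u
    by (rule cubic_zero_off_origin) (use eq[OF _ that] in \<open>simp add: algebra_simps\<close>)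
  have 2: "r 3 * u ^ 3 = 0 \<and> r 8 * u ^ 2 = 0 \<and> r 5 * u = 0 \<and> r 2 = 0" if "u \<noteq> 0" for u
    by (rule cubic_zero_off_origin) (use 1[OF _ that] in \<open>simp add: algebra_simps\<close>)
  have 3: "r 6 * u ^ 2 = 0 \<and> r 10 * u = 0 \<and> r 7 = 0 \<and> (0::complex) = 0" if "u \<noteq> 0" for u
    by (rule cubic_zero_off_origin) (use 1[OF _ that] in \<open>simp add: algebra_simps\<close>)
  have 4: "r 9 * u = 0 \<and> r 4 = 0 \<and> (0::complex) = 0 \<and> (0::complex) = 0" if "u \<noteq> 0" for u
    by (rule cubic_zero_off_origin) (use 1[OF _ that] in \<open>simp add: algebra_simps\<close>)
  show ?thesis
    using exhaust_10[of n] 1[of 1 1] 2[of 1] 3[of 1] 4[of 1] by auto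
qed

text \<open>Since the Veronese cone spans \<open>\<complex>\<^sup>1\<^sup>0\<close>, identities between \<open>10 \<times> 10\<close> matrices can be checked on it.\<close>

lemma matrix_eq_on_veronese:
  fixes M N :: "complex ^ 10 ^ 'm"
  assumes "\<And>v. (\<And>i. v $ i \<noteq> 0) \<Longrightarrow> M *v veronese v = N *v veronese v"
  shows "M = N"
proof -
  have "M $ p $ q - N $ p $ q = 0" for p q
  proof (rule veronese_independent[where r = "\<lambda>q. M $ p $ q - N $ p $ q"])
    fix v :: "complex ^ 3"
    assume "\<And>i. v $ i \<noteq> 0"
    then have "(M *v veronese v) $ p = (N *v veronese v) $ p" using assms by simp
    then show "(\<Sum>n\<in>UNIV. (M $ p $ n - N $ p $ n) * veronese v $ n) = 0"
      by (simp add: matrix_vector_mult_def left_diff_distrib sum_subtractf)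
  qed
  then show ?thesis by (simp add: vec_eq_iff)
qed

text \<open>A symmetric tensor of degree three is stored by its ten coordinates, with one ordering of the indices for each.\<close>

definition tensor_vec :: "(3 \<Rightarrow> 3 \<Rightarrow> 3 \<Rightarrow> complex) \<Rightarrow> complex ^ 10" where
  "tensor_vec T = vector [T 1 1 1, T 2 2 2, T 3 3 3, T 1 1 2, T 2 2 3, T 3 3 1, T 1 2 2, T 2 3 3, T 3 1 1, T 1 2 3]"

lemma tensor_vec_nth:
  "tensor_vec T $ 1 = T 1 1 1" "tensor_vec T $ 2 = T 2 2 2" "tensor_vec T $ 3 = T 3 3 3"
  "tensor_vec T $ 4 = T 1 1 2" "tensor_vec T $ 5 = T 2 2 3" "tensor_vec T $ 6 = T 3 3 1"
  "tensor_vec T $ 7 = T 1 2 2" "tensor_vec T $ 8 = T 2 3 3" "tensor_vec T $ 9 = T 3 1 1"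
  "tensor_vec T $ 10 = T 1 2 3"
  unfolding tensor_vec_def vector_def by simp_all

lemma tensor_vec_idx:
  assumes swap: "\<And>i j k. T j i k = T i j k" "\<And>i j k. T i k j = T i j k"
  shows "tensor_vec T $ idx i j k = T i j k"
proof -
  have "T 1 2 1 = T 1 1 2" "T 2 1 1 = T 1 1 2" "T 2 3 2 = T 2 2 3" "T 3 2 2 = T 2 2 3"
    "T 3 1 3 = T 3 3 1" "T 1 3 3 = T 3 3 1" "T 2 1 2 = T 1 2 2" "T 2 2 1 = T 1 2 2"
    "T 3 2 3 = T 2 3 3" "T 3 3 2 = T 2 3 3" "T 1 3 1 = T 3 1 1" "T 1 1 3 = T 3 1 1"
    "T 1 3 2 = T 1 2 3" "T 2 1 3 = T 1 2 3" "T 2 3 1 = T 1 2 3" "T 3 1 2 = T 1 2 3" "T 3 2 1 = T 1 2 3"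
    using swap by metis+
  then have "\<forall>i j k. tensor_vec T $ idx i j k = T i j k"
    unfolding forall_3 by (simp only: idx_table tensor_vec_nth simp_thms)
  then show ?thesis by blast
qed

lemma vec10_eqI: "(\<And>i j k. x $ idx i j k = y $ idx i j k) \<Longrightarrow> x = y"
  unfolding vec_eq_iff by (metis idx_cases)

lemma veronese_nonzero: "v \<noteq> 0 \<Longrightarrow> veronese v \<noteq> 0"
proof
  assume "v \<noteq> 0" "veronese v = 0"
  then obtain k where "v $ k \<noteq> 0" "veronese v $ idx k k k = 0" by (auto simp: vec_eq_iff)
  then show False by (simp add: veronese_idx)
qed

lemma matrix_tensor_vec_idx:
  assumes swap: "\<And>x i j k. T x j i k = T x i j k" "\<And>x i j k. T x i k j = T x i j k"
    and linear: "\<And>x y i j k. T (x + y) i j k = T x i j k + T y i j k"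
      "\<And>c x i j k. T (c *s x) i j k = c * T x i j k"
  shows "(matrix (\<lambda>x. tensor_vec (T x)) *v x) $ idx i j k = T x i j k"
proof -
  have T: "tensor_vec (T x) $ idx i j k = T x i j k" for x i j k
    by (rule tensor_vec_idx) (rule swap)+
  have "Vector_Spaces.linear (*s) (*s) (\<lambda>x. tensor_vec (T x))"
    unfolding Vector_Spaces.linear_iff
    by (auto intro!: vec10_eqI simp: T linear vec.vector_space_axioms)
  from matrix_works[OF this] show ?thesis by (simp add: T)
qed

text \<open>The derivation action of a \<open>3 \<times> 3\<close> matrix on symmetric tensors of degree three. On the Veronese cone it
  is the derivative of the Veronese map: the product rule applied to \<open>v\<^sub>i v\<^sub>j v\<^sub>k\<close> in the direction \<open>Y v\<close>.\<close>

definition rho :: "complex ^ 3 ^ 3 \<Rightarrow> complex ^ 10 ^ 10" where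
  "rho Y = matrix (\<lambda>x. tensor_vec (\<lambda>i j k.
     \<Sum>l\<in>UNIV. Y $ i $ l * x $ idx l j k + Y $ j $ l * x $ idx i l k + Y $ k $ l * x $ idx i j l))"

text \<open>The third symmetric power of a linear map, which satisfies \<open>sym3 b (\<nu> v) = \<nu> (b v)\<close> for the Veronese map \<open>\<nu>\<close>.\<close>

definition sym3 :: "complex ^ 3 ^ 3 \<Rightarrow> complex ^ 10 ^ 10" where
  "sym3 b = matrix (\<lambda>x. tensor_vec (\<lambda>i j k.
     \<Sum>l\<in>UNIV. \<Sum>p\<in>UNIV. \<Sum>q\<in>UNIV. b $ i $ l * b $ j $ p * b $ k $ q * x $ idx l p q))"

lemma rho_idx: "(rho Y *v x) $ idx i j k =
  (\<Sum>l\<in>UNIV. Y $ i $ l * x $ idx l j k + Y $ j $ l * x $ idx i l k + Y $ k $ l * x $ idx i j l)"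
  unfolding rho_def by (rule matrix_tensor_vec_idx)
    (simp_all add: idx_swap ac_simps sum.distrib[symmetric] sum_distrib_left algebra_simps)

lemma sym3_idx: "(sym3 b *v x) $ idx i j k =
  (\<Sum>l\<in>UNIV. \<Sum>p\<in>UNIV. \<Sum>q\<in>UNIV. b $ i $ l * b $ j $ p * b $ k $ q * x $ idx l p q)"
  unfolding sym3_def
proof (rule matrix_tensor_vec_idx, goal_cases)
  case 1
  show ?case by (subst sum.swap) (simp add: idx_swap ac_simps)
next
  case 2
  show ?case by (rule sum.cong[OF refl], subst sum.swap) (simp add: idx_swap ac_simps)
qed (simp_all add: algebra_simps sum.distrib sum_distrib_left)

lemma matrix_vector_mult_3: "(Y *v v) $ i = Y $ i $ 1 * v $ 1 + Y $ i $ 2 * v $ 2 + Y $ i $ 3 * v $ 3"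
  for Y :: "complex ^ 3 ^ 'm"
  by (simp add: matrix_vector_mult_def sum_3)

lemma rho_veronese_idx: "(rho Y *v veronese v) $ idx i j k =
  (Y *v v) $ i * v $ j * v $ k + v $ i * (Y *v v) $ j * v $ k + v $ i * v $ j * (Y *v v) $ k"
  unfolding rho_idx veronese_idx matrix_vector_mult_3 by (simp add: sum_3 algebra_simps)

lemma sym3_tensor_sum: "(\<Sum>l\<in>UNIV. \<Sum>p\<in>UNIV. \<Sum>q\<in>UNIV. b $ i $ l * b $ j $ p * b $ k $ q * (x $ l * y $ p * z $ q)) =
    (b *v x) $ i * (b *v y) $ j * (b *v z) $ k"
  for b :: "complex ^ 3 ^ 3"
proof -
  have "b $ i $ l * b $ j $ p * b $ k $ q * (x $ l * y $ p * z $ q) =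
    (b $ i $ l * x $ l) * (b $ j $ p * y $ p) * (b $ k $ q * z $ q)" for l p q
    by (simp only: ac_simps)
  then show ?thesis
    by (simp only: sum_distrib_left[symmetric] sum_distrib_right[symmetric]) (simp add: matrix_vector_mult_def)
qed

lemma sym3_veronese: "sym3 b *v veronese v = veronese (b *v v)"
  by (rule vec10_eqI) (simp only: sym3_idx veronese_idx sym3_tensor_sum)

lemma rho_add: "rho (Y + Z) = rho Y + rho Z"
  by (rule matrix_eq_on_veronese, rule vec10_eqI)
    (simp add: matrix_vector_mult_add_rdistrib rho_veronese_idx algebra_simps)

lemma scale_mult_vec: "scale c M *v x = c *s (M *v x)"
  by (simp add: scale_def matrix_vector_mult_def vec_eq_iff sum_distrib_left mult.assoc)

lemma rho_scale: "rho (scale c Y) = scale c (rho Y)"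
  by (rule matrix_eq_on_veronese, rule vec10_eqI)
    (simp add: scale_mult_vec rho_veronese_idx algebra_simps)

text \<open>Applying the product rule twice. The terms in which \<open>Y\<close> and \<open>Z\<close> act on different factors are symmetric in
  \<open>Y\<close> and \<open>Z\<close>, so they cancel in the commutator.\<close>

lemma rho_mult_idx: "(rho Y *v (rho Z *v veronese v)) $ idx i j k =
  ((Y ** Z) *v v) $ i * v $ j * v $ k + v $ i * ((Y ** Z) *v v) $ j * v $ k + v $ i * v $ j * ((Y ** Z) *v v) $ k +
  (Y *v v) $ i * (Z *v v) $ j * v $ k + (Z *v v) $ i * (Y *v v) $ j * v $ k +
  (Y *v v) $ i * v $ j * (Z *v v) $ k + (Z *v v) $ i * v $ j * (Y *v v) $ k +
  v $ i * (Y *v v) $ j * (Z *v v) $ k + v $ i * (Z *v v) $ j * (Y *v v) $ k"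
proof -
  have Y: "(\<Sum>l\<in>UNIV. Y $ a $ l * (w $ l * c * d)) = (Y *v w) $ a * c * d"
    "(\<Sum>l\<in>UNIV. Y $ a $ l * (c * w $ l * d)) = c * (Y *v w) $ a * d"
    "(\<Sum>l\<in>UNIV. Y $ a $ l * (c * d * w $ l)) = c * d * (Y *v w) $ a" for a w c d
    unfolding matrix_vector_mult_3 by (simp_all add: sum_3 algebra_simps)
  show ?thesis
    unfolding rho_idx[of Y] rho_veronese_idx
    by (simp only: distrib_left sum.distrib Y matrix_vector_mul_assoc) (simp only: ac_simps)
qed

lemma rho_bracket: "rho (bracket Y Z) = bracket (rho Y) (rho Z)"
  by (rule matrix_eq_on_veronese, rule vec10_eqI)
    (simp only: bracket_def matrix_vector_mult_diff_rdistrib vector_minus_component matrix_vector_mul_assoc[symmetric]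
      rho_mult_idx rho_veronese_idx, simp only: matrix_vector_mul_assoc, simp add: left_diff_distrib right_diff_distrib)

lemma rho_eq_0D:
  assumes "rho Y = 0"
  shows "Y = 0"
proof -
  have "Y $ i $ l = 0" for i l
  proof -
    have "0 = (rho Y *v axis (idx i i l) 1) $ idx i i i" using assms by simp
    also have "\<dots> = 3 * Y $ i $ l"
    proof -
      have "\<forall>a i l. (idx a i i = idx i i l) = (a = l)"
        unfolding forall_3 by (simp add: idx_table)
      then have eq: "idx a i i = idx i i l \<longleftrightarrow> a = l" "idx i a i = idx i i l \<longleftrightarrow> a = l" "idx i i a = idx i i l \<longleftrightarrow> a = l" for a
        by (simp_all add: idx_swap(1)[of i a] idx_swap(2)[of i i a])
      show ?thesis unfolding rho_idx axis_def by (simp add: eq if_distrib[where f = "(*) _"] sum.distrib cong: if_cong)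
    qed
    finally show ?thesis by simp
  qed
  then show ?thesis by (simp add: vec_eq_iff)
qed

lemma sym3_mult: "sym3 a ** sym3 b = sym3 (a ** b)"
  by (rule matrix_eq_on_veronese) (simp add: matrix_vector_mul_assoc[symmetric] sym3_veronese)

lemma sym3_one: "sym3 (mat 1) = mat 1"
  by (rule matrix_eq_on_veronese) (simp add: sym3_veronese)

lemma sym3_rho: "sym3 b ** rho Y = rho (b ** Y ** matrix_inv b) ** sym3 b" if "invertible b"
proof (rule matrix_eq_on_veronese, rule vec10_eqI)
  fix v :: "complex ^ 3" and i j k
  have inv: "(b ** Y ** matrix_inv b) *v (b *v v) = b *v (Y *v v)"
    using that by (simp add: matrix_vector_mul_assoc matrix_mul_assoc[symmetric] matrix_inv_mult)
  have "(sym3 b *v (rho Y *v veronese v)) $ idx i j k =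
    (b *v (Y *v v)) $ i * (b *v v) $ j * (b *v v) $ k + (b *v v) $ i * (b *v (Y *v v)) $ j * (b *v v) $ k +
    (b *v v) $ i * (b *v v) $ j * (b *v (Y *v v)) $ k"
    unfolding sym3_idx rho_veronese_idx by (simp only: distrib_left sum.distrib sym3_tensor_sum)
  also have "\<dots> = (rho (b ** Y ** matrix_inv b) *v veronese (b *v v)) $ idx i j k"
    by (simp only: rho_veronese_idx inv)
  finally show "((sym3 b ** rho Y) *v veronese v) $ idx i j k =
      ((rho (b ** Y ** matrix_inv b) ** sym3 b) *v veronese v) $ idx i j k"
    by (simp only: matrix_vector_mul_assoc[symmetric] sym3_veronese)
qed

section \<open>Irreducibility, and the tangent fields of the Veronese cone\<close>

definition unit_mat :: "3 \<Rightarrow> 3 \<Rightarrow> complex ^ 3 ^ 3" where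
  "unit_mat a b = (\<chi> i j. if i = a \<and> j = b then 1 else 0)"

definition diag_mat :: "(3 \<Rightarrow> complex) \<Rightarrow> complex ^ 3 ^ 3" where
  "diag_mat d = (\<chi> i j. if i = j then d i else 0)"

lemma unit_mat_in_sl: "a \<noteq> b \<Longrightarrow> unit_mat a b \<in> sl \<rat>"
  by (auto simp: sl_def matrices_def unit_mat_def trace_def intro!: sum.neutral)

lemma diag_mat_in_sl: "(\<And>i. d i \<in> \<rat>) \<Longrightarrow> d 1 + d 2 + d 3 = 0 \<Longrightarrow> diag_mat d \<in> sl \<rat>"
  by (simp add: sl_def matrices_def diag_mat_def trace_def sum_3)

lemma rho_diag: "(rho (diag_mat d) *v x) $ idx i j k = (d i + d j + d k) * x $ idx i j k"
proof -
  have "diag_mat d $ a $ l * c = (if l = a then d a * c else 0)" for a l c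
    by (simp add: diag_mat_def)
  then show ?thesis unfolding rho_idx by (simp add: sum.distrib algebra_simps)
qed

lemma rho_unit: "(rho (unit_mat a b) *v x) $ idx i j k =
  (if i = a then x $ idx b j k else 0) + (if j = a then x $ idx i b k else 0) + (if k = a then x $ idx i j b else 0)"
proof -
  have "unit_mat a b $ i $ l * c = (if l = b then if i = a then c else 0 else 0)" for i l c
    by (simp add: unit_mat_def)
  then show ?thesis unfolding rho_idx by (simp add: sum.distrib)
qed

lemma rho_diag_weights:
  obtains w where "\<And>x m. (rho (diag_mat d) *v x) $ m = w m * x $ m"
    and "\<And>i j k. w (idx i j k) = d i + d j + d k"
proof -
  define w where "w m = (rho (diag_mat d) *v (\<chi> n. 1)) $ m" for m
  have w: "w (idx i j k) = d i + d j + d k" for i j k by (simp add: w_def rho_diag)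
  have "(rho (diag_mat d) *v x) $ m = w m * x $ m" for x m
    using rho_diag w by (cases m rule: idx_cases) simp
  then show ?thesis using w that by blast
qed

lemma matrix_vector_mult_axis: "(M *v axis q 1) $ p = M $ p $ q" for M :: "complex ^ 'n ^ 'm"
proof -
  have "M $ p $ n * axis q 1 $ n = (if n = q then M $ p $ q else 0)" for n
    by (simp add: axis_def)
  then show ?thesis by (simp add: matrix_vector_mult_def)
qed

text \<open>Schur's lemma for the restriction of \<open>rho\<close> to the rational matrices, by weights: a commuting matrix is diagonal
  because the weights are distinct, and the unit matrices connect all its diagonal entries.\<close>

lemma rho_irreducible:
  fixes m :: "complex ^ 10 ^ 10"
  assumes comm: "\<And>X. X \<in> sl \<rat> \<Longrightarrow> m ** rho X = rho X ** m"
  obtains c where "\<And>x. m *v x = c *s x"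
proof -
  \<comment> \<open>a rational traceless diagonal matrix for which the ten sums of three entries are distinct\<close>
  define d :: "3 \<Rightarrow> complex" where "d i = (if i = 1 then 1 else if i = 2 then 10 else -11)" for i
  obtain w where w: "\<And>x p. (rho (diag_mat d) *v x) $ p = w p * x $ p"
    and widx: "\<And>i j k. w (idx i j k) = d i + d j + d k"
    using rho_diag_weights[of d] by blast
  have wtab: "w 1 = 3" "w 2 = 30" "w 3 = -33" "w 4 = 12" "w 5 = 9" "w 6 = -21" "w 7 = 21" "w 8 = -12" "w 9 = -9" "w 10 = 0"
    using widx[of 1 1 1] widx[of 2 2 2] widx[of 3 3 3] widx[of 1 1 2] widx[of 2 2 3] widx[of 3 3 1]
      widx[of 1 2 2] widx[of 2 3 3] widx[of 1 1 3] widx[of 1 2 3] by (simp_all add: d_def idx_table)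
  have winj: "w p \<noteq> w q" if "p \<noteq> q" for p q
    using that exhaust_10[of p] exhaust_10[of q] by (elim disjE; simp add: wtab)
  have "diag_mat d \<in> sl \<rat>" by (rule diag_mat_in_sl) (auto simp: d_def)
  note D = comm[OF this]
  have scaled: "M *v y = a *s (M *v x)" if "\<And>p. y $ p = a * x $ p" for M :: "complex ^ 10 ^ 10" and x y a
  proof -
    have "y = a *s x" using that by (simp add: vec_eq_iff)
    then show ?thesis by (simp add: vector_scalar_commute)
  qed
  have diag: "m $ p $ q = 0" if "p \<noteq> q" for p q
  proof -
    have "m *v (rho (diag_mat d) *v axis q 1) = w q *s (m *v axis q 1)"
      by (rule scaled) (simp add: w axis_def)
    then have "(rho (diag_mat d) *v (m *v axis q 1)) $ p = w q * m $ p $ q"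
      by (simp add: matrix_vector_mul_assoc D matrix_vector_mult_axis)
    then have "w p * m $ p $ q = w q * m $ p $ q"
      by (simp add: w matrix_vector_mult_axis)
    then show ?thesis using winj[OF that] by simp
  qed
  have m: "(m *v x) $ p = m $ p $ p * x $ p" for x p
  proof -
    have "(m *v x) $ p = (\<Sum>n\<in>UNIV. if n = p then m $ p $ p * x $ p else 0)"
      unfolding matrix_vector_mult_def vec_lambda_beta
    proof (rule sum.cong)
      show "m $ p $ n * x $ n = (if n = p then m $ p $ p * x $ p else 0)" for n using diag[of p n] by auto
    qed simp
    then show ?thesis by simp
  qed
  define \<mu> where "\<mu> p = m $ p $ p" for p
  have step: "\<mu> (idx a j k) = \<mu> (idx b j k)" if "a \<noteq> b" for a b j k
  proof -
    let ?x = "axis (idx b j k) 1 :: complex ^ 10" and ?E = "rho (unit_mat a b)"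
    have E: "(?E *v ?x) $ idx a j k \<noteq> 0"
    proof -
      have "j = a \<longrightarrow> idx a b k = idx b j k" "k = a \<longrightarrow> idx a j b = idx b j k"
        using idx_swap by metis+
      then show ?thesis unfolding rho_unit by (auto simp: axis_def)
    qed
    have "?E *v (m *v ?x) = \<mu> (idx b j k) *s (?E *v ?x)"
      by (rule scaled) (simp add: m \<mu>_def axis_def)
    then have "(m *v (?E *v ?x)) $ idx a j k = \<mu> (idx b j k) * (?E *v ?x) $ idx a j k"
      by (simp add: matrix_vector_mul_assoc comm[OF unit_mat_in_sl[OF that]])
    then have "\<mu> (idx a j k) * (?E *v ?x) $ idx a j k = \<mu> (idx b j k) * (?E *v ?x) $ idx a j k"
      by (simp add: m \<mu>_def)
    then show ?thesis using E by simp
  qed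
  have "\<mu> p = \<mu> (idx 1 1 1)" for p
  proof (cases p rule: idx_cases)
    case (1 i j k)
    have "\<mu> (idx i j k) = \<mu> (idx 1 j k)" using step by metis
    also have "\<dots> = \<mu> (idx 1 1 k)" using step[of j 1 1 k] idx_swap(1)[of 1 j k] by metis
    also have "\<dots> = \<mu> (idx 1 1 1)" using step[of k 1 1 1] idx_swap(1)[of 1 k 1] idx_swap(2)[of 1 k 1] by metis
    finally show ?thesis using 1 by simp
  qed
  then have "m *v x = \<mu> (idx 1 1 1) *s x" for x
    by (simp add: vec_eq_iff m flip: \<mu>_def)
  then show ?thesis by (rule that)
qed

text \<open>The matrix \<open>diag(1, 1, -2)\<close> has weight \<open>-6\<close> in \<open>rho\<close>, on the monomial \<open>u\<^sup>3\<close>. In the dual its weights are the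
  negatives of numbers that are at most \<open>3\<close>. So an intertwiner kills the weight vector.\<close>

lemma rho_not_self_dual:
  assumes comm: "\<And>X. X \<in> sl \<rat> \<Longrightarrow> m ** rho X = rho (- transpose X) ** m"
  shows "\<not> invertible m"
proof
  assume "invertible m"
  define d :: "3 \<Rightarrow> complex" where "d i = (if i = 3 then -2 else 1)" for i
  have neg: "- transpose (diag_mat d) = diag_mat (\<lambda>i. - d i)"
    by (simp add: diag_mat_def transpose_def vec_eq_iff)
  obtain w where w: "\<And>x p. (rho (diag_mat (\<lambda>i. - d i)) *v x) $ p = w p * x $ p"
    and widx: "\<And>i j k. w (idx i j k) = - d i + - d j + - d k"
    using rho_diag_weights[of "\<lambda>i. - d i"] by blast
  have "diag_mat d \<in> sl \<rat>" by (rule diag_mat_in_sl) (auto simp: d_def)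
  note D = comm[OF this, unfolded neg]
  let ?e = "axis (idx 3 3 3) 1 :: complex ^ 10"
  have "rho (diag_mat d) *v ?e = (-6) *s ?e"
  proof (rule vec10_eqI)
    fix i j k
    have "idx i j k = idx 3 3 3 \<longrightarrow> i = 3 \<and> j = 3 \<and> k = 3"
      using exhaust_3[of i] exhaust_3[of j] exhaust_3[of k] by (elim disjE; simp add: idx_table)
    then show "(rho (diag_mat d) *v ?e) $ idx i j k = ((-6) *s ?e) $ idx i j k"
      unfolding rho_diag by (auto simp: axis_def d_def)
  qed
  then have "m *v (rho (diag_mat d) *v ?e) = (-6) *s (m *v ?e)" by (simp only: vector_scalar_commute)
  then have eigen: "rho (diag_mat (\<lambda>i. - d i)) *v (m *v ?e) = (-6) *s (m *v ?e)"
    by (simp only: matrix_vector_mul_assoc D)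
  have weight: "w p * (m *v ?e) $ p = (-6) * (m *v ?e) $ p" for p
    using w[of "m *v ?e" p] unfolding eigen by simp
  have "w p \<noteq> -6" for p
  proof (cases p rule: idx_cases)
    case (1 i j k)
    show ?thesis unfolding 1 widx d_def by auto
  qed
  then have "(m *v ?e) $ p = 0" for p using weight[of p] mult_right_cancel by blast
  then have "m *v ?e = 0" by (simp add: vec_eq_iff)
  then have "matrix_inv m *v (m *v ?e) = 0" by simp
  then have "?e = 0"
    by (simp only: matrix_vector_mul_assoc matrix_inv_mult[OF \<open>invertible m\<close>] matrix_vector_mul_lid)
  then show False by (simp add: axis_eq_0_iff)
qed

text \<open>The ten monomials in variables that are named relative to a chosen one, so that arguments about \<open>v\<^sub>i\<close> need not be
  repeated for \<open>i = 1, 2, 3\<close>.\<close>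

lemma sum_idx:
  assumes "i \<noteq> j" "i \<noteq> k" "j \<noteq> k"
  shows "sum F (UNIV :: 10 set) = F (idx i i i) + F (idx j j j) + F (idx k k k) + F (idx i i j) + F (idx i i k) +
    F (idx i j j) + F (idx j j k) + F (idx i k k) + F (idx j k k) + (F (idx i j k) :: complex)"
proof -
  have "\<forall>i j k. i \<noteq> j \<and> i \<noteq> k \<and> j \<noteq> k \<longrightarrow> sum F (UNIV :: 10 set) = F (idx i i i) + F (idx j j j) + F (idx k k k) + F (idx i i j) + F (idx i i k) +
    F (idx i j j) + F (idx j j k) + F (idx i k k) + F (idx j k k) + F (idx i j k)"
    unfolding forall_3 by (simp add: idx_table sum_10 ac_simps)
  then show ?thesis using assms by blast
qed

text \<open>The ideal of the Veronese cone contains the binomials \<open>x\<^sub>p x\<^sub>q - x\<^sub>r x\<^sub>s\<close>. The condition says that the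
  derivative of each of them along the linear vector field \<open>X\<close> vanishes on the cone.\<close>

definition tangent_to_cone :: "complex ^ 10 ^ 10 \<Rightarrow> bool" where
  "tangent_to_cone X \<longleftrightarrow> (\<forall>p q r s v. (\<forall>u. veronese u $ p * veronese u $ q = veronese u $ r * veronese u $ s) \<longrightarrow>
     (X *v veronese v) $ p * veronese v $ q + veronese v $ p * (X *v veronese v) $ q =
     (X *v veronese v) $ r * veronese v $ s + veronese v $ r * (X *v veronese v) $ s)"

lemma veronese_has_derivative:
  "((\<lambda>t. veronese (v + t *s (Y *v v)) $ p) has_field_derivative (rho Y *v veronese v) $ p) (at 0)"
proof (cases p rule: idx_cases)
  case (1 i j k)
  show ?thesis unfolding 1 veronese_idx rho_veronese_idx
    by (auto intro!: derivative_eq_intros simp: algebra_simps)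
qed

text \<open>The flow of \<open>rho Y\<close> preserves the cone, so the binomials can be differentiated along curves in the cone.\<close>

lemma tangent_to_cone_rho: "tangent_to_cone (rho Y)"
  unfolding tangent_to_cone_def
proof (intro allI impI)
  fix p q r s v
  let ?v = "\<lambda>t. v + t *s (Y *v v)"
  have D: "((\<lambda>t. veronese (?v t) $ p * veronese (?v t) $ q) has_field_derivative
    (rho Y *v veronese v) $ p * veronese v $ q + veronese v $ p * (rho Y *v veronese v) $ q) (at 0)" for p q
    by (rule derivative_eq_intros veronese_has_derivative)+ (simp add: algebra_simps)
  assume "\<forall>u. veronese u $ p * veronese u $ q = veronese u $ r * veronese u $ s"
  then have "((\<lambda>t. veronese (?v t) $ r * veronese (?v t) $ s) has_field_derivative
    (rho Y *v veronese v) $ p * veronese v $ q + veronese v $ p * (rho Y *v veronese v) $ q) (at 0)"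
    using D[of p q] by simp
  then show "(rho Y *v veronese v) $ p * veronese v $ q + veronese v $ p * (rho Y *v veronese v) $ q =
     (rho Y *v veronese v) $ r * veronese v $ s + veronese v $ r * (rho Y *v veronese v) $ s"
    using D DERIV_unique by blast
qed

lemma tangent_to_cone_diff: "tangent_to_cone X \<Longrightarrow> tangent_to_cone Y \<Longrightarrow> tangent_to_cone (X - Y)"
  unfolding tangent_to_cone_def
proof (intro allI impI, goal_cases)
  case (1 p q r s v)
  let ?L = "\<lambda>X p q. (X *v veronese v) $ p * veronese v $ q + veronese v $ p * (X *v veronese v) $ q"
  have "?L (X - Y) p q = ?L X p q - ?L Y p q" for p q
    by (simp add: matrix_vector_mult_diff_rdistrib algebra_simps)
  moreover have "?L X p q = ?L X r s" "?L Y p q = ?L Y r s" using 1 by blast+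
  ultimately show ?case by simp
qed

lemma tangent_to_coneD:
  assumes "tangent_to_cone X"
    and "\<And>u :: complex ^ 3. u $ a * u $ b * u $ c * (u $ d * u $ e * u $ f) = u $ a' * u $ b' * u $ c' * (u $ d' * u $ e' * u $ f')"
  shows "(X *v veronese v) $ idx a b c * (v $ d * v $ e * v $ f) + v $ a * v $ b * v $ c * (X *v veronese v) $ idx d e f =
     (X *v veronese v) $ idx a' b' c' * (v $ d' * v $ e' * v $ f') + v $ a' * v $ b' * v $ c' * (X *v veronese v) $ idx d' e' f'"
proof -
  have "\<forall>u. veronese u $ idx a b c * veronese u $ idx d e f = veronese u $ idx a' b' c' * veronese u $ idx d' e' f'"
    using assms(2) by (simp add: veronese_idx)
  then show ?thesis using assms(1) unfolding tangent_to_cone_def by (metis veronese_idx)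
qed

text \<open>If \<open>X\<close> is tangent to the cone, then its component at the coordinate of \<open>v\<^sub>i\<^sup>3\<close> is a cubic form divisible by \<open>v\<^sub>i\<^sup>2\<close>, as
  for the derivative of a cube. Write \<open>P\<^sub>a\<^sub>b\<^sub>c\<close> for the component at the coordinate of \<open>v\<^sub>a v\<^sub>b v\<^sub>c\<close>. The binomial
  \<open>x\<^sub>i\<^sub>i\<^sub>j x\<^sub>j\<^sub>j\<^sub>j - x\<^sub>i\<^sub>j\<^sub>j\<^sup>2\<close> gives \<open>P\<^sub>i\<^sub>i\<^sub>j = 0\<close> for \<open>v\<^sub>i = 0\<close>. Then \<open>x\<^sub>i\<^sub>i\<^sub>i x\<^sub>i\<^sub>j\<^sub>j - x\<^sub>i\<^sub>i\<^sub>j\<^sup>2\<close> gives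
  \<open>v\<^sub>j\<^sup>2 P\<^sub>i\<^sub>i\<^sub>i + v\<^sub>i\<^sup>2 P\<^sub>i\<^sub>j\<^sub>j = 2 v\<^sub>i v\<^sub>j P\<^sub>i\<^sub>i\<^sub>j\<close>, whose right-hand side is divisible by \<open>v\<^sub>i\<^sup>2\<close>.\<close>

lemma tangent_row_divisible:
  assumes X: "tangent_to_cone X" and d: "i \<noteq> j" "i \<noteq> k" "j \<noteq> k"
  shows "X $ idx i i i $ idx j j j = 0" "X $ idx i i i $ idx k k k = 0" "X $ idx i i i $ idx i j j = 0"
    "X $ idx i i i $ idx j j k = 0" "X $ idx i i i $ idx i k k = 0" "X $ idx i i i $ idx j k k = 0"
    "X $ idx i i i $ idx i j k = 0"
proof -
  define v :: "complex \<Rightarrow> complex \<Rightarrow> complex ^ 3"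
    where "v x u = (\<chi> l. if l = i then x else if l = j then 1 else u)" for x u
  have v: "v x u $ i = x" "v x u $ j = 1" "v x u $ k = u" for x u
    using d by (simp_all add: v_def)
  \<comment> \<open>the coefficients of a cubic form as a polynomial in \<open>v\<^sub>i\<close>, for \<open>v\<^sub>j = 1\<close> and \<open>v\<^sub>k = u\<close>\<close>
  define c0 c1 c2 c3 where "c0 a u = a $ idx j j j + a $ idx j j k * u + a $ idx j k k * u ^ 2 + a $ idx k k k * u ^ 3"
    and "c1 a u = a $ idx i j j + a $ idx i j k * u + a $ idx i k k * u ^ 2"
    and "c2 a u = a $ idx i i j + a $ idx i i k * u" and "c3 a u = (a $ idx i i i)"
    for a :: "complex ^ 10" and u :: complex
  have expand: "(X *v veronese (v x u)) $ p = c0 (X $ p) u + c1 (X $ p) u * x + c2 (X $ p) u * x ^ 2 + c3 (X $ p) u * x ^ 3" for x u p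
    unfolding matrix_vector_mult_def c0_def c1_def c2_def c3_def
    by (simp add: sum_idx[OF d] veronese_idx v power2_eq_square power3_eq_cube algebra_simps)
  have B0: "c0 (X $ idx i i j) u = 0" for u
  proof -
    have "(X *v veronese (v 0 u)) $ idx i i j = 0"
      using tangent_to_coneD[OF X, of i i j j j j i j j i j j "v 0 u"] by (simp add: v mult_ac)
    then show ?thesis by (simp add: expand)
  qed
  have P: "c0 (X $ idx i i i) u = 0 \<and> c1 (X $ idx i i i) u = 0" for u
  proof -
    let ?p = "X $ idx i i i" and ?a = "X $ idx i j j" and ?b = "X $ idx i i j"
    have "[: c0 ?p u, c1 ?p u, c2 ?p u + c0 ?a u - 2 * c1 ?b u, c3 ?p u + c1 ?a u - 2 * c2 ?b u, c2 ?a u - 2 * c3 ?b u, c3 ?a u :] = 0"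
    proof (rule poly_zero_off_origin)
      fix x :: complex
      assume x: "x \<noteq> 0"
      have "x * ((X *v veronese (v x u)) $ idx i i i + x ^ 2 * (X *v veronese (v x u)) $ idx i j j) =
         x * (2 * x * (X *v veronese (v x u)) $ idx i i j)"
        using tangent_to_coneD[OF X, of i i i i j j i i j i i j "v x u"]
        by (simp add: v power2_eq_square algebra_simps)
      then have "(X *v veronese (v x u)) $ idx i i i + x ^ 2 * (X *v veronese (v x u)) $ idx i j j =
         2 * x * (X *v veronese (v x u)) $ idx i i j"
        using x mult_left_cancel by blast
      then show "poly [: c0 ?p u, c1 ?p u, c2 ?p u + c0 ?a u - 2 * c1 ?b u, c3 ?p u + c1 ?a u - 2 * c2 ?b u, c2 ?a u - 2 * c3 ?b u, c3 ?a u :] x = 0"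
        unfolding expand B0 by (simp add: power2_eq_square power3_eq_cube algebra_simps)
    qed
    then show ?thesis by simp
  qed
  have "X $ idx i i i $ idx j j j = 0 \<and> X $ idx i i i $ idx j j k = 0 \<and> X $ idx i i i $ idx j k k = 0 \<and> X $ idx i i i $ idx k k k = 0"
    by (rule cubic_zero_off_origin) (use P in \<open>simp add: c0_def\<close>)
  moreover have "X $ idx i i i $ idx i j j = 0 \<and> X $ idx i i i $ idx i j k = 0 \<and> X $ idx i i i $ idx i k k = 0 \<and> (0::complex) = 0"
    by (rule cubic_zero_off_origin) (use P in \<open>simp add: c1_def\<close>)
  ultimately show "X $ idx i i i $ idx j j j = 0" "X $ idx i i i $ idx k k k = 0" "X $ idx i i i $ idx i j j = 0"
    "X $ idx i i i $ idx j j k = 0" "X $ idx i i i $ idx i k k = 0" "X $ idx i i i $ idx j k k = 0"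
    "X $ idx i i i $ idx i j k = 0" by simp_all
qed

text \<open>On the torus the binomials determine the components at the mixed monomials by those at the three cubes: for
  \<open>v\<^sub>i\<^sup>2 v\<^sub>j\<close> and \<open>v\<^sub>i v\<^sub>j\<^sup>2\<close> they are two linear equations with nonzero determinant.\<close>

lemma tangent_to_cone_eq_0:
  assumes Z: "tangent_to_cone Z" and cubes: "\<And>i v. (Z *v veronese v) $ idx i i i = 0"
  shows "Z = 0"
proof (rule matrix_eq_on_veronese, rule vec10_eqI)
  fix v :: "complex ^ 3" and a b c
  assume v: "\<And>i. v $ i \<noteq> 0"
  define Q where "Q i j k = (Z *v veronese v) $ idx i j k" for i j k
  have iij: "Q i i j = 0" if "i \<noteq> j" for i j
  proof -
    have "v $ i ^ 2 * (v $ i * Q i j j) = v $ i ^ 2 * (2 * v $ j * Q i i j)"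
      using tangent_to_coneD[OF Z, of i i i i j j i i j i i j v] cubes[of v i]
      by (simp add: Q_def power2_eq_square algebra_simps)
    then have 1: "v $ i * Q i j j = 2 * v $ j * Q i i j" using v[of i] by simp
    have "v $ j ^ 2 * (v $ j * Q i i j) = v $ j ^ 2 * (2 * v $ i * Q i j j)"
      using tangent_to_coneD[OF Z, of i i j j j j i j j i j j v] cubes[of v j]
      by (simp add: Q_def power2_eq_square algebra_simps)
    then have "v $ j * Q i i j = 2 * (v $ i * Q i j j)" using v[of j] by simp
    then have "v $ j * Q i i j = 4 * (v $ j * Q i i j)" using 1 by simp
    then show ?thesis using v[of j] by simp
  qed
  have ijk: "Q i j k = 0" if "i \<noteq> j" "j \<noteq> k" "i \<noteq> k" for i j k
  proof -
    have "Q j k k = 0" using iij[of k j] that idx_swap by (metis Q_def)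
    then have "2 * (v $ i * v $ j * v $ k * Q i j k) = 0"
      using tangent_to_coneD[OF Z, of i j k i j k i i j j k k v] iij[of i j] that
      by (auto simp: Q_def algebra_simps)
    then show ?thesis using v[of i] v[of j] v[of k] by simp
  qed
  have "Q a b c = 0"
  proof (cases "a = b \<or> b = c \<or> a = c")
    case True
    then show ?thesis using iij cubes idx_swap unfolding Q_def by metis
  qed (use ijk in blast)
  then show "(Z *v veronese v) $ idx a b c = (0 *v veronese v) $ idx a b c"
    by (simp add: Q_def)
qed

lemma other_indices:
  fixes i :: 3
  obtains j k where "i \<noteq> j" "i \<noteq> k" "j \<noteq> k" "UNIV = {i, j, k}"
proof -
  have *: "\<exists>j k. i \<noteq> j \<and> i \<noteq> k \<and> j \<noteq> k \<and> UNIV = {i, j, k}" if "i = 1 \<and> j = 2 \<and> k = 3 \<or> i = 2 \<and> j = 3 \<and> k = 1 \<or> i = 3 \<and> j = 1 \<and> k = 2" for j k :: 3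
  proof (rule exI[of _ j], rule exI[of _ k], intro conjI)
    have "x \<in> {i, j, k}" for x using that exhaust_3[of x] by auto
    then show "UNIV = {i, j, k}" by blast
  qed (use that in auto)
  have "\<exists>j k. i \<noteq> j \<and> i \<noteq> k \<and> j \<noteq> k \<and> UNIV = {i, j, k}"
    using exhaust_3[of i] * by blast
  then show ?thesis using that by blast
qed

text \<open>By \<open>tangent_row_divisible\<close> the components of \<open>X\<close> at the three cubes agree with those of some \<open>rho Y\<close>, and the difference
  vanishes by \<open>tangent_to_cone_eq_0\<close>. So the linear vector fields tangent to the Veronese cone form a copy of \<open>gl\<^sub>3\<close>.\<close>

lemma tangent_to_cone_imp_rho:
  assumes X: "tangent_to_cone X"
  obtains Y where "X = rho Y"
proof -
  define Y :: "complex ^ 3 ^ 3" where "Y = (\<chi> i l. X $ idx i i i $ idx i i l / 3)"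
  have "(X *v veronese v) $ idx i i i = (rho Y *v veronese v) $ idx i i i" for v i
  proof -
    obtain j k where d: "i \<noteq> j" "i \<noteq> k" "j \<noteq> k" and UNIV: "UNIV = {i, j, k}"
      by (rule other_indices)
    have "(X *v veronese v) $ idx i i i = X $ idx i i i $ idx i i i * v $ i ^ 3 +
        X $ idx i i i $ idx i i j * (v $ i ^ 2 * v $ j) + X $ idx i i i $ idx i i k * (v $ i ^ 2 * v $ k)"
      unfolding matrix_vector_mult_def
      by (simp add: sum_idx[OF d] tangent_row_divisible[OF X d] veronese_idx power2_eq_square power3_eq_cube)
    also have "\<dots> = 3 * (Y *v v) $ i * v $ i ^ 2"
      unfolding matrix_vector_mult_def UNIV using d
      by (simp add: Y_def power2_eq_square power3_eq_cube algebra_simps)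
    finally show ?thesis by (simp add: rho_veronese_idx power2_eq_square algebra_simps)
  qed
  then have "X - rho Y = 0"
    by (intro tangent_to_cone_eq_0 tangent_to_cone_diff X tangent_to_cone_rho)
      (simp add: matrix_vector_mult_diff_rdistrib)
  then show ?thesis using that by simp
qed

section \<open>Homomorphisms from the Lie algebra of traceless matrices\<close>

definition cols3 :: "(3 \<Rightarrow> complex ^ 3) \<Rightarrow> complex ^ 3 ^ 3" where
  "cols3 f = (\<chi> i j. f j $ i)"

lemma cols3_mult: "cols3 f *v x = x $ 1 *s f 1 + x $ 2 *s f 2 + x $ 3 *s f 3"
  by (simp add: vec_eq_iff matrix_vector_mult_3 cols3_def algebra_simps)

lemma cols3_invertible:
  assumes "\<And>a b c. a *s f 1 + b *s f 2 + c *s f 3 = 0 \<Longrightarrow> a = 0 \<and> b = 0 \<and> c = 0"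
  shows "invertible (cols3 f)"
proof -
  have "x = 0" if "cols3 f *v x = 0" for x
  proof -
    have "x $ 1 = 0 \<and> x $ 2 = 0 \<and> x $ 3 = 0" using assms that unfolding cols3_mult by blast
    then show ?thesis by (simp add: vec_eq_iff forall_3)
  qed
  then show ?thesis using matrix_left_invertible_ker invertible_left_inverse by blast
qed

lemma basis3:
  fixes p q r z :: "complex ^ 3"
  assumes "\<And>a b c. a *s p + b *s q + c *s r = 0 \<Longrightarrow> a = 0 \<and> b = 0 \<and> c = 0"
  obtains a b c where "z = a *s p + b *s q + c *s r"
proof -
  define f where "f j = (if j = 1 then p else if j = 2 then q else r)" for j :: 3
  have f: "f 1 = p" "f 2 = q" "f 3 = r" by (simp_all add: f_def)
  have inv: "invertible (cols3 f)" by (rule cols3_invertible) (use assms in \<open>simp add: f\<close>)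
  have "z = cols3 f *v (matrix_inv (cols3 f) *v z)"
    by (simp add: matrix_vector_mul_assoc matrix_inv_mult[OF inv])
  then show ?thesis unfolding cols3_mult f using that by blast
qed

lemma cayley_hamilton_3:
  fixes x :: "complex ^ 3 ^ 3"
  obtains e2 e3 where "x ** x ** x = scale (trace x) (x ** x) - scale e2 x + scale e3 (mat 1)"
    and "trace (x ** x) = trace x ^ 2 - 2 * e2"
proof
  define a b c d e f g h i where abc: "a = x $ 1 $ 1" "b = x $ 1 $ 2" "c = x $ 1 $ 3" "d = x $ 2 $ 1" "e = x $ 2 $ 2"
    "f = x $ 2 $ 3" "g = x $ 3 $ 1" "h = x $ 3 $ 2" "i = x $ 3 $ 3"
  show "x ** x ** x = scale (trace x) (x ** x) - scale (a * e - b * d + a * i - c * g + e * i - f * h) x +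
      scale (a * e * i - a * f * h - b * d * i + b * f * g + c * d * h - c * e * g) (mat 1)"
    unfolding vec_eq_iff forall_3
    by (simp add: matrix_matrix_mult_def sum_3 trace_def scale_def mat_def abc[symmetric]) (simp add: algebra_simps)
  show "trace (x ** x) = trace x ^ 2 - 2 * (a * e - b * d + a * i - c * g + e * i - f * h)"
    by (simp add: matrix_matrix_mult_def sum_3 trace_def abc[symmetric] power2_eq_square algebra_simps)
qed

lemma trace_scale: "trace (scale c x) = c * trace x"
  by (simp add: trace_def scale_def sum_distrib_left)

lemma scale_mult_left: "scale c x ** y = scale c (x ** y)" and scale_mult_right: "x ** scale c y = scale c (x ** y)"
  by (simp_all add: scale_def matrix_matrix_mult_def vec_eq_iff sum_distrib_left mult_ac)

lemma scale_zero [simp]: "scale 0 x = 0" and scale_0_right [simp]: "scale c 0 = 0"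
  by (simp_all add: scale_def vec_eq_iff)

lemma matrix_diff_mult_left: "(A - B) ** C = A ** C - B ** C" and matrix_diff_mult_right: "C ** (A - B) = C ** A - C ** B"
  and matrix_add_mult_left: "(A + B) ** C = A ** C + B ** C"
  for A B C :: "complex ^ 'n ^ 'n"
  by (simp_all add: matrix_matrix_mult_def vec_eq_iff algebra_simps sum_subtractf sum.distrib)

lemma trace_bracket_mult:
  assumes "x ** y = y ** x"
  shows "trace (bracket h x ** y) = 0"
proof -
  have "trace (h ** x ** y) = trace (h ** y ** x)"
    using assms by (simp add: matrix_mul_assoc[symmetric])
  also have "\<dots> = trace (x ** h ** y)"
    by (metis matrix_mul_assoc trace_mul_sym)
  finally show ?thesis
    by (simp add: bracket_def matrix_diff_mult_left trace_sub)
qed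

text \<open>If \<open>[h, x] = \<alpha> x\<close> and \<open>\<alpha> \<noteq> 0\<close>, then \<open>\<alpha> x\<^sup>k\<close> is up to a factor a commutator, so all powers of \<open>x\<close> have trace zero.
  By the Cayley-Hamilton theorem \<open>x\<^sup>3 = 0\<close>.\<close>

lemma eigenvector_of_ad_nilpotent:
  fixes x h :: "complex ^ 3 ^ 3"
  assumes "bracket h x = scale \<alpha> x" "\<alpha> \<noteq> 0"
  shows "x ** x ** x = 0"
proof -
  have tr: "trace (x ** y) = 0" if "x ** y = y ** x" for y
    using trace_bracket_mult[OF that, of h] assms by (simp add: scale_mult_left trace_scale)
  obtain e2 e3 where e: "x ** x ** x = scale (trace x) (x ** x) - scale e2 x + scale e3 (mat 1)"
    "trace (x ** x) = trace x ^ 2 - 2 * e2"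
    by (rule cayley_hamilton_3)
  have "trace x = 0" using tr[of "mat 1"] by simp
  moreover have "trace (x ** x) = 0" using tr[of x] by simp
  ultimately have 3: "x ** x ** x = scale e3 (mat 1)" using e by simp
  have "trace (x ** (x ** x)) = 0" using tr[of "x ** x"] by (simp add: matrix_mul_assoc)
  then have "e3 = 0" using 3 by (simp add: matrix_mul_assoc trace_scale trace_I)
  then show ?thesis using 3 by simp
qed

text \<open>If \<open>x\<^sup>2 \<noteq> 0\<close> then \<open>x\<close> has a cyclic vector \<open>v\<close>, so matrices that commute with \<open>x\<close> act on \<open>v\<close> as polynomials in \<open>x\<close> and
  commute with each other there. But \<open>a\<close> and \<open>b\<close> have commutator \<open>x\<close>.\<close>

lemma heisenberg_square_zero:
  fixes x a b :: "complex ^ 3 ^ 3"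
  assumes x3: "x ** x ** x = 0" and x: "x = bracket a b" and ax: "a ** x = x ** a" and bx: "b ** x = x ** b"
  shows "x ** x = 0"
proof (rule ccontr)
  assume "x ** x \<noteq> 0"
  then obtain v where v: "x *v (x *v v) \<noteq> 0"
    by (metis matrix_eq matrix_vector_mul_assoc matrix_vector_mult_0)
  have x3v: "x *v (x *v (x *v v)) = 0" using x3 by (simp add: matrix_vector_mul_assoc matrix_mul_assoc)
  have ind: "c0 = 0 \<and> c1 = 0 \<and> c2 = 0" if eq: "c0 *s v + c1 *s (x *v v) + c2 *s (x *v (x *v v)) = 0" for c0 c1 c2
  proof -
    have "x *v (x *v (c0 *s v + c1 *s (x *v v) + c2 *s (x *v (x *v v)))) = c0 *s (x *v (x *v v))"
      by (simp add: matrix_vector_right_distrib vector_scalar_commute x3v)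
    then have c0: "c0 = 0" using eq v by simp
    have "x *v (c0 *s v + c1 *s (x *v v) + c2 *s (x *v (x *v v))) = c1 *s (x *v (x *v v))"
      using c0 by (simp add: matrix_vector_right_distrib vector_scalar_commute x3v)
    then have "c1 = 0" using eq v by simp
    then show ?thesis using c0 eq v by simp
  qed
  obtain p0 p1 p2 where p: "a *v v = p0 *s v + p1 *s (x *v v) + p2 *s (x *v (x *v v))" by (rule basis3[OF ind])
  obtain q0 q1 q2 where q: "b *v v = q0 *s v + q1 *s (x *v v) + q2 *s (x *v (x *v v))" by (rule basis3[OF ind])
  have a: "a *v (x *v w) = x *v (a *v w)" and b: "b *v (x *v w) = x *v (b *v w)" for w
    using ax bx by (simp_all add: matrix_vector_mul_assoc)
  have "a *v (b *v v) = b *v (a *v v)"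
    unfolding p q
    by (simp add: matrix_vector_right_distrib vector_scalar_commute a b p q x3v)
      (simp add: vec_eq_iff algebra_simps)
  then have "x *v v = 0"
    by (simp add: x bracket_def matrix_vector_mult_diff_rdistrib matrix_vector_mul_assoc[symmetric])
  then show False using v by simp
qed

text \<open>A \<open>3 \<times> 3\<close> matrix with square zero has rank at most one: otherwise \<open>x z\<close>, \<open>x z'\<close>, \<open>z\<close> is a basis, whose image
  lies in the line of \<open>x z\<close>.\<close>

lemma square_zero_image_line:
  fixes x :: "complex ^ 3 ^ 3"
  assumes x2: "x ** x = 0" and z: "x *v z \<noteq> 0"
  obtains c where "x *v z' = c *s (x *v z)"
proof (rule ccontr)
  assume "\<not> thesis"
  then have no: "x *v z' \<noteq> c *s (x *v z)" for c using that by blast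
  have x2v: "x *v (x *v w) = 0" for w using x2 by (simp add: matrix_vector_mul_assoc)
  have ind: "a = 0 \<and> b = 0 \<and> c = 0" if eq: "a *s (x *v z) + b *s (x *v z') + c *s z = 0" for a b c
  proof -
    have "x *v (a *s (x *v z) + b *s (x *v z') + c *s z) = c *s (x *v z)"
      by (simp add: matrix_vector_right_distrib vector_scalar_commute x2v)
    then have c: "c = 0" using eq z by simp
    have b: "b = 0"
    proof (rule ccontr)
      assume b: "b \<noteq> 0"
      have "x *v z' = (- a / b) *s (x *v z)"
        unfolding vec_eq_iff
      proof
        fix i
        have "a * (x *v z) $ i + b * (x *v z') $ i = 0"
          using arg_cong[OF eq, of "\<lambda>w. w $ i"] c by simp
        then show "(x *v z') $ i = ((- a / b) *s (x *v z)) $ i"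
          using b by (simp add: field_simps eq_neg_iff_add_eq_0)
      qed
      then show False using no by blast
    qed
    show ?thesis using eq z b c by simp
  qed
  obtain a b c where "z' = a *s (x *v z) + b *s (x *v z') + c *s z" by (rule basis3[OF ind])
  then have "x *v z' = x *v (a *s (x *v z) + b *s (x *v z') + c *s z)" by simp
  then have "x *v z' = c *s (x *v z)"
    by (simp add: matrix_vector_right_distrib vector_scalar_commute x2v)
  then show False using no by blast
qed

text \<open>If \<open>x y z \<noteq> 0\<close>, then the image of \<open>y\<close> is the line of \<open>y x z = x y z\<close>. This line contains \<open>y z\<close> and is killed by \<open>x\<close>,
  so \<open>x y z = 0\<close>.\<close>

lemma commuting_square_zero:
  fixes x y :: "complex ^ 3 ^ 3"
  assumes x2: "x ** x = 0" and y2: "y ** y = 0" and comm: "x ** y = y ** x"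
  shows "x ** y = 0"
proof (rule ccontr)
  assume "x ** y \<noteq> 0"
  then obtain z where z: "x *v (y *v z) \<noteq> 0"
    by (metis matrix_eq matrix_vector_mul_assoc matrix_vector_mult_0)
  have "x *v (y *v z) = y *v (x *v z)" using comm by (simp add: matrix_vector_mul_assoc)
  then obtain c where "y *v z = c *s (x *v (y *v z))"
    using square_zero_image_line[OF y2, of "x *v z" z] z by metis
  then have "x *v (y *v z) = c *s (x *v (x *v (y *v z)))" by (metis vector_scalar_commute)
  then show False using z x2 by (simp add: matrix_vector_mul_assoc matrix_mul_assoc)
qed

text \<open>The relations of the unit matrices \<open>E\<^sub>i\<^sub>j\<close> with \<open>i \<noteq> j\<close> in \<open>sl\<^sub>3\<close>, to be satisfied by the images of these
  matrices under an injective homomorphism.\<close>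

definition sl3_system :: "(3 \<Rightarrow> 3 \<Rightarrow> complex ^ 3 ^ 3) \<Rightarrow> bool" where
  "sl3_system F \<longleftrightarrow>
     (\<forall>i j k. i \<noteq> j \<and> j \<noteq> k \<and> i \<noteq> k \<longrightarrow>
        bracket (F i j) (F j k) = F i k \<and> bracket (F i j) (F k j) = 0 \<and> bracket (F i j) (F i k) = 0) \<and>
     (\<forall>i j. i \<noteq> j \<longrightarrow> F i j \<noteq> 0 \<and> bracket (bracket (F i j) (F j i)) (F i j) = scale 2 (F i j))"

lemma bracket_eq_0_iff: "bracket x y = 0 \<longleftrightarrow> x ** y = y ** x"
  by (simp add: bracket_def)

lemma third_index:
  obtains k :: 3 where "k \<noteq> i" "k \<noteq> j"
proof -
  obtain k l where "i \<noteq> k" "i \<noteq> l" "k \<noteq> l" by (rule other_indices)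
  then show ?thesis using that[of k] that[of l] by metis
qed

context
  fixes F
  assumes F: "sl3_system F"
begin

text \<open>\<open>F i j\<close> is the central element of the Heisenberg algebra of \<open>F i k\<close> and \<open>F k j\<close>.\<close>

lemma system_square: "i \<noteq> j \<Longrightarrow> F i j ** F i j = 0"
proof -
  assume ij: "i \<noteq> j"
  obtain k where k: "k \<noteq> i" "k \<noteq> j" by (rule third_index)
  show ?thesis
  proof (rule heisenberg_square_zero)
    show "F i j ** F i j ** F i j = 0"
      by (rule eigenvector_of_ad_nilpotent[of _ _ 2]) (use F ij in \<open>auto simp: sl3_system_def\<close>)
    show "F i j = bracket (F i k) (F k j)" using F ij k unfolding sl3_system_def by metis
    show "F i k ** F i j = F i j ** F i k" "F k j ** F i j = F i j ** F k j"
      using F ij k unfolding sl3_system_def bracket_eq_0_iff by metis+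
  qed
qed

lemma system_square_vec: "i \<noteq> j \<Longrightarrow> F i j *v (F i j *v z) = 0"
  using system_square by (simp add: matrix_vector_mul_assoc)

lemma system_xyx_vec: "i \<noteq> j \<Longrightarrow> F i j *v (F j i *v (F i j *v z)) = F i j *v z"
proof -
  assume ij: "i \<noteq> j"
  have "bracket (bracket (F i j) (F j i)) (F i j) *v z = 2 *s (F i j *v z)"
    using F ij by (simp add: sl3_system_def scale_mult_vec)
  then have "2 *s (F i j *v (F j i *v (F i j *v z))) = 2 *s (F i j *v z)"
    using system_square_vec[OF ij]
    by (simp add: bracket_def matrix_vector_mult_diff_rdistrib matrix_vector_mult_diff_distrib matrix_vector_mul_assoc[symmetric])
      (simp add: vec_eq_iff)
  then show ?thesis by simp
qed

lemma system_orthogonal: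
  assumes "i \<noteq> j" "j \<noteq> k" "i \<noteq> k"
  shows "F i j *v (F k j *v z) = 0" "F i j *v (F i k *v z) = 0"
proof -
  have "F i j ** F k j = 0" "F i j ** F i k = 0"
    by (rule commuting_square_zero; use assms F system_square in \<open>auto simp: sl3_system_def simp flip: bracket_eq_0_iff\<close>)+
  then show "F i j *v (F k j *v z) = 0" "F i j *v (F i k *v z) = 0"
    by (simp_all add: matrix_vector_mul_assoc)
qed

lemma system_bracket_vec:
  assumes "i \<noteq> j" "j \<noteq> k" "i \<noteq> k"
  shows "F i j *v (F j k *v z) = F i k *v z + F j k *v (F i j *v z)"
proof -
  have "F i k = F i j ** F j k - F j k ** F i j"
    using F assms by (simp add: sl3_system_def bracket_def)
  then show ?thesis
    by (simp add: matrix_vector_mult_diff_rdistrib matrix_vector_mul_assoc)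
qed

text \<open>For a highest weight vector \<open>u\<close> this is the relation between the coroots: the coroot of the highest root of
  \<open>sl\<^sub>3\<close> is the sum of the two simple coroots.\<close>

lemma system_coroot_sum:
  assumes u: "F 1 2 *v u = 0" "F 2 3 *v u = 0"
  shows "F 1 2 *v (F 2 1 *v u) + F 2 3 *v (F 3 2 *v u) = F 1 3 *v (F 3 1 *v u)"
proof -
  have "F 2 3 *v (F 3 1 *v u) = F 2 1 *v u" using system_bracket_vec[of 2 3 1 u] u by simp
  moreover have "F 1 2 *v (F 3 1 *v u) = - (F 3 2 *v u)"
    using system_bracket_vec[of 3 1 2 u] u by (simp add: eq_neg_iff_add_eq_0 add.commute)
  ultimately show ?thesis
    using system_bracket_vec[of 1 2 3 "F 3 1 *v u"] by (simp add: vec.neg)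
qed

text \<open>If the highest weight vector \<open>u\<close> has weight one for the first simple coroot, then \<open>u\<close>, \<open>F 2 1 u\<close>, \<open>F 3 1 u\<close> is a
  basis on which the \<open>F i j\<close> act as unit matrices.\<close>

lemma standard_system:
  assumes u: "u \<noteq> 0" "u = F 1 3 *v z" and P: "F 1 2 *v (F 2 1 *v u) = u"
  obtains b where "invertible b" "\<And>i j. i \<noteq> j \<Longrightarrow> F i j ** b = b ** unit_mat i j"
proof -
  have u0: "F 1 2 *v u = 0" "F 1 3 *v u = 0" "F 2 3 *v u = 0"
    using system_orthogonal[of 1 2 3] system_orthogonal[of 2 3 1] system_square_vec[of 1 3] by (simp_all add: u(2))
  have P13: "F 1 3 *v (F 3 1 *v u) = u" using system_xyx_vec[of 1 3 z] u by simp
  have "F 2 3 *v (F 3 2 *v u) = 0" using system_coroot_sum[OF u0(1,3)] P P13 by simp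
  then have 32: "F 3 2 *v u = 0" using system_xyx_vec[of 3 2 u] by simp
  define f where "f k = (if k = 1 then u else F k 1 *v u)" for k
  have f: "f 1 = u" "f 2 = F 2 1 *v u" "f 3 = F 3 1 *v u" by (simp_all add: f_def)
  have 2: "F 1 2 *v f 2 = u" "F 1 3 *v f 2 = 0" "F 2 3 *v f 2 = 0" "F 2 1 *v f 2 = 0" "F 3 1 *v f 2 = 0" "F 3 2 *v f 2 = f 3"
    using P system_bracket_vec[of 2 1 3 u] u0 system_orthogonal(2)[of 2 3 1 u] system_square_vec[of 2 1 u]
      system_orthogonal(1)[of 3 1 2 u] system_bracket_vec[of 3 2 1 u] 32 unfolding f by simp_all
  have 3: "F 1 3 *v f 3 = u" "F 1 2 *v f 3 = 0" "F 2 3 *v f 3 = f 2" "F 2 1 *v f 3 = 0" "F 3 1 *v f 3 = 0" "F 3 2 *v f 3 = 0"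
    using P13 system_bracket_vec[of 3 1 2 u] u0 system_orthogonal(1)[of 2 1 3 u] system_square_vec[of 3 1 u]
      system_orthogonal(2)[of 3 2 1 u] system_bracket_vec[of 2 3 1 u] 32 unfolding f by simp_all
  have inv: "invertible (cols3 f)"
  proof (rule cols3_invertible)
    fix a b c
    assume eq: "a *s f 1 + b *s f 2 + c *s f 3 = 0"
    have "F 1 2 *v (a *s f 1 + b *s f 2 + c *s f 3) = b *s u" "F 1 3 *v (a *s f 1 + b *s f 2 + c *s f 3) = c *s u"
      by (simp_all add: matrix_vector_right_distrib vector_scalar_commute 2 3 f(1) u0)
    then have "b = 0" "c = 0" using eq u(1) by simp_all
    then show "a = 0 \<and> b = 0 \<and> c = 0" using eq u(1) f(1) by simp
  qed
  have "F i j *v (cols3 f *v x) = cols3 f *v (unit_mat i j *v x)" if "i \<noteq> j" for i j x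
  proof -
    have "(unit_mat i j *v x) $ k = (if k = i then x $ j else 0)" for k
      using exhaust_3[of j] by (auto simp: unit_mat_def matrix_vector_mult_3)
    then show ?thesis
      using that exhaust_3[of i] exhaust_3[of j] unfolding cols3_mult
      by (elim disjE; simp add: matrix_vector_right_distrib vector_scalar_commute 2 3 u0 32; simp add: f u0 32)
  qed
  then have "F i j ** cols3 f = cols3 f ** unit_mat i j" if "i \<noteq> j" for i j
    using that by (simp add: matrix_eq matrix_vector_mul_assoc[symmetric])
  then show ?thesis using inv that by blast
qed

text \<open>Every nonzero vector in the image of \<open>F 1 3\<close> is a highest weight vector. As \<open>F 1 2 F 2 1\<close> maps the line of \<open>u\<close> to
  itself and is idempotent on it, the weight of \<open>u\<close> for the first simple coroot is \<open>1\<close> or \<open>0\<close>. In the second case the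
  weight for the other simple coroot is \<open>1\<close>, because the sum of the two is \<open>1\<close>.\<close>

lemma standard_or_dual:
  obtains u z where "u \<noteq> 0" "u = F 1 3 *v z" "F 1 2 *v (F 2 1 *v u) = u \<or> F 2 3 *v (F 3 2 *v u) = u"
proof -
  have "F 1 3 \<noteq> 0" using F by (simp add: sl3_system_def)
  then obtain z where z: "F 1 3 *v z \<noteq> 0" by (metis matrix_eq matrix_vector_mult_0)
  define u where "u = F 1 3 *v z"
  have u0: "F 1 2 *v u = 0" "F 1 3 *v u = 0" "F 2 3 *v u = 0"
    using system_orthogonal[of 1 2 3] system_orthogonal[of 2 3 1] system_square_vec[of 1 3] by (simp_all add: u_def)
  have P13: "F 1 3 *v (F 3 1 *v u) = u" using system_xyx_vec[of 1 3 z] by (simp add: u_def)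
  have "F 1 2 *v (F 2 1 *v u) = F 1 2 *v (F 2 3 *v z)"
  proof -
    have "F 2 1 *v u = F 2 3 *v z + F 1 3 *v (F 2 1 *v z)"
      using system_bracket_vec[of 2 1 3 z] by (simp add: u_def)
    then show ?thesis using system_orthogonal(2)[of 1 2 3] by (simp add: matrix_vector_right_distrib)
  qed
  also have "\<dots> = u + F 2 3 *v (F 1 2 *v z)"
    using system_bracket_vec[of 1 2 3 z] by (simp add: u_def)
  also have "F 2 3 *v (F 1 2 *v z) = - (F 1 3 *v (F 2 1 *v (F 1 2 *v z)))"
    using system_bracket_vec[of 2 1 3 "F 1 2 *v z"] system_orthogonal(2)[of 1 3 2 z]
    by (simp add: eq_neg_iff_add_eq_0)
  finally have "F 1 2 *v (F 2 1 *v u) = F 1 3 *v (z - F 2 1 *v (F 1 2 *v z))"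
    by (simp add: u_def matrix_vector_mult_diff_distrib)
  moreover have "F 1 3 ** F 1 3 = 0" by (rule system_square) simp
  then obtain c where "F 1 3 *v (z - F 2 1 *v (F 1 2 *v z)) = c *s u"
    unfolding u_def using z by (rule square_zero_image_line)
  ultimately have c: "F 1 2 *v (F 2 1 *v u) = c *s u" by simp
  have "c *s (c *s u) = F 1 2 *v (F 2 1 *v (c *s u))"
    by (simp add: vector_scalar_commute c)
  also have "\<dots> = F 1 2 *v (F 2 1 *v (F 1 2 *v (F 2 1 *v u)))" by (simp only: c)
  also have "\<dots> = c *s u" using system_xyx_vec[of 1 2 "F 2 1 *v u"] c by simp
  finally have "c * c = c" using z by (simp add: u_def vector_smult_assoc)
  then have "c = 0 \<or> c = 1" by simp
  then have "F 1 2 *v (F 2 1 *v u) = u \<or> F 2 3 *v (F 3 2 *v u) = u"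
    using c system_coroot_sum[OF u0(1,3)] P13 by auto
  then show ?thesis using that z u_def by blast
qed

end

lemma sl3_system_dual:
  assumes F: "sl3_system F" and \<sigma>: "inj \<sigma>"
  shows "sl3_system (\<lambda>i j. - F (\<sigma> j) (\<sigma> i))"
proof -
  have neg: "bracket (- x) (- y) = bracket x y" "bracket (- x) y = - bracket x y" "bracket x y = - bracket y x"
     "scale c (- x) = - scale c x" for x y :: "complex ^ 3 ^ 3" and c
    by (simp_all add: bracket_def matrix_matrix_mult_def vec_eq_iff sum_negf scale_def)
  have \<sigma>': "\<sigma> i \<noteq> \<sigma> j" if "i \<noteq> j" for i j using \<sigma> that by (auto dest: injD)
  show ?thesis
    unfolding sl3_system_def
  proof (intro conjI allI impI)
    fix i j k :: 3
    assume d: "i \<noteq> j \<and> j \<noteq> k \<and> i \<noteq> k"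
    then have B: "bracket (F (\<sigma> k) (\<sigma> j)) (F (\<sigma> j) (\<sigma> i)) = F (\<sigma> k) (\<sigma> i)"
      "bracket (F (\<sigma> j) (\<sigma> i)) (F (\<sigma> j) (\<sigma> k)) = 0" "bracket (F (\<sigma> j) (\<sigma> i)) (F (\<sigma> k) (\<sigma> i)) = 0"
      using F \<sigma>' unfolding sl3_system_def by metis+
    show "bracket (- F (\<sigma> j) (\<sigma> i)) (- F (\<sigma> k) (\<sigma> j)) = - F (\<sigma> k) (\<sigma> i)"
      using B(1) neg(1) neg(3) by metis
    show "bracket (- F (\<sigma> j) (\<sigma> i)) (- F (\<sigma> j) (\<sigma> k)) = 0" "bracket (- F (\<sigma> j) (\<sigma> i)) (- F (\<sigma> k) (\<sigma> i)) = 0"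
      using B(2,3) neg(1) by simp_all
  next
    fix i j :: 3
    assume "i \<noteq> j"
    then have B: "F (\<sigma> j) (\<sigma> i) \<noteq> 0"
      "bracket (bracket (F (\<sigma> j) (\<sigma> i)) (F (\<sigma> i) (\<sigma> j))) (F (\<sigma> j) (\<sigma> i)) = scale 2 (F (\<sigma> j) (\<sigma> i))"
      using F \<sigma>' unfolding sl3_system_def by metis+
    then show "- F (\<sigma> j) (\<sigma> i) \<noteq> 0" by simp
    have neg': "bracket x (- y) = - bracket x y" for x y :: "complex ^ 3 ^ 3"
      by (simp add: bracket_def matrix_matrix_mult_def vec_eq_iff sum_negf)
    then show "bracket (bracket (- F (\<sigma> j) (\<sigma> i)) (- F (\<sigma> i) (\<sigma> j))) (- F (\<sigma> j) (\<sigma> i)) = scale 2 (- F (\<sigma> j) (\<sigma> i))"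
      by (simp only: neg(2,4) neg' minus_minus B(2))
  qed
qed

text \<open>If the highest weight vector belongs to the second simple coroot, then \<open>standard_system\<close> applies to the dual system
  \<open>- F (\<sigma> j) (\<sigma> i)\<close>, where \<open>\<sigma>\<close> exchanges \<open>1\<close> and \<open>3\<close>. With this \<open>\<sigma>\<close> the matrix at \<open>(1, 3)\<close> changes only by a
  sign, so that \<open>u\<close> is still in its image.\<close>

lemma sl3_system_classification:
  assumes F: "sl3_system F"
  obtains b where "invertible b" "\<And>i j. i \<noteq> j \<Longrightarrow> F i j ** b = b ** unit_mat i j"
  | b where "invertible b" "\<And>i j. i \<noteq> j \<Longrightarrow> F i j ** b = b ** (- transpose (unit_mat i j))"
proof -
  obtain u z where uz: "u \<noteq> 0" "u = F 1 3 *v z" "F 1 2 *v (F 2 1 *v u) = u \<or> F 2 3 *v (F 3 2 *v u) = u"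
    by (rule standard_or_dual[OF F])
  show ?thesis
  proof (cases "F 1 2 *v (F 2 1 *v u) = u")
    case True
    from standard_system[OF F uz(1,2) this] show ?thesis using that(1) by metis
  next
    case False
    define \<sigma> :: "3 \<Rightarrow> 3" where "\<sigma> i = (if i = 1 then 3 else if i = 2 then 2 else 1)" for i
    have \<sigma>: "\<sigma> 1 = 3" "\<sigma> 2 = 2" "\<sigma> 3 = 1" by (simp_all add: \<sigma>_def)
    have \<sigma>\<sigma>: "\<sigma> (\<sigma> i) = i" for i using exhaust_3[of i] \<sigma> by auto
    define F' where "F' i j = - F (\<sigma> j) (\<sigma> i)" for i j
    have neg: "(- M) *v x = - (M *v x)" "M *v (- x) = - (M *v x)" for M :: "complex ^ 3 ^ 3" and x
      by (simp_all add: matrix_vector_mult_def vec_eq_iff sum_negf)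
    have sys: "sl3_system F'"
      unfolding F'_def by (rule sl3_system_dual[OF F]) (metis \<sigma>\<sigma> injI)
    have "u = F' 1 3 *v (- z)" "F' 1 2 *v (F' 2 1 *v u) = u"
      using uz False by (simp_all add: F'_def \<sigma> neg)
    from standard_system[OF sys uz(1) this] obtain b
      where b: "invertible b" "\<And>i j. i \<noteq> j \<Longrightarrow> F' i j ** b = b ** unit_mat i j" by metis
    define J :: "complex ^ 3 ^ 3" where "J = (\<chi> i j. if i = \<sigma> j then 1 else 0)"
    have J: "(J *v x) $ i = x $ \<sigma> i" for x i
      using exhaust_3[of i] by (auto simp: J_def matrix_vector_mult_3 \<sigma>)
    have "J ** J = mat 1"
      unfolding matrix_eq by (simp add: matrix_vector_mul_assoc[symmetric] vec_eq_iff J \<sigma>\<sigma>)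
    then have "invertible J" unfolding invertible_def by blast
    then have inv: "invertible (b ** J)" using b(1) invertible_mult by blast
    have "F i j ** (b ** J) = (b ** J) ** (- transpose (unit_mat i j))" if "i \<noteq> j" for i j
    proof -
      have "\<sigma> j \<noteq> \<sigma> i" using that \<sigma>\<sigma> by metis
      from b(2)[OF this] have "(- F i j) ** b = b ** unit_mat (\<sigma> j) (\<sigma> i)"
        by (simp only: F'_def \<sigma>\<sigma>)
      moreover have "(- F i j) ** b = - (F i j ** b)"
        by (simp add: matrix_matrix_mult_def vec_eq_iff sum_negf)
      ultimately have Fb: "F i j ** b = - (b ** unit_mat (\<sigma> j) (\<sigma> i))" by (metis minus_minus)
      have "- (unit_mat (\<sigma> j) (\<sigma> i) *v (J *v x)) = J *v (- transpose (unit_mat i j) *v x)" for x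
      proof -
        have U: "(unit_mat a b *v x) $ k = (if k = a then x $ b else 0)" "(transpose (unit_mat a b) *v x) $ k = (if k = b then x $ a else 0)" for a b k x
          using exhaust_3[of b] exhaust_3[of a] by (auto simp: unit_mat_def transpose_def matrix_vector_mult_3)
        show ?thesis
        proof (subst vec_eq_iff, rule allI)
          fix k
          have "\<sigma> k = j \<longleftrightarrow> k = \<sigma> j" using \<sigma>\<sigma> by metis
          then show "(- (unit_mat (\<sigma> j) (\<sigma> i) *v (J *v x))) $ k = (J *v (- transpose (unit_mat i j) *v x)) $ k"
            by (simp add: J neg U \<sigma>\<sigma> del: transpose_matrix_vector)
        qed
      qed
      then have "(F i j ** b) *v (J *v x) = b *v (J *v (- transpose (unit_mat i j) *v x))" for x
        unfolding Fb by (simp only: neg flip: matrix_vector_mul_assoc) (simp only: neg(2)[symmetric])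
      then show ?thesis by (simp add: matrix_eq matrix_vector_mul_assoc[symmetric])
    qed
    then show ?thesis using that(2) inv by metis
  qed
qed

lemma sl_closed:
  assumes "X \<in> sl \<rat>" "Y \<in> (sl \<rat> :: (complex ^ 3 ^ 3) set)"
  shows "X + Y \<in> sl \<rat>" "bracket X Y \<in> sl \<rat>" "c \<in> \<rat> \<Longrightarrow> scale c X \<in> sl \<rat>"
proof -
  have rat: "X $ i $ j \<in> \<rat>" "Y $ i $ j \<in> \<rat>" for i j
    using assms by (simp_all add: sl_def matrices_def)
  have tr: "trace X = 0" "trace Y = 0" using assms by (simp_all add: sl_def)
  show "X + Y \<in> sl \<rat>"
    by (simp add: sl_def matrices_def trace_add tr rat)
  have "trace (bracket X Y) = 0"
    using trace_mul_sym[of X Y] by (simp add: bracket_def trace_sub)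
  then show "bracket X Y \<in> sl \<rat>"
    by (simp add: sl_def matrices_def bracket_def matrix_matrix_mult_def sum_3 rat)
  show "scale c X \<in> sl \<rat>" if "c \<in> \<rat>"
    using that trace_scale[of c X] by (simp add: sl_def matrices_def scale_def tr rat)
qed

text \<open>As a Lie algebra over \<open>\<rat>\<close>, \<open>sl\<^sub>3(\<rat>)\<close> is generated by the unit matrices off the diagonal.\<close>

lemma sl3_induct [consumes 1, case_names unit add scale bracket]:
  assumes X: "X \<in> sl \<rat>"
    and unit: "\<And>i j. i \<noteq> j \<Longrightarrow> P (unit_mat i j)"
    and add: "\<And>X Y. X \<in> sl \<rat> \<Longrightarrow> Y \<in> sl \<rat> \<Longrightarrow> P X \<Longrightarrow> P Y \<Longrightarrow> P (X + Y)"
    and scale: "\<And>c X. c \<in> \<rat> \<Longrightarrow> X \<in> sl \<rat> \<Longrightarrow> P X \<Longrightarrow> P (scale c X)"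
    and bracket: "\<And>X Y. X \<in> sl \<rat> \<Longrightarrow> Y \<in> sl \<rat> \<Longrightarrow> P X \<Longrightarrow> P Y \<Longrightarrow> P (bracket X Y)"
  shows "P X"
proof -
  let ?Q = "\<lambda>X. X \<in> sl \<rat> \<and> P X"
  have U: "?Q (unit_mat i j)" if "i \<noteq> j" for i j using that unit unit_mat_in_sl by blast
  have A: "?Q (X + Y)" if "?Q X" "?Q Y" for X Y using that add[of X Y] sl_closed(1)[of X Y] by blast
  have S: "?Q (scale c X)" if "c \<in> \<rat>" "?Q X" for c X using that scale[of c X] sl_closed(3)[of X X c] by blast
  have B: "?Q (bracket X Y)" if "?Q X" "?Q Y" for X Y using that bracket[of X Y] sl_closed(2)[of X Y] by blast
  have rat: "X $ i $ j \<in> \<rat>" for i j using X by (simp add: sl_def matrices_def)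
  have tr: "X $ 3 $ 3 = - X $ 1 $ 1 - X $ 2 $ 2"
    using X by (simp add: sl_def trace_def sum_3 eq_neg_iff_add_eq_0 algebra_simps)
  have "X = scale (X $ 1 $ 2) (unit_mat 1 2) + scale (X $ 1 $ 3) (unit_mat 1 3) + scale (X $ 2 $ 1) (unit_mat 2 1) +
    scale (X $ 2 $ 3) (unit_mat 2 3) + scale (X $ 3 $ 1) (unit_mat 3 1) + scale (X $ 3 $ 2) (unit_mat 3 2) +
    scale (X $ 1 $ 1) (bracket (unit_mat 1 2) (unit_mat 2 1)) +
    scale (X $ 1 $ 1 + X $ 2 $ 2) (bracket (unit_mat 2 3) (unit_mat 3 2))"
    unfolding vec_eq_iff forall_3 by (simp add: bracket_def matrix_matrix_mult_def sum_3 scale_def unit_mat_def tr)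
  moreover have "?Q (scale (X $ 1 $ 2) (unit_mat 1 2) + scale (X $ 1 $ 3) (unit_mat 1 3) + scale (X $ 2 $ 1) (unit_mat 2 1) +
    scale (X $ 2 $ 3) (unit_mat 2 3) + scale (X $ 3 $ 1) (unit_mat 3 1) + scale (X $ 3 $ 2) (unit_mat 3 2) +
    scale (X $ 1 $ 1) (bracket (unit_mat 1 2) (unit_mat 2 1)) +
    scale (X $ 1 $ 1 + X $ 2 $ 2) (bracket (unit_mat 2 3) (unit_mat 3 2)))"
    by (intro A S B U rat Rats_add) simp_all
  ultimately show ?thesis by simp
qed

lemma unit_mat_mult: "unit_mat i j ** unit_mat k l = (if j = k then unit_mat i l else 0)"
  using exhaust_3[of j] exhaust_3[of k]
  by (auto simp: vec_eq_iff matrix_matrix_mult_def sum_3 unit_mat_def)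

lemma sl3_hom_extend:
  fixes \<gamma> \<theta> :: "complex ^ 3 ^ 3 \<Rightarrow> complex ^ 3 ^ 3"
  assumes hom: "\<And>X Y. X \<in> sl \<rat> \<Longrightarrow> Y \<in> sl \<rat> \<Longrightarrow> \<gamma> (X + Y) = \<gamma> X + \<gamma> Y"
      "\<And>X Y. X \<in> sl \<rat> \<Longrightarrow> Y \<in> sl \<rat> \<Longrightarrow> \<gamma> (bracket X Y) = bracket (\<gamma> X) (\<gamma> Y)"
      "\<And>c X. c \<in> \<rat> \<Longrightarrow> X \<in> sl \<rat> \<Longrightarrow> \<gamma> (scale c X) = scale c (\<gamma> X)"
    and hom': "\<And>X Y. \<theta> (X + Y) = \<theta> X + \<theta> Y" "\<And>X Y. \<theta> (bracket X Y) = bracket (\<theta> X) (\<theta> Y)"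
      "\<And>c X. \<theta> (scale c X) = scale c (\<theta> X)"
    and b: "invertible b" "\<And>i j. i \<noteq> j \<Longrightarrow> \<gamma> (unit_mat i j) ** b = b ** \<theta> (unit_mat i j)"
    and X: "X \<in> sl \<rat>"
  shows "\<gamma> X = b ** \<theta> X ** matrix_inv b"
proof -
  have "\<gamma> X ** b = b ** \<theta> X"
    using X
  proof (induction rule: sl3_induct)
    case (unit i j)
    then show ?case by (rule b)
  next
    case (add X Y)
    then show ?case by (simp add: hom hom' matrix_add_mult_left matrix_add_ldistrib)
  next
    case (scale c X)
    then show ?case by (simp add: hom hom' scale_mult_left scale_mult_right)
  next
    case (bracket X Y)
    have "\<gamma> X ** \<gamma> Y ** b = b ** \<theta> X ** \<theta> Y" "\<gamma> Y ** \<gamma> X ** b = b ** \<theta> Y ** \<theta> X"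
      using bracket(3,4) by (metis matrix_mul_assoc)+
    then have "bracket (\<gamma> X) (\<gamma> Y) ** b = b ** bracket (\<theta> X) (\<theta> Y)"
      by (simp add: bracket_def matrix_diff_mult_left matrix_diff_mult_right matrix_mul_assoc)
    then show ?case by (simp only: hom(2)[OF bracket(1,2)] hom'(2))
  qed
  then have "\<gamma> X ** b ** matrix_inv b = b ** \<theta> X ** matrix_inv b" by simp
  then show ?thesis by (simp add: matrix_mul_assoc[symmetric] matrix_inv_mult[OF b(1)])
qed

text \<open>The images of the unit matrices form an \<open>sl3_system\<close>, and its description extends from these generators to the whole
  algebra. In other words, a faithful three-dimensional representation is the standard one or its dual.\<close>

lemma sl3_hom_classification:
  fixes \<gamma> :: "complex ^ 3 ^ 3 \<Rightarrow> complex ^ 3 ^ 3"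
  assumes add: "\<And>X Y. X \<in> sl \<rat> \<Longrightarrow> Y \<in> sl \<rat> \<Longrightarrow> \<gamma> (X + Y) = \<gamma> X + \<gamma> Y"
    and br: "\<And>X Y. X \<in> sl \<rat> \<Longrightarrow> Y \<in> sl \<rat> \<Longrightarrow> \<gamma> (bracket X Y) = bracket (\<gamma> X) (\<gamma> Y)"
    and sc: "\<And>c X. c \<in> \<rat> \<Longrightarrow> X \<in> sl \<rat> \<Longrightarrow> \<gamma> (scale c X) = scale c (\<gamma> X)"
    and inj: "inj_on \<gamma> (sl \<rat>)"
  obtains b where "invertible b" "\<And>X. X \<in> sl \<rat> \<Longrightarrow> \<gamma> X = b ** X ** matrix_inv b"
  | b where "invertible b" "\<And>X. X \<in> sl \<rat> \<Longrightarrow> \<gamma> X = b ** (- transpose X) ** matrix_inv b"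
proof -
  have zero: "0 \<in> sl \<rat>" by (simp add: sl_def matrices_def trace_def)
  have \<gamma>0: "\<gamma> 0 = 0" using sc[of 0 0] zero by simp
  have "sl3_system (\<lambda>i j. \<gamma> (unit_mat i j))"
    unfolding sl3_system_def
  proof (intro conjI allI impI)
    fix i j k :: 3
    assume d: "i \<noteq> j \<and> j \<noteq> k \<and> i \<noteq> k"
    show "bracket (\<gamma> (unit_mat i j)) (\<gamma> (unit_mat j k)) = \<gamma> (unit_mat i k)"
      "bracket (\<gamma> (unit_mat i j)) (\<gamma> (unit_mat k j)) = 0" "bracket (\<gamma> (unit_mat i j)) (\<gamma> (unit_mat i k)) = 0"
      using d by (auto simp: br[symmetric] unit_mat_in_sl) (auto simp: bracket_def unit_mat_mult \<gamma>0)
  next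
    fix i j :: 3
    assume d: "i \<noteq> j"
    have "unit_mat i j $ i $ j \<noteq> 0" by (simp add: unit_mat_def)
    then have "unit_mat i j \<noteq> 0" by auto
    then show "\<gamma> (unit_mat i j) \<noteq> 0"
      using inj_onD[OF inj, of "unit_mat i j" 0] zero unit_mat_in_sl[OF d] \<gamma>0 by auto
    have two: "scale 2 x = x + x" for x :: "complex ^ 3 ^ 3" by (simp add: scale_def vec_eq_iff)
    have "bracket (bracket (unit_mat i j) (unit_mat j i)) (unit_mat i j) = scale 2 (unit_mat i j)"
      using d by (simp add: bracket_def unit_mat_mult matrix_diff_mult_left matrix_diff_mult_right two)
    then show "bracket (bracket (\<gamma> (unit_mat i j)) (\<gamma> (unit_mat j i))) (\<gamma> (unit_mat i j)) = scale 2 (\<gamma> (unit_mat i j))"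
      using d by (simp add: br[symmetric] sc[symmetric] sl_closed unit_mat_in_sl)
  qed
  then show ?thesis
  proof (cases rule: sl3_system_classification)
    case (1 b)
    have "\<gamma> X = b ** X ** matrix_inv b" if "X \<in> sl \<rat>" for X
    proof (rule sl3_hom_extend[OF add br sc, where \<theta> = "\<lambda>X. X" and b = b])
      show "invertible b" "X \<in> sl \<rat>" by fact+
      show "\<gamma> (unit_mat i j) ** b = b ** unit_mat i j" if "i \<noteq> j" for i j using 1(2) that .
    qed simp_all
    then show ?thesis using 1(1) that(1) by blast
  next
    case (2 b)
    have "\<gamma> X = b ** (- transpose X) ** matrix_inv b" if "X \<in> sl \<rat>" for X
    proof (rule sl3_hom_extend[OF add br sc, where \<theta> = "\<lambda>X. - transpose X" and b = b])
      show "- transpose (X + Y) = - transpose X + - transpose Y" "- transpose (scale c X) = scale c (- transpose X)" for X Y :: "complex ^ 3 ^ 3" and c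
        by (simp_all add: transpose_def scale_def vec_eq_iff)
      show "- transpose (bracket X Y) = bracket (- transpose X) (- transpose Y)" for X Y :: "complex ^ 3 ^ 3"
        by (simp add: bracket_def transpose_def matrix_matrix_mult_def vec_eq_iff mult.commute)
      show "invertible b" "X \<in> sl \<rat>" by fact+
      show "\<gamma> (unit_mat i j) ** b = b ** (- transpose (unit_mat i j))" if "i \<noteq> j" for i j using 2(2) that .
    qed
    then show ?thesis using 2(1) that(2) by blast
  qed
qed

section \<open>Chevalley bases and the trace form of degree three\<close>

lemma linear_combination_in_span:
  assumes "is_basis F V B" "X \<in> V"
  obtains c where "X = (\<Sum>b\<in>B. scale (c b) b)"
  using assms unfolding is_basis_def linear_combination_def by blast

lemma is_basis_memD:
  assumes B: "is_basis \<rat> V B" and b: "b \<in> B"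
  shows "b \<in> V" "b \<noteq> 0"
proof -
  have fin: "finite B" using B by (simp add: is_basis_def lin_indep_def)
  have "linear_combination (\<lambda>x. if x = b then 1 else 0) B = (\<Sum>x\<in>B. if x = b then b else 0)"
    unfolding linear_combination_def by (rule sum.cong) (auto simp: scale_def vec_eq_iff)
  also have "\<dots> = b" using fin b by simp
  finally have lc: "linear_combination (\<lambda>x. if x = b then 1 else 0) B = b" .
  have "linear_combination (\<lambda>x. if x = b then 1 else 0) B \<in> V"
    using B by (auto simp: is_basis_def)
  then show "b \<in> V" by (simp only: lc)
  show "b \<noteq> 0"
  proof
    assume "b = 0"
    have indep: "(\<And>x. x \<in> B \<Longrightarrow> c x \<in> \<rat>) \<Longrightarrow> linear_combination c B = 0 \<Longrightarrow> x \<in> B \<Longrightarrow> c x = 0" for c x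
      using B unfolding is_basis_def lin_indep_def by blast
    have "(if b = b then 1 else 0 :: complex) = 0"
      by (rule indep[of "\<lambda>x. if x = b then 1 else 0"]) (use lc \<open>b = 0\<close> b in auto)
    then show False by simp
  qed
qed

lemma matrix_sum_mult: "(\<Sum>b\<in>B. M b) *v x = (\<Sum>b\<in>B. M b *v x)" for x :: "complex ^ 'n"
  by (induction B rule: infinite_finite_induct) (simp_all add: matrix_vector_mult_add_rdistrib)

text \<open>\<open>E\<^sub>i\<^sub>j u\<close> is a multiple of the \<open>i\<close>-th unit vector, with factor \<open>u\<^sub>j\<close>. If \<open>u\<^sub>j \<noteq> 0\<close> this gives all unit vectors except the
  \<open>j\<close>-th, which is then obtained from \<open>u\<close> itself.\<close>

lemma sl3_acts_transitively:
  fixes u :: "complex ^ 3"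
  assumes W: "\<And>X. X \<in> sl \<rat> \<Longrightarrow> X *v u \<in> W" "u \<in> W" "vec.subspace W" and u: "u \<noteq> 0"
  shows "W = UNIV"
proof -
  obtain j where j: "u $ j \<noteq> 0" using u by (auto simp: vec_eq_iff)
  have sub: "a *s x \<in> W" "x + y \<in> W" "x - y \<in> W" if "x \<in> W" "y \<in> W" for a x y
    using that W(3) vec.subspace_scale vec.subspace_add vec.subspace_diff by blast+
  have ax: "axis i 1 \<in> W" if "i \<noteq> j" for i
  proof -
    have "unit_mat i j *v u = u $ j *s axis i 1"
      using exhaust_3[of j] by (auto simp: vec_eq_iff matrix_vector_mult_3 unit_mat_def axis_def)
    then have "axis i 1 = inverse (u $ j) *s (unit_mat i j *v u)" using j by (simp add: vector_smult_assoc)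
    moreover have "unit_mat i j *v u \<in> W" using W(1) unit_mat_in_sl[OF that] by blast
    ultimately show ?thesis using sub by metis
  qed
  obtain k l where kl: "j \<noteq> k" "j \<noteq> l" "k \<noteq> l" "UNIV = {j, k, l}" by (rule other_indices)
  have dec: "x = x $ j *s axis j 1 + x $ k *s axis k 1 + x $ l *s axis l 1" for x :: "complex ^ 3"
    unfolding vec_eq_iff
  proof
    fix i :: 3
    have "i \<in> {j, k, l}" using kl(4) by blast
    then show "x $ i = (x $ j *s axis j 1 + x $ k *s axis k 1 + x $ l *s axis l 1) $ i"
      using kl(1-3) by (auto simp: axis_def)
  qed
  have axW: "axis k 1 \<in> W" "axis l 1 \<in> W" using ax kl by metis+
  have "w - b - c = a" if "w = a + b + c" for w a b c :: "complex ^ 3" using that by simp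
  from this[OF dec[of u]] have "axis j 1 = inverse (u $ j) *s (u - u $ k *s axis k 1 - u $ l *s axis l 1)"
    using j by (simp add: vector_smult_assoc)
  then have "axis j 1 \<in> W" using sub axW W(2) by metis
  then have "x \<in> W" for x using sub axW dec[of x] by metis
  then show ?thesis by blast
qed

lemma spanning_set_basis3:
  assumes "vec.span V = (UNIV :: (complex ^ 3) set)"
  obtains f where "\<And>k. f k \<in> V" "invertible (cols3 f)"
proof -
  obtain B where B: "B \<subseteq> V" "vec.independent B" "V \<subseteq> vec.span B" "card B = vec.dim V"
    using vec.basis_exists[of V] by metis
  have "vec.dim V = 3" using assms vec.dim_span[of V] vec_dim_card[where 'n = 3 and 'a = complex] by simp
  then obtain x y z where xyz: "B = {x, y, z}" "x \<noteq> y" "y \<noteq> z" "x \<noteq> z"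
    using B(4) by (auto simp: card_3_iff)
  define f where "f k = (if k = 1 then x else if k = 2 then y else z)" for k :: 3
  have f: "f 1 = x" "f 2 = y" "f 3 = z" by (simp_all add: f_def)
  have "invertible (cols3 f)"
  proof (rule cols3_invertible)
    fix a b c
    assume eq: "a *s f 1 + b *s f 2 + c *s f 3 = 0"
    define g where "g w = (if w = x then a else if w = y then b else c)" for w
    have "(\<Sum>w\<in>B. g w *s w) = 0" using eq xyz(2-4) unfolding xyz(1) by (simp add: g_def f add.assoc)
    then have "g w = 0" if "w \<in> B" for w
      using vec.independentD[OF B(2) _ subset_refl] that xyz(1) by blast
    then show "a = 0 \<and> b = 0 \<and> c = 0" using xyz by (metis g_def insertCI)
  qed
  moreover have "f k \<in> V" for k using B(1) xyz(1) by (auto simp: f_def)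
  ultimately show ?thesis using that by blast
qed

text \<open>The last nonzero power \<open>N\<close> of the nilpotent matrix \<open>x\<close> has rank one, and \<open>[h\<^sub>i, N]\<close> is a multiple of \<open>N\<close>. So the image
  of \<open>N\<close> is a line that is invariant under all \<open>h\<^sub>i\<close>.\<close>

lemma ad_eigenvector_common_eigenvector:
  fixes x :: "complex ^ 3 ^ 3" and h :: "'l \<Rightarrow> complex ^ 3 ^ 3"
  assumes x: "x \<noteq> 0" and eig: "\<And>i. bracket (h i) x = scale (\<alpha> i) x" and nz: "\<alpha> i0 \<noteq> 0"
  obtains u \<mu> where "u \<noteq> 0" "\<And>i. h i *v u = \<mu> i *s u"
proof -
  have x3: "x ** x ** x = 0" using eigenvector_of_ad_nilpotent[OF eig nz] .
  have hx: "h i ** x = x ** h i + scale (\<alpha> i) x" for i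
    using eig[of i] by (simp add: bracket_def algebra_simps)
  obtain N \<nu> where N: "N \<noteq> 0" "N ** N = 0" "\<And>i. h i ** N = N ** h i + scale (\<nu> i) N"
  proof (cases "x ** x = 0")
    case True
    then show ?thesis using that[of x \<alpha>] x hx by blast
  next
    case False
    have "h i ** (x ** x) = (x ** x) ** h i + scale (2 * \<alpha> i) (x ** x)" for i
    proof -
      have "h i ** (x ** x) = (x ** h i + scale (\<alpha> i) x) ** x" by (simp add: matrix_mul_assoc hx)
      also have "\<dots> = x ** (x ** h i + scale (\<alpha> i) x) + scale (\<alpha> i) (x ** x)"
        by (simp add: matrix_add_mult_left scale_mult_left matrix_mul_assoc[symmetric] hx)
      also have "\<dots> = (x ** x) ** h i + (scale (\<alpha> i) (x ** x) + scale (\<alpha> i) (x ** x))"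
        by (simp add: matrix_add_ldistrib scale_mult_right matrix_mul_assoc add.assoc)
      also have "scale (\<alpha> i) (x ** x) + scale (\<alpha> i) (x ** x) = scale (2 * \<alpha> i) (x ** x)"
        by (simp add: scale_def vec_eq_iff)
      finally show ?thesis .
    qed
    moreover have "(x ** x) ** (x ** x) = 0" using x3 by (simp add: matrix_mul_assoc)
    ultimately show ?thesis using that[of "x ** x" "\<lambda>i. 2 * \<alpha> i"] False by blast
  qed
  obtain z where z: "N *v z \<noteq> 0" using N(1) by (metis matrix_eq matrix_vector_mult_0)
  have "\<exists>c. h i *v (N *v z) = c *s (N *v z)" for i
  proof -
    have "h i *v (N *v z) = N *v (h i *v z + \<nu> i *s z)"
      by (simp add: matrix_vector_mul_assoc N(3) matrix_vector_mult_add_rdistrib matrix_vector_right_distrib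
          vector_scalar_commute scale_mult_vec)
    then show ?thesis using square_zero_image_line[OF N(2) z] by metis
  qed
  then obtain \<mu> where "\<And>i. h i *v (N *v z) = \<mu> i *s (N *v z)" by metis
  then show ?thesis using that z by blast
qed

text \<open>If \<open>u\<close> is a common eigenvector of the \<open>h\<^sub>i\<close> (found in the image of a power of a root vector), then so is the image of
  \<open>u\<close> under each root vector. These images and \<open>u\<close> span \<open>\<complex>\<^sup>3\<close>, as \<open>sl\<^sub>3\<close> acts transitively.\<close>

lemma chevalley_basis_joint_eigenbasis:
  fixes h :: "2 \<Rightarrow> complex ^ 3 ^ 3"
  assumes cb: "chevalley_basis \<rat> (sl \<rat>) H h e"
  obtains P :: "complex ^ 3 ^ 3" and \<mu> where "invertible P" "\<And>i x. (matrix_inv P ** h i ** P) *v x = (\<chi> k. \<mu> k i * x $ k)"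
proof -
  let ?R = "roots \<rat> (sl \<rat>) h"
  have K: "is_basis \<rat> (sl \<rat>) (range h \<union> e ` ?R)" using cb by (simp add: chevalley_basis_def)
  have e: "e \<alpha> \<noteq> 0" "\<And>i. bracket (h i) (e \<alpha>) = scale (\<alpha> i) (e \<alpha>)" if "\<alpha> \<in> ?R" for \<alpha>
    using that cb is_basis_memD(2)[OF K] by (auto simp: chevalley_basis_def root_space_def)
  obtain a where "root_base \<rat> ?R a" using cb unfolding chevalley_basis_def by blast
  then obtain \<alpha> where \<alpha>: "\<alpha> \<in> ?R" unfolding root_base_def by blast
  then obtain i0 where i0: "\<alpha> i0 \<noteq> 0" by (auto simp: roots_def)
  obtain u \<nu> where u: "u \<noteq> 0" "\<And>i. h i *v u = \<nu> i *s u"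
    using ad_eigenvector_common_eigenvector[of "e \<alpha>" h, OF e(1)[OF \<alpha>] e(2)[OF \<alpha>] i0] by metis
  define V where "V = {w. \<exists>\<mu>. \<forall>i. h i *v w = \<mu> i *s w}"
  have uV: "u \<in> V" using u by (auto simp: V_def)
  have hV: "h i *v u \<in> vec.span V" for i
    using uV u(2) by (simp add: vec.span_scale vec.span_base)
  have eV: "e \<beta> *v u \<in> V" if "\<beta> \<in> ?R" for \<beta>
  proof -
    have "h i *v (e \<beta> *v u) = (\<nu> i + \<beta> i) *s (e \<beta> *v u)" for i
    proof -
      have "h i ** e \<beta> = e \<beta> ** h i + scale (\<beta> i) (e \<beta>)"
        using e(2)[OF that, of i] by (simp add: bracket_def algebra_simps)
      then have "h i *v (e \<beta> *v u) = e \<beta> *v (h i *v u) + \<beta> i *s (e \<beta> *v u)"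
        by (simp add: matrix_vector_mul_assoc matrix_vector_mult_add_rdistrib scale_mult_vec)
      then show ?thesis by (simp add: u(2) vector_scalar_commute vec_eq_iff algebra_simps)
    qed
    then show ?thesis unfolding V_def by (intro CollectI exI[where x = "\<lambda>i. \<nu> i + \<beta> i"]) simp
  qed
  have "vec.span V = UNIV"
  proof (rule sl3_acts_transitively[OF _ _ _ u(1)])
    fix X :: "complex ^ 3 ^ 3"
    assume "X \<in> sl \<rat>"
    then obtain c where "X = (\<Sum>b\<in>range h \<union> e ` ?R. scale (c b) b)"
      by (rule linear_combination_in_span[OF K])
    then have "X *v u = (\<Sum>b\<in>range h \<union> e ` ?R. c b *s (b *v u))"
      by (simp add: matrix_sum_mult scale_mult_vec)
    also have "\<dots> \<in> vec.span V"
      by (intro vec.span_sum vec.span_scale) (use hV eV vec.span_base in blast)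
    finally show "X *v u \<in> vec.span V" .
  qed (use uV vec.span_base in auto)
  then obtain f where f: "\<And>k. f k \<in> V" "invertible (cols3 f)" by (rule spanning_set_basis3) blast
  have "\<exists>\<mu>. \<forall>i. h i *v f k = \<mu> i *s f k" for k using f(1) by (simp add: V_def)
  then obtain \<mu> where \<mu>: "\<And>k i. h i *v f k = \<mu> k i *s f k" by metis
  have "(matrix_inv (cols3 f) ** h i ** cols3 f) *v x = (\<chi> k. \<mu> k i * x $ k)" for i x
  proof -
    have "h i *v (cols3 f *v x) = cols3 f *v (\<chi> k. \<mu> k i * x $ k)"
      unfolding cols3_mult by (simp add: matrix_vector_right_distrib vector_scalar_commute \<mu> vector_smult_assoc mult.commute)
    then show ?thesis
      by (simp add: matrix_vector_mul_assoc[symmetric]) (simp add: matrix_vector_mul_assoc matrix_inv_mult[OF f(2)])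
  qed
  then show ?thesis using f(2) that by blast
qed

text \<open>The entry is \<open>(P\<inverse>)\<^sub>p\<^sub>a P\<^sub>b\<^sub>q\<close>. If it vanished for all \<open>a \<noteq> b\<close>, then row \<open>p\<close> of \<open>P\<inverse>\<close> and column \<open>q\<close> of \<open>P\<close> would
  have one nonzero entry each, at the same position, and their product would not be zero.\<close>

lemma conjugate_entry_nonzero:
  fixes P :: "complex ^ 3 ^ 3"
  assumes P: "invertible P" and pq: "p \<noteq> q"
  obtains a b where "a \<noteq> b" "(matrix_inv P ** unit_mat a b ** P) $ p $ q \<noteq> 0"
proof -
  have entry: "(matrix_inv P ** unit_mat a b ** P) $ p $ q = matrix_inv P $ p $ a * P $ b $ q" for a b
    using exhaust_3[of a] exhaust_3[of b] by (auto simp: matrix_matrix_mult_def sum_3 unit_mat_def)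
  have I: "(\<Sum>a\<in>UNIV. matrix_inv P $ p $ a * P $ a $ q) = 0"
    using matrix_inv_mult(2)[OF P] pq by (simp add: matrix_matrix_mult_def vec_eq_iff mat_def)
  have "(\<Sum>a\<in>UNIV. matrix_inv P $ p $ a * P $ a $ p) = 1"
    using matrix_inv_mult(2)[OF P] by (simp add: matrix_matrix_mult_def vec_eq_iff mat_def)
  then obtain a where a: "matrix_inv P $ p $ a \<noteq> 0"
    using sum.neutral[of UNIV "\<lambda>a. matrix_inv P $ p $ a * P $ a $ p"] by fastforce
  have "(\<Sum>a\<in>UNIV. matrix_inv P $ q $ a * P $ a $ q) = 1"
    using matrix_inv_mult(2)[OF P] by (simp add: matrix_matrix_mult_def vec_eq_iff mat_def)
  then obtain b where b: "P $ b $ q \<noteq> 0"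
    using sum.neutral[of UNIV "\<lambda>a. matrix_inv P $ q $ a * P $ a $ q"] by fastforce
  show ?thesis
  proof (cases "\<exists>a b. a \<noteq> b \<and> matrix_inv P $ p $ a \<noteq> 0 \<and> P $ b $ q \<noteq> 0")
    case True
    then show ?thesis using that entry by (metis mult_eq_0_iff)
  next
    case False
    then have "P $ c $ q = 0" if "c \<noteq> a" for c using a that by metis
    then have "matrix_inv P $ p $ c * P $ c $ q = (if c = a then matrix_inv P $ p $ a * P $ a $ q else 0)" for c
      by simp
    then have "(\<Sum>c\<in>UNIV. matrix_inv P $ p $ c * P $ c $ q) = (\<Sum>c\<in>UNIV. if c = a then matrix_inv P $ p $ a * P $ a $ q else 0)"
      by (intro sum.cong) auto
    then have "P $ a $ q = 0" using I a by simp
    then show ?thesis using False a b by metis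
  qed
qed

text \<open>In a basis of common eigenvectors the roots are the differences of the eigenvalues, as for diagonal matrices. The
  coroots \<open>h\<^sub>1\<close>, \<open>h\<^sub>2\<close> of the simple roots become \<open>E\<^sub>p\<^sub>p - E\<^sub>q\<^sub>q\<close> and \<open>E\<^sub>r\<^sub>r - E\<^sub>s\<^sub>s\<close>. Neither \<open>p = r\<close> nor \<open>q = s\<close> is
  possible, because then the difference of the simple roots would be a root.\<close>

lemma chevalley_basis_diagonal_form:
  fixes h :: "2 \<Rightarrow> complex ^ 3 ^ 3"
  assumes cb: "chevalley_basis \<rat> (sl \<rat>) H h e"
  obtains P :: "complex ^ 3 ^ 3" and p q r s where "invertible P" "p \<noteq> q" "r \<noteq> s"
    "matrix_inv P ** h 1 ** P = diag_mat (\<lambda>k. of_bool (k = p) - of_bool (k = q))"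
    "matrix_inv P ** h 2 ** P = diag_mat (\<lambda>k. of_bool (k = r) - of_bool (k = s))"
    "p \<noteq> r" "q \<noteq> s" "\<not> (p = s \<and> q = r)"
proof -
  let ?R = "roots \<rat> (sl \<rat>) h"
  obtain P :: "complex ^ 3 ^ 3" and \<mu> where P: "invertible P" and \<mu>: "\<And>i x. (matrix_inv P ** h i ** P) *v x = (\<chi> k. \<mu> k i * x $ k)"
    using chevalley_basis_joint_eigenbasis[OF cb] by metis
  define C where "C M = matrix_inv P ** M ** P" for M
  have C_mult: "C (M ** N) = C M ** C N" for M N
  proof -
    have "C M ** C N = matrix_inv P ** M ** (P ** matrix_inv P) ** N ** P" by (simp only: C_def matrix_mul_assoc)
    then show ?thesis by (simp add: C_def matrix_inv_mult[OF P] matrix_mul_assoc)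
  qed
  have C_diff: "C (M - N) = C M - C N" for M N
    by (simp add: C_def matrix_diff_mult_left matrix_diff_mult_right)
  have C_scale: "C (scale c M) = scale c (C M)" for c M
    by (simp add: C_def scale_mult_left scale_mult_right)
  have C_bracket: "C (bracket M N) = bracket (C M) (C N)" for M N
    by (simp add: bracket_def C_diff C_mult)
  have C_inv: "P ** C M ** matrix_inv P = M" for M
  proof -
    have "P ** C M ** matrix_inv P = (P ** matrix_inv P) ** M ** (P ** matrix_inv P)" by (simp only: C_def matrix_mul_assoc)
    then show ?thesis by (simp add: matrix_inv_mult[OF P])
  qed
  have C_inj: "C M = C N \<Longrightarrow> M = N" for M N using C_inv by metis
  have C_0: "C 0 = 0" by (simp add: C_def matrix_matrix_mult_def vec_eq_iff)
  have Ch: "C (h i) = diag_mat (\<lambda>k. \<mu> k i)" for i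
    unfolding matrix_eq C_def \<mu> by (simp add: vec_eq_iff forall_3 matrix_vector_mult_3 diag_mat_def)
  have K: "is_basis \<rat> (sl \<rat>) (range h \<union> e ` ?R)" and HB: "is_basis \<rat> H (range h)" and inj: "inj h"
    using cb by (simp_all add: chevalley_basis_def)
  have Cbr: "(bracket (diag_mat d) M) $ p $ q = (d p - d q) * M $ p $ q" for d M p q
    using exhaust_3[of p] exhaust_3[of q]
    by (auto simp: bracket_def matrix_matrix_mult_def sum_3 diag_mat_def algebra_simps)
  have eig: "(\<mu> p i - \<mu> q i - \<alpha> i) * C (e \<alpha>) $ p $ q = 0" if "\<alpha> \<in> ?R" for \<alpha> p q i
  proof -
    have "bracket (h i) (e \<alpha>) = scale (\<alpha> i) (e \<alpha>)"
      using that cb by (auto simp: chevalley_basis_def root_space_def)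
    then have "bracket (diag_mat (\<lambda>k. \<mu> k i)) (C (e \<alpha>)) = scale (\<alpha> i) (C (e \<alpha>))"
      by (metis C_bracket C_scale Ch)
    from arg_cong[OF this, of "\<lambda>M. M $ p $ q"]
    have "(\<mu> p i - \<mu> q i) * C (e \<alpha>) $ p $ q = \<alpha> i * C (e \<alpha>) $ p $ q"
      by (simp add: Cbr scale_def)
    then show ?thesis by (simp add: algebra_simps)
  qed
  have root_diff: "(\<lambda>i. \<mu> p i - \<mu> q i) \<in> ?R" if pq: "p \<noteq> q" for p q
  proof -
    obtain a b where ab: "a \<noteq> b" "C (unit_mat a b) $ p $ q \<noteq> 0"
      unfolding C_def by (rule conjugate_entry_nonzero[OF P pq])
    obtain c where "unit_mat a b = (\<Sum>b\<in>range h \<union> e ` ?R. scale (c b) b)"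
      by (rule linear_combination_in_span[OF K unit_mat_in_sl[OF ab(1)]])
    moreover have "C (\<Sum>b\<in>B. scale (c b) b) $ p $ q = (\<Sum>b\<in>B. c b * C b $ p $ q)" for B
    proof (induction B rule: infinite_finite_induct)
      case (insert x B)
      have "C (M + N) = C M + C N" for M N
        by (simp add: C_def matrix_add_mult_left matrix_add_ldistrib)
      moreover have "C (scale c M) $ p $ q = c * C M $ p $ q" for c M
        by (subst C_scale) (simp add: scale_def)
      ultimately show ?case using insert by simp
    qed (simp_all add: C_def matrix_matrix_mult_def)
    ultimately have "(\<Sum>b\<in>range h \<union> e ` ?R. c b * C b $ p $ q) \<noteq> 0" using ab(2) by simp
    then obtain b where b: "b \<in> range h \<union> e ` ?R" "C b $ p $ q \<noteq> 0"
      by (metis (no_types, lifting) mult_zero_right sum.neutral)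
    moreover have "b \<notin> range h" using b(2) pq by (auto simp: Ch diag_mat_def)
    ultimately obtain \<alpha> where \<alpha>: "\<alpha> \<in> ?R" "C (e \<alpha>) $ p $ q \<noteq> 0" by auto
    then have "(\<lambda>i. \<mu> p i - \<mu> q i) = \<alpha>" using eig[OF \<alpha>(1), of p _ q] by (auto simp: fun_eq_iff)
    then show ?thesis using \<alpha>(1) by simp
  qed
  have root_rat: "\<mu> p i - \<mu> q i \<in> \<rat>" for p q i
    using root_diff[of p q] by (cases "p = q") (auto simp: roots_def)
  have hK: "h i \<in> sl \<rat>" for i using is_basis_memD(1)[OF K] by blast
  have tr: "\<mu> 1 i + \<mu> 2 i + \<mu> 3 i = 0" for i
  proof -
    have "trace (C (h i)) = trace (h i)"
      by (metis C_def C_inv matrix_mul_assoc trace_mul_sym matrix_inv_mult(1)[OF P] matrix_mul_rid)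
    then show ?thesis using hK[of i] by (simp add: Ch sl_def trace_def diag_mat_def sum_3)
  qed
  have \<mu>3: "\<mu> 3 i = - \<mu> 1 i - \<mu> 2 i" for i using tr[of i] by (simp add: eq_neg_iff_add_eq_0 algebra_simps)
  have \<mu>_rat: "\<mu> p i \<in> \<rat>" for p i
  proof -
    have "\<mu> p i = ((\<mu> p i - \<mu> 1 i) + (\<mu> p i - \<mu> 2 i) + (\<mu> p i - \<mu> 3 i) + (\<mu> 1 i + \<mu> 2 i + \<mu> 3 i)) / 3" by simp
    also have "\<dots> \<in> \<rat>" unfolding tr by (intro Rats_divide Rats_add root_rat) auto
    finally show ?thesis .
  qed
  have lin: "c1 = 0 \<and> c2 = 0" if c: "c1 \<in> \<rat>" "c2 \<in> \<rat>" "\<And>k. c1 * \<mu> k 1 + c2 * \<mu> k 2 = 0" for c1 c2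
  proof -
    have "C (scale c1 (h 1) + scale c2 (h 2)) = 0"
    proof -
      have "C (scale c1 (h 1) + scale c2 (h 2)) = scale c1 (C (h 1)) + scale c2 (C (h 2))"
        by (simp add: C_def matrix_add_mult_left matrix_add_ldistrib scale_mult_left scale_mult_right)
      then show ?thesis using c(3) by (simp add: Ch scale_def diag_mat_def vec_eq_iff)
    qed
    then have 0: "scale c1 (h 1) + scale c2 (h 2) = 0" using C_inj C_0 by metis
    have ne: "h 1 \<noteq> h 2" using injD[OF inj, of 1 2] by auto
    define c where "c b = (if b = h 1 then c1 else if b = h 2 then c2 else 0)" for b
    have "linear_combination c (range h) = scale c1 (h 1) + scale c2 (h 2)"
      using ne by (simp add: linear_combination_def UNIV_2 c_def)
    moreover have "c b \<in> \<rat>" for b using that(1,2) by (simp add: c_def)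
    moreover have "(\<forall>b\<in>range h. c b \<in> \<rat>) \<and> linear_combination c (range h) = 0 \<Longrightarrow> \<forall>b\<in>range h. c b = 0" for c
      using HB unfolding is_basis_def lin_indep_def by blast
    ultimately have "\<forall>b\<in>range h. c b = 0" using 0 by simp
    then have "c (h 1) = 0" "c (h 2) = 0" by blast+
    then show ?thesis using ne by (auto simp: c_def split: if_splits)
  qed
  \<comment> \<open>\<open>h 1\<close> and \<open>h 2\<close> are independent over \<open>\<rat>\<close> and have rational eigenvalues, so these are independent as well\<close>
  have \<delta>: "\<mu> 1 1 * \<mu> 2 2 - \<mu> 1 2 * \<mu> 2 1 \<noteq> 0"
  proof
    assume 0: "\<mu> 1 1 * \<mu> 2 2 - \<mu> 1 2 * \<mu> 2 1 = 0"
    have "\<mu> 2 2 = 0 \<and> - \<mu> 2 1 = 0"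
    proof (rule lin)
      fix k
      show "\<mu> 2 2 * \<mu> k 1 + - \<mu> 2 1 * \<mu> k 2 = 0"
        using exhaust_3[of k] 0 by (auto simp: \<mu>3 algebra_simps)
    qed (simp_all add: \<mu>_rat)
    moreover have "\<mu> 1 2 = 0 \<and> - \<mu> 1 1 = 0"
    proof (rule lin)
      fix k
      show "\<mu> 1 2 * \<mu> k 1 + - \<mu> 1 1 * \<mu> k 2 = 0"
        using exhaust_3[of k] 0 by (auto simp: \<mu>3 algebra_simps)
    qed (simp_all add: \<mu>_rat)
    ultimately have "(\<lambda>i. \<mu> 1 i - \<mu> 2 i) = (\<lambda>i. 0)" by (metis diff_self exhaust_2 neg_equal_0_iff_equal)
    moreover have "(\<lambda>i. \<mu> 1 i - \<mu> 2 i) \<in> ?R" by (rule root_diff) simp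
    ultimately show False by (simp add: roots_def)
  qed
  \<comment> \<open>A relation between the eigenvalues has equal coefficients, since the first two eigenvalues are independent and
    the sum of all three is zero. So two differences that agree belong to the same pair.\<close>
  have distinct: "p = r \<and> q = s" if pq: "p \<noteq> q" and rs: "r \<noteq> s" and eq: "\<And>i. \<mu> p i - \<mu> q i = \<mu> r i - \<mu> s i" for p q r s
  proof -
    define c :: "3 \<Rightarrow> complex" where "c k = of_bool (k = p) - of_bool (k = q) - of_bool (k = r) + of_bool (k = s)" for k
    have pick: "(\<Sum>k\<in>UNIV. of_bool (k = p) * \<mu> k i) = \<mu> p i" for p i
      using exhaust_3[of p] by (auto simp: sum_3)
    have "(\<Sum>k\<in>UNIV. c k * \<mu> k i) = \<mu> p i - \<mu> q i - \<mu> r i + \<mu> s i" for i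
      by (simp only: c_def left_diff_distrib distrib_right sum_subtractf sum.distrib pick)
    then have "c 1 * \<mu> 1 i + c 2 * \<mu> 2 i + c 3 * \<mu> 3 i = \<mu> p i - \<mu> q i - \<mu> r i + \<mu> s i" for i
      by (simp only: sum_3)
    moreover have "\<mu> p i - \<mu> q i - \<mu> r i + \<mu> s i = 0" for i using eq[of i] by simp
    ultimately have "c 1 * \<mu> 1 i + c 2 * \<mu> 2 i + c 3 * \<mu> 3 i = 0" for i by simp
    then have c0: "(c 1 - c 3) * \<mu> 1 i + (c 2 - c 3) * \<mu> 2 i = 0" for i
      by (simp add: \<mu>3 algebra_simps)
    have "(c 1 - c 3) * (\<mu> 1 1 * \<mu> 2 2 - \<mu> 1 2 * \<mu> 2 1) =
       \<mu> 2 2 * ((c 1 - c 3) * \<mu> 1 1 + (c 2 - c 3) * \<mu> 2 1) - \<mu> 2 1 * ((c 1 - c 3) * \<mu> 1 2 + (c 2 - c 3) * \<mu> 2 2)"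
      by (simp add: algebra_simps)
    then have 13: "c 1 = c 3" unfolding c0 using \<delta> by simp
    have "(c 2 - c 3) * (\<mu> 1 1 * \<mu> 2 2 - \<mu> 1 2 * \<mu> 2 1) =
       \<mu> 1 1 * ((c 1 - c 3) * \<mu> 1 2 + (c 2 - c 3) * \<mu> 2 2) - \<mu> 1 2 * ((c 1 - c 3) * \<mu> 1 1 + (c 2 - c 3) * \<mu> 2 1)"
      by (simp add: algebra_simps)
    then have 23: "c 2 = c 3" unfolding c0 using \<delta> by simp
    have one: "(\<Sum>k\<in>UNIV. of_bool (k = p)) = (1 :: complex)" for p :: 3
      using exhaust_3[of p] by (auto simp: sum_3)
    have "(\<Sum>k\<in>UNIV. c k) = 0"
      by (simp only: c_def sum.distrib sum_subtractf one) simp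
    then have "c 1 + c 2 + c 3 = 0" by (simp only: sum_3)
    then have "c k = 0" for k using 13 23 exhaust_3[of k] by auto
    then have "c p = 0" "c q = 0" by blast+
    then show ?thesis using pq rs by (auto simp: c_def of_bool_def split: if_splits)
  qed
  obtain a where base: "root_base \<rat> ?R a" and ha: "\<And>j. h j = bracket (e (a j)) (e (\<lambda>i. - a j i))"
    using cb unfolding chevalley_basis_def by blast
  have aR: "a j \<in> ?R" for j using base by (simp add: root_base_def)
  have two: "a j j = 2" for j
  proof -
    have "bracket (bracket (e (a j)) (e (\<lambda>i. - a j i))) (e (a j)) = scale 2 (e (a j))" "e (a j) \<in> root_space (sl \<rat>) h (a j)"
      using cb aR[of j] unfolding chevalley_basis_def by blast+
    then have "bracket (h j) (e (a j)) = scale 2 (e (a j))" "bracket (h j) (e (a j)) = scale (a j j) (e (a j))"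
      unfolding root_space_def by (simp_all flip: ha)
    then have "scale (a j j - 2) (e (a j)) = 0" by (simp add: scale_def vec_eq_iff algebra_simps)
    moreover have "e (a j) \<noteq> 0" using is_basis_memD(2)[OF K] aR by blast
    ultimately show ?thesis by (auto simp: scale_def vec_eq_iff)
  qed
  have form: "\<exists>p q. p \<noteq> q \<and> (\<forall>i. a j i = \<mu> p i - \<mu> q i) \<and> (\<forall>k. \<mu> k j = of_bool (k = p) - of_bool (k = q))" for j
  proof -
    define x where "x = C (e (a j))"
    define y where "y = C (e (\<lambda>i. - a j i))"
    have "x \<noteq> 0" unfolding x_def using C_inj[of "e (a j)" 0] C_0 is_basis_memD(2)[OF K, of "e (a j)"] aR[of j] by auto
    then obtain p q where pq: "x $ p $ q \<noteq> 0" by (auto simp: vec_eq_iff)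
    have supp: "a j i = \<mu> k i - \<mu> l i" if "x $ k $ l \<noteq> 0" for k l i
      using eig[OF aR, of k i l j] that by (auto simp: x_def)
    have ne: "k \<noteq> l" if "x $ k $ l \<noteq> 0" for k l
      using supp[OF that] two[of j] by auto
    have supp1: "x $ k $ l = (if k = p \<and> l = q then x $ p $ q else 0)" for k l
    proof (cases "x $ k $ l = 0")
      case False
      then have "k = p \<and> l = q" using distinct[OF ne[OF False] ne[OF pq]] supp[OF False] supp[OF pq] by metis
      then show ?thesis by simp
    qed (use pq in auto)
    define \<kappa> where "\<kappa> = x $ p $ q * y $ q $ p"
    have D: "\<mu> k j = \<kappa> * (of_bool (k = p) - of_bool (k = q))" for k
    proof -
      have "diag_mat (\<lambda>k. \<mu> k j) = bracket x y"
        unfolding x_def y_def C_bracket[symmetric] ha[symmetric] Ch by simp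
      from arg_cong[OF this, of "\<lambda>M. M $ k $ k"]
      have "\<mu> k j = (\<Sum>l\<in>UNIV. x $ k $ l * y $ l $ k) - (\<Sum>l\<in>UNIV. y $ k $ l * x $ l $ k)"
        by (simp add: diag_mat_def bracket_def matrix_matrix_mult_def)
      also have "(\<Sum>l\<in>UNIV. x $ k $ l * y $ l $ k) = (\<Sum>l\<in>UNIV. if l = q then \<kappa> * of_bool (k = p) else 0)"
        by (rule sum.cong[OF refl], subst supp1) (simp add: \<kappa>_def)
      also have "(\<Sum>l\<in>UNIV. y $ k $ l * x $ l $ k) = (\<Sum>l\<in>UNIV. if l = p then \<kappa> * of_bool (k = q) else 0)"
        by (rule sum.cong[OF refl], subst supp1) (simp add: \<kappa>_def)
      finally show ?thesis by (simp add: algebra_simps)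
    qed
    have "\<kappa> = 1" using two[of j] supp[OF pq, of j] D[of p] D[of q] ne[OF pq] by simp
    then have "\<mu> k j = of_bool (k = p) - of_bool (k = q)" for k using D[of k] by simp
    then show ?thesis using supp[OF pq] ne[OF pq] by blast
  qed
  obtain p q where pq: "p \<noteq> q" "\<And>i. a 1 i = \<mu> p i - \<mu> q i" "\<And>k. \<mu> k 1 = of_bool (k = p) - of_bool (k = q)"
    using form[of 1] by blast
  obtain r s where rs: "r \<noteq> s" "\<And>i. a 2 i = \<mu> r i - \<mu> s i" "\<And>k. \<mu> k 2 = of_bool (k = r) - of_bool (k = s)"
    using form[of 2] by blast
  have nopp: "\<not> (p = s \<and> q = r)"
  proof
    assume "p = s \<and> q = r"
    then have "(1::complex) = 0 \<and> (1::complex) = 0" by (intro lin) (simp_all add: pq rs)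
    then show False by simp
  qed
  have nsame: "\<not> (p = r \<and> q = s)"
  proof
    assume "p = r \<and> q = s"
    then have "(1::complex) = 0 \<and> (-1::complex) = 0" by (intro lin) (simp_all add: pq rs)
    then show False by simp
  qed
  \<comment> \<open>a root has coefficients of one sign in the simple roots\<close>
  have nomixed: False if "\<alpha> \<in> ?R" "\<And>i. \<alpha> i = a 2 i - a 1 i" for \<alpha>
  proof -
    obtain n :: "2 \<Rightarrow> int" where n: "\<And>i. \<alpha> i = (\<Sum>j\<in>UNIV. of_int (n j) * a j i)" "(\<forall>j. n j \<ge> 0) \<or> (\<forall>j. n j \<le> 0)"
    proof -
      have "\<forall>\<alpha>\<in>?R. \<exists>n :: 2 \<Rightarrow> int. (\<forall>i. \<alpha> i = (\<Sum>j\<in>UNIV. of_int (n j) * a j i)) \<and>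
        ((\<forall>j. n j \<ge> 0) \<or> (\<forall>j. n j \<le> 0))"
        using base unfolding root_base_def by (elim conjE)
      from bspec[OF this \<open>\<alpha> \<in> ?R\<close>] show ?thesis using that by blast
    qed
    define c :: "2 \<Rightarrow> complex" where "c j = of_int (n j) - (if j = 1 then -1 else 1)" for j
    have "(\<Sum>j\<in>UNIV. c j * a j i) = 0" for i
      using n(1)[of i] that(2)[of i] by (simp add: sum_2 c_def algebra_simps)
    moreover have "c j \<in> \<rat>" for j by (simp add: c_def)
    ultimately have "\<forall>j. c j = 0" using base unfolding root_base_def by blast
    then have "of_int (n 1) = (-1 :: complex)" "of_int (n 2) = (1 :: complex)" by (auto simp: c_def dest: spec[of _ 1] spec[of _ 2])
    then have "n 1 = -1" "n 2 = 1" by (metis of_int_minus of_int_1 of_int_eq_iff)+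
    then show False using n(2) by (metis neg_0_le_iff_le not_one_le_zero zero_le_one le_minus_one_simps(3))
  qed
  have pr: "p \<noteq> r"
  proof
    assume "p = r"
    then have "(\<lambda>i. \<mu> q i - \<mu> s i) \<in> ?R" using nsame \<open>p = r\<close> by (intro root_diff) auto
    then show False by (rule nomixed) (simp add: pq(2) rs(2) \<open>p = r\<close>)
  qed
  have qs: "q \<noteq> s"
  proof
    assume "q = s"
    then have "(\<lambda>i. \<mu> r i - \<mu> p i) \<in> ?R" using nsame \<open>q = s\<close> by (intro root_diff) auto
    then show False by (rule nomixed) (simp add: pq(2) rs(2) \<open>q = s\<close>)
  qed
  show ?thesis
    by (rule that[OF P pq(1) rs(1) _ _ pr qs nopp])
      (simp_all add: Ch[unfolded C_def] pq(3) rs(3))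
qed

text \<open>For \<open>h\<^sub>1 = E\<^sub>p\<^sub>p - E\<^sub>q\<^sub>q\<close> and \<open>h\<^sub>2 = E\<^sub>q\<^sub>q - E\<^sub>s\<^sub>s\<close> the traces are \<open>1\<close> and \<open>-1\<close>; in the other chain the signs are
  exchanged.\<close>

lemma chevalley_basis_cubic_trace:
  fixes h :: "2 \<Rightarrow> complex ^ 3 ^ 3"
  assumes cb: "chevalley_basis \<rat> (sl \<rat>) H h e"
  shows "trace (h 1 ** h 1 ** h 2) \<noteq> trace (h 2 ** h 2 ** h 1)"
proof -
  obtain P :: "complex ^ 3 ^ 3" and p q r s where P: "invertible P" and pq: "p \<noteq> q" "r \<noteq> s"
    and h1: "matrix_inv P ** h 1 ** P = diag_mat (\<lambda>k. of_bool (k = p) - of_bool (k = q))"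
    and h2: "matrix_inv P ** h 2 ** P = diag_mat (\<lambda>k. of_bool (k = r) - of_bool (k = s))"
    and ne: "p \<noteq> r" "q \<noteq> s" "\<not> (p = s \<and> q = r)"
    by (rule chevalley_basis_diagonal_form[OF cb]) blast
  have C: "trace (X ** Y ** Z) = trace ((matrix_inv P ** X ** P) ** (matrix_inv P ** Y ** P) ** (matrix_inv P ** Z ** P))" for X Y Z
  proof -
    have "(matrix_inv P ** X ** P) ** (matrix_inv P ** Y ** P) ** (matrix_inv P ** Z ** P) =
      matrix_inv P ** X ** (P ** matrix_inv P) ** Y ** (P ** matrix_inv P) ** Z ** P"
      by (simp only: matrix_mul_assoc)
    also have "\<dots> = matrix_inv P ** (X ** Y ** Z ** P)"
      by (simp add: matrix_inv_mult[OF P] matrix_mul_assoc)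
    finally show ?thesis
      by (simp add: trace_mul_sym[of "matrix_inv P"]) (simp add: matrix_mul_assoc[symmetric] matrix_inv_mult[OF P])
  qed
  have tr: "trace (diag_mat a ** diag_mat b ** diag_mat c) = (\<Sum>k\<in>UNIV. a k * b k * c k)" for a b c
    by (simp add: trace_def matrix_matrix_mult_def sum_3 diag_mat_def)
  show ?thesis
    unfolding C[of "h 1"] C[of "h 2"] h1 h2 tr sum_3
    using pq ne exhaust_3[of p] exhaust_3[of q] exhaust_3[of r] exhaust_3[of s] by (elim disjE) simp_all
qed

section \<open>Polynomials, projective points and cubic forms\<close>

lemma rep_nonzero: "rep x \<noteq> 0" and pt_rep: "pt (rep x) = x"
  using Quotient3_rep_reflp[OF Quotient3_proj, of x] Quotient3_abs_rep[OF Quotient3_proj, of x] by auto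

lemma pt_eq_iff: "v \<noteq> 0 \<Longrightarrow> w \<noteq> 0 \<Longrightarrow> pt v = pt w \<longleftrightarrow> (\<exists>c. w = c *s v)"
  using Quotient3_rel[OF Quotient3_proj, of v w] by (auto intro: exI[of _ 1])

lemma pt_scale: "c \<noteq> 0 \<Longrightarrow> v \<noteq> 0 \<Longrightarrow> pt (c *s v) = pt v"
  using pt_eq_iff[of v "c *s v"] by auto

lemma rep_pt:
  assumes "v \<noteq> 0"
  obtains c where "c \<noteq> 0" "rep (pt v) = c *s v"
proof -
  have "pt v = pt (rep (pt v))" by (simp add: pt_rep)
  then obtain c where c: "rep (pt v) = c *s v" using pt_eq_iff[OF assms rep_nonzero] by metis
  then have "c \<noteq> 0" using rep_nonzero[of "pt v"] by auto
  then show ?thesis using that c by blast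
qed

definition monom_eval :: "('n \<Rightarrow>\<^sub>0 nat) \<Rightarrow> complex ^ 'n::finite \<Rightarrow> complex" where
  "monom_eval m v = (\<Prod>i\<in>UNIV. (v $ i) ^ Poly_Mapping.lookup m i)"

lemma eval_superset:
  assumes "finite A" "Poly_Mapping.keys p \<subseteq> A"
  shows "eval p v = (\<Sum>m\<in>A. Poly_Mapping.lookup p m * monom_eval m v)"
  unfolding eval_def monom_eval_def
  by (rule sum.mono_neutral_left) (use assms in \<open>auto simp: in_keys_iff\<close>)

lemma eval_add: "eval (p + q) v = eval p v + eval q v"
proof -
  let ?A = "Poly_Mapping.keys p \<union> Poly_Mapping.keys q"
  have "eval (p + q) v = (\<Sum>m\<in>?A. Poly_Mapping.lookup (p + q) m * monom_eval m v)"
    by (rule eval_superset) (use Poly_Mapping.keys_add[of p q] in auto)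
  also have "\<dots> = (\<Sum>m\<in>?A. Poly_Mapping.lookup p m * monom_eval m v) + (\<Sum>m\<in>?A. Poly_Mapping.lookup q m * monom_eval m v)"
    by (simp add: lookup_add distrib_right sum.distrib)
  also have "\<dots> = eval p v + eval q v"
    by (simp add: eval_superset[of ?A p] eval_superset[of ?A q])
  finally show ?thesis .
qed

lemma eval_zero: "eval 0 v = 0"
  by (simp add: eval_def)

lemma eval_sum: "eval (sum f A) v = (\<Sum>a\<in>A. eval (f a) v)"
  by (induction A rule: infinite_finite_induct) (simp_all add: eval_add eval_zero)

lemma eval_single: "eval (Poly_Mapping.single m c) v = c * monom_eval m v"
  by (simp add: eval_def monom_eval_def)

lemma monom_eval_add: "monom_eval (m + n) v = monom_eval m v * monom_eval n v"
  by (simp add: monom_eval_def lookup_add power_add prod.distrib)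

lemma poly_eq_sum_single: "p = (\<Sum>m\<in>Poly_Mapping.keys p. Poly_Mapping.single m (Poly_Mapping.lookup p m))"
proof (rule poly_mapping_eqI)
  fix k
  have "Poly_Mapping.lookup (\<Sum>m\<in>Poly_Mapping.keys p. Poly_Mapping.single m (Poly_Mapping.lookup p m)) k =
    (\<Sum>m\<in>Poly_Mapping.keys p. if m = k then Poly_Mapping.lookup p k else 0)"
    unfolding lookup_sum by (rule sum.cong) (auto simp: lookup_single)
  also have "\<dots> = Poly_Mapping.lookup p k" by (simp add: in_keys_iff)
  finally show "Poly_Mapping.lookup p k = Poly_Mapping.lookup (\<Sum>m\<in>Poly_Mapping.keys p. Poly_Mapping.single m (Poly_Mapping.lookup p m)) k" ..
qed

lemma eval_mult: "eval (p * q) v = eval p v * eval q v"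
proof -
  have single: "eval (Poly_Mapping.single m a * q) v = a * monom_eval m v * eval q v" for m a
  proof -
    have "Poly_Mapping.single m a * q = (\<Sum>n\<in>Poly_Mapping.keys q. Poly_Mapping.single (m + n) (a * Poly_Mapping.lookup q n))"
      by (subst (1) poly_eq_sum_single[of q]) (simp add: sum_distrib_left mult_single)
    also have "eval \<dots> v = (\<Sum>n\<in>Poly_Mapping.keys q. a * monom_eval m v * (Poly_Mapping.lookup q n * monom_eval n v))"
      by (simp add: eval_sum eval_single monom_eval_add mult_ac)
    also have "\<dots> = a * monom_eval m v * eval q v"
      by (simp add: eval_def monom_eval_def sum_distrib_left)
    finally show ?thesis .
  qed
  have "p * q = (\<Sum>m\<in>Poly_Mapping.keys p. Poly_Mapping.single m (Poly_Mapping.lookup p m) * q)"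
    by (subst (1) poly_eq_sum_single[of p]) (simp add: sum_distrib_right)
  then have "eval (p * q) v = (\<Sum>m\<in>Poly_Mapping.keys p. Poly_Mapping.lookup p m * monom_eval m v * eval q v)"
    by (simp add: eval_sum single)
  also have "\<dots> = eval p v * eval q v"
    by (simp add: eval_def monom_eval_def sum_distrib_right)
  finally show ?thesis .
qed

text \<open>Values of forms scale, so the vanishing of a form at a point does not depend on the representative of the point.\<close>

lemma eval_homogeneous:
  assumes "p \<in> forms k d"
  shows "eval p (c *s v) = c ^ d * eval p v"
proof -
  have "monom_eval m (c *s v) = c ^ d * monom_eval m v" if "m \<in> Poly_Mapping.keys p" for m
  proof -
    have "(\<Sum>i\<in>UNIV. Poly_Mapping.lookup m i) = d" using assms that by (simp add: forms_def)
    then show ?thesis by (simp add: monom_eval_def power_mult_distrib prod.distrib power_sum[symmetric])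
  qed
  then show ?thesis by (simp add: eval_superset[OF finite_keys subset_refl] sum_distrib_left mult_ac)
qed

lemma forms_const: "Poly_Mapping.single 0 c \<in> forms UNIV 0"
  by (simp add: forms_def)

lemma eval_const: "eval (Poly_Mapping.single 0 c) v = c"
  by (simp add: eval_single monom_eval_def)

lemma forms_add: "p \<in> forms UNIV d \<Longrightarrow> q \<in> forms UNIV d \<Longrightarrow> p + q \<in> forms UNIV d"
  using Poly_Mapping.keys_add[of p q] by (auto simp: forms_def)

lemma forms_mult: "p \<in> forms UNIV d \<Longrightarrow> q \<in> forms UNIV d' \<Longrightarrow> p * q \<in> forms UNIV (d + d')"
  using keys_mult[of p q] by (auto simp: forms_def lookup_add sum.distrib dest!: subsetD)

lemma eval_holomorphic:
  assumes "\<And>i. (\<lambda>t. \<gamma> t $ i) holomorphic_on U"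
  shows "(\<lambda>t. eval p (\<gamma> t)) holomorphic_on U"
  unfolding eval_def by (intro holomorphic_intros assms)

definition cubic_along :: "(complex \<Rightarrow> complex) \<Rightarrow> bool" where
  "cubic_along f \<longleftrightarrow> (\<exists>a b c d. \<forall>t. f t = a + b * t + c * t ^ 2 + d * t ^ 3)"

text \<open>On a line that avoids the origin the function is entire. By homogeneity \<open>c (v + t w) = t\<^sup>3 c (w + v / t)\<close>, so it grows
  at most like the third power of \<open>t\<close>, and Liouville's theorem applies. On a line through the origin it is a
  multiple of the cube of an affine function.\<close>

lemma homogeneous_holomorphic_cubic_along:
  fixes c :: "complex ^ 'n \<Rightarrow> complex"
  assumes hom: "\<And>a v. c (a *s v) = a ^ 3 * c v"
    and hol: "\<And>v w t. v + t *s w \<noteq> 0 \<Longrightarrow> (\<lambda>t. c (v + t *s w)) field_differentiable (at t)"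
  shows "cubic_along (\<lambda>t. c (v + t *s w))"
proof (cases "\<exists>t. v + t *s w = 0")
  case True
  then obtain t0 where t0: "v + t0 *s w = 0" by blast
  have "v + t *s w = (t - t0) *s w" for t
  proof -
    have "v + t *s w = (v + t0 *s w) + (t - t0) *s w" by (simp add: vec_eq_iff algebra_simps)
    then show ?thesis by (simp add: t0)
  qed
  then have "c (v + t *s w) = (t - t0) ^ 3 * c w" for t by (simp only: hom)
  moreover have "(t - t0) ^ 3 * c w = (- (t0 ^ 3)) * c w + 3 * t0 ^ 2 * c w * t + (- 3 * t0 * c w) * t ^ 2 + c w * t ^ 3" for t
    by (simp add: power3_eq_cube power2_eq_square algebra_simps)
  ultimately show ?thesis unfolding cubic_along_def by metis
next
  case False
  then have nz: "v + t *s w \<noteq> 0" for t by blast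
  show ?thesis
  proof (cases "w = 0")
    case True
    then have "c (v + t *s w) = c v + 0 * t + 0 * t ^ 2 + 0 * t ^ 3" for t by simp
    then show ?thesis unfolding cubic_along_def by blast
  next
    case False
    have "(\<lambda>s. c (w + s *s v)) field_differentiable (at 0)" by (rule hol) (use False in simp)
    then have "isCont (\<lambda>s. c (w + s *s v)) 0" by (rule field_differentiable_imp_continuous_at)
    then have "\<exists>d>0. \<forall>s. dist s 0 < d \<longrightarrow> dist (c (w + s *s v)) (c (w + 0 *s v)) < 1"
      unfolding continuous_at_eps_delta by (metis zero_less_one)
    then obtain d where d: "d > 0" "\<And>s. norm s < d \<Longrightarrow> dist (c (w + s *s v)) (c w) < 1"
      by auto
    define A where "A = 2 / d"
    define B where "B = norm (c w) + 1"
    have growth: "norm (c (v + t *s w)) \<le> B * norm t ^ 3" if "A \<le> norm t" for t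
    proof -
      have t: "t \<noteq> 0" using that d(1) by (auto simp: A_def)
      have "v + t *s w = t *s (w + inverse t *s v)" using t by (simp add: vec_eq_iff algebra_simps)
      then have 1: "c (v + t *s w) = t ^ 3 * c (w + inverse t *s v)" by (simp only: hom)
      have "norm (inverse t) < d"
        using le_imp_inverse_le[of "2 / d" "norm t"] that d(1) by (simp add: A_def norm_inverse)
      then have "norm (c (w + inverse t *s v)) \<le> B"
        using d(2)[of "inverse t"] norm_triangle_sub[of "c (w + inverse t *s v)" "c w"]
        by (simp add: B_def dist_norm)
      then show ?thesis
        unfolding 1 norm_mult norm_power by (subst mult.commute) (rule mult_right_mono, simp_all)
    qed
    have hol': "(\<lambda>t. c (v + t *s w)) holomorphic_on UNIV"
      using hol[OF nz] by (simp add: holomorphic_on_def)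
    define q where "q k = (deriv ^^ k) (\<lambda>t. c (v + t *s w)) 0 / fact k" for k
    have "c (v + t *s w) = (\<Sum>k\<le>3. q k * t ^ k)" for t
      using Liouville_polynomial[OF hol', of A B 3 t] growth by (simp add: q_def)
    then have "c (v + t *s w) = q 0 + q 1 * t + q 2 * t ^ 2 + q 3 * t ^ 3" for t
      by (simp add: eval_nat_numeral)
    then show ?thesis unfolding cubic_along_def by blast
  qed
qed

text \<open>\<open>interpolation i a\<close> is the coefficient of \<open>t\<^sup>i\<close> in the Lagrange polynomial that is \<open>1\<close> at the node \<open>a\<close> and \<open>0\<close> at the
  other nodes among \<open>0, 1, 2, 3\<close>.\<close>

definition interpolation :: "nat \<Rightarrow> nat \<Rightarrow> complex" where
  "interpolation i a = ([[1, 0, 0, 0], [-11/6, 3, -3/2, 1/3], [1, -5/2, 2, -1/2], [-1/6, 1/2, -1/2, 1/6]] ! i) ! a"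

lemma sum_lessThan_4: "(\<Sum>i<4. g i) = g 0 + g 1 + g 2 + g (3 :: nat)" for g :: "nat \<Rightarrow> complex"
  by (simp add: eval_nat_numeral)

lemma cubic_along_interpolation:
  assumes "cubic_along f"
  shows "f t = (\<Sum>i<4. \<Sum>a<4. interpolation i a * f (of_nat a) * t ^ i)"
proof -
  obtain a b c d where f: "\<And>t. f t = a + b * t + c * t ^ 2 + d * t ^ 3"
    using assms unfolding cubic_along_def by blast
  have vals: "f 0 = a" "f 1 = a + b + c + d" "f 2 = a + 2 * b + 4 * c + 8 * d" "f 3 = a + 3 * b + 9 * c + 27 * d"
    by (simp_all add: f)
  have "(\<Sum>k<4. interpolation 0 k * f (of_nat k)) = a" "(\<Sum>k<4. interpolation 1 k * f (of_nat k)) = b"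
    "(\<Sum>k<4. interpolation 2 k * f (of_nat k)) = c" "(\<Sum>k<4. interpolation 3 k * f (of_nat k)) = d"
    by (simp_all add: sum_lessThan_4 interpolation_def vals field_simps)
  then have "(\<Sum>i<4. (\<Sum>k<4. interpolation i k * f (of_nat k)) * t ^ i) = f t"
    unfolding sum_lessThan_4[of "\<lambda>i. (\<Sum>k<4. interpolation i k * f (of_nat k)) * t ^ i"]
    by (simp only: f) simp
  then show ?thesis by (simp add: sum_distrib_right)
qed

text \<open>Interpolation in each of the three variables shows that \<open>c\<close> is a polynomial of degree at most three in each of them.
  By homogeneity only the terms of total degree three remain.\<close>

lemma cubic_form_of_cubic_along:
  fixes c :: "complex ^ 3 \<Rightarrow> complex"
  assumes hom: "\<And>a v. c (a *s v) = a ^ 3 * c v"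
    and lines: "\<And>v w. cubic_along (\<lambda>t. c (v + t *s w))"
  obtains r where "\<And>v. c v = (\<Sum>n\<in>UNIV. r n * veronese v $ n)"
proof -
  have coord: "cubic_along (\<lambda>s. c (vector [s, t, u]))" "cubic_along (\<lambda>s. c (vector [t, s, u]))"
    "cubic_along (\<lambda>s. c (vector [t, u, s]))" for t u
  proof -
    have e: "vector [s, t, u] = vector [0, t, u] + s *s (axis 1 1 :: complex ^ 3)"
      "vector [t, s, u] = vector [t, 0, u] + s *s (axis 2 1 :: complex ^ 3)"
      "vector [t, u, s] = vector [t, u, 0] + s *s (axis 3 1 :: complex ^ 3)" for s
      by (simp_all add: vec_eq_iff forall_3 axis_def)
    show "cubic_along (\<lambda>s. c (vector [s, t, u]))"
      using lines[of "vector [0, t, u]" "axis 1 1"] by (simp only: e(1)[symmetric])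
    show "cubic_along (\<lambda>s. c (vector [t, s, u]))"
      using lines[of "vector [t, 0, u]" "axis 2 1"] by (simp only: e(2)[symmetric])
    show "cubic_along (\<lambda>s. c (vector [t, u, s]))"
      using lines[of "vector [t, u, 0]" "axis 3 1"] by (simp only: e(3)[symmetric])
  qed
  have I: "c (vector [s, t, u]) = (\<Sum>i<4. \<Sum>a<4. interpolation i a * c (vector [of_nat a, t, u]) * s ^ i)"
    "c (vector [s, t, u]) = (\<Sum>i<4. \<Sum>a<4. interpolation i a * c (vector [s, of_nat a, u]) * t ^ i)"
    "c (vector [s, t, u]) = (\<Sum>i<4. \<Sum>a<4. interpolation i a * c (vector [s, t, of_nat a]) * u ^ i)" for s t u
    by (rule cubic_along_interpolation[OF coord(1)] cubic_along_interpolation[OF coord(2)]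
        cubic_along_interpolation[OF coord(3)])+
  define C where "C i j k = (\<Sum>a<4. \<Sum>b<4. \<Sum>e<4. interpolation i a * interpolation j b * interpolation k e *
    c (vector [of_nat a, of_nat b, of_nat e]))" for i j k
  have expand: "c (vector [s, t, u]) = (\<Sum>i<4. \<Sum>j<4. \<Sum>k<4. C i j k * s ^ i * t ^ j * u ^ k)" for s t u
  proof -
    have "c (vector [s, t, u]) = (\<Sum>i<4. \<Sum>a<4. interpolation i a * (\<Sum>j<4. \<Sum>b<4. interpolation j b *
      (\<Sum>k<4. \<Sum>e<4. interpolation k e * c (vector [of_nat a, of_nat b, of_nat e]) * u ^ k) * t ^ j) * s ^ i)"
      by (simp only: I(1)[of s t u], simp only: I(2)[of _ t u], simp only: I(3)[of _ _ u])
    also have "\<dots> = (\<Sum>i<4. \<Sum>a<4. \<Sum>j<4. \<Sum>b<4. \<Sum>k<4. \<Sum>e<4. interpolation i a * interpolation j b * interpolation k e *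
       c (vector [of_nat a, of_nat b, of_nat e]) * s ^ i * t ^ j * u ^ k)"
      by (simp add: sum_distrib_left sum_distrib_right mult_ac)
    also have "\<dots> = (\<Sum>i<4. \<Sum>j<4. \<Sum>a<4. \<Sum>k<4. \<Sum>b<4. \<Sum>e<4. interpolation i a * interpolation j b * interpolation k e *
       c (vector [of_nat a, of_nat b, of_nat e]) * s ^ i * t ^ j * u ^ k)"
      by (subst (2) sum.swap, subst (4) sum.swap) (rule refl)
    also have "\<dots> = (\<Sum>i<4. \<Sum>j<4. \<Sum>k<4. \<Sum>a<4. \<Sum>b<4. \<Sum>e<4. interpolation i a * interpolation j b * interpolation k e *
       c (vector [of_nat a, of_nat b, of_nat e]) * s ^ i * t ^ j * u ^ k)"
      by (subst (3) sum.swap) (rule refl)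
    also have "\<dots> = (\<Sum>i<4. \<Sum>j<4. \<Sum>k<4. C i j k * s ^ i * t ^ j * u ^ k)"
      by (simp add: C_def sum_distrib_right)
    finally show ?thesis .
  qed
  have graded: "c (vector [s, t, u]) = (\<Sum>i<4. \<Sum>j<4. \<Sum>k<4. if i + j + k = 3 then C i j k * s ^ i * t ^ j * u ^ k else 0)" for s t u
  proof -
    \<comment> \<open>the polynomial \<open>c (x v) - x\<^sup>3 c v\<close> in \<open>x\<close>\<close>
    define p where "p = (\<Sum>i<4. \<Sum>j<4. \<Sum>k<4. monom (C i j k * s ^ i * t ^ j * u ^ k) (i + j + k)) - monom (c (vector [s, t, u])) 3"
    have "p = 0"
    proof (rule poly_zero_off_origin)
      fix x :: complex
      have "x *s vector [s, t, u] = (vector [x * s, x * t, x * u] :: complex ^ 3)"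
        by (simp add: vec_eq_iff forall_3)
      then have "x ^ 3 * c (vector [s, t, u]) = c (vector [x * s, x * t, x * u])" using hom by metis
      also have "\<dots> = (\<Sum>i<4. \<Sum>j<4. \<Sum>k<4. C i j k * s ^ i * t ^ j * u ^ k * x ^ (i + j + k))"
        unfolding expand by (simp add: power_mult_distrib power_add mult_ac)
      finally show "poly p x = 0" by (simp add: p_def poly_sum poly_monom mult.commute)
    qed
    then have "coeff p 3 = 0" by simp
    then show ?thesis by (simp add: p_def coeff_sum)
  qed
  define r :: "10 \<Rightarrow> complex" where "r n = (if n = 1 then C 3 0 0 else if n = 2 then C 0 3 0 else if n = 3 then C 0 0 3
    else if n = 4 then C 2 1 0 else if n = 5 then C 0 2 1 else if n = 6 then C 1 0 2 else if n = 7 then C 1 2 0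
    else if n = 8 then C 0 1 2 else if n = 9 then C 2 0 1 else C 1 1 1)" for n
  have "c v = (\<Sum>n\<in>UNIV. r n * veronese v $ n)" for v
  proof -
    have v: "v = vector [v $ 1, v $ 2, v $ 3]" by (simp add: vec_eq_iff forall_3)
    have "c v = (\<Sum>i<4. \<Sum>j<4. \<Sum>k<4. if i + j + k = 3 then C i j k * v $ 1 ^ i * v $ 2 ^ j * v $ 3 ^ k else 0)"
      by (subst v) (rule graded)
    also have "\<dots> = (\<Sum>n\<in>UNIV. r n * veronese v $ n)"
      unfolding sum_10 veronese_nth by (simp add: r_def eval_nat_numeral lessThan_Suc)
    finally show ?thesis .
  qed
  then show ?thesis by (rule that)
qed

section \<open>Anticanonical sections as cubic forms\<close>

abbreviation "regular S f x \<equiv> regular_at UNIV S f x"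

lemma regular_const: "regular S (\<lambda>y. c) x"
  unfolding regular_at_def
  by (rule exI[of _ 0], rule bexI[OF _ forms_const[of c]], rule bexI[OF _ forms_const[of 1]]) (simp add: eval_const del: single_one)

lemma regular_indicator: "regular S (\<lambda>y. if y \<in> S then 1 else 0) x"
  unfolding regular_at_def
  by (rule exI[of _ 0], rule bexI[OF _ forms_const[of 1]], rule bexI[OF _ forms_const[of 1]]) (simp add: eval_const del: single_one)

lemma regular_add:
  assumes "regular S f x" "regular S h x"
  shows "regular S (\<lambda>y. f y + h y) x"
proof -
  obtain d p q where f: "p \<in> forms UNIV d" "q \<in> forms UNIV d" "eval q (rep x) \<noteq> 0"
    "\<And>v. v \<noteq> 0 \<Longrightarrow> pt v \<in> S \<Longrightarrow> eval q v \<noteq> 0 \<Longrightarrow> f (pt v) = eval p v / eval q v"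
    using assms(1) unfolding regular_at_def by blast
  obtain d' p' q' where h: "p' \<in> forms UNIV d'" "q' \<in> forms UNIV d'" "eval q' (rep x) \<noteq> 0"
    "\<And>v. v \<noteq> 0 \<Longrightarrow> pt v \<in> S \<Longrightarrow> eval q' v \<noteq> 0 \<Longrightarrow> h (pt v) = eval p' v / eval q' v"
    using assms(2) unfolding regular_at_def by blast
  have "p * q' + q * p' \<in> forms UNIV (d + d')" "q * q' \<in> forms UNIV (d + d')"
    using f h by (auto intro: forms_add forms_mult)
  moreover have "f (pt v) + h (pt v) = eval (p * q' + q * p') v / eval (q * q') v"
    if "v \<noteq> 0" "pt v \<in> S" "eval (q * q') v \<noteq> 0" for v
    using that f(4)[of v] h(4)[of v] by (simp add: eval_add eval_mult add_frac_eq mult_ac)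
  moreover have "eval (q * q') (rep x) \<noteq> 0" using f h by (simp add: eval_mult)
  ultimately show ?thesis unfolding regular_at_def by blast
qed

lemma regular_mult:
  assumes "regular S f x" "regular S h x"
  shows "regular S (\<lambda>y. f y * h y) x"
proof -
  obtain d p q where f: "p \<in> forms UNIV d" "q \<in> forms UNIV d" "eval q (rep x) \<noteq> 0"
    "\<And>v. v \<noteq> 0 \<Longrightarrow> pt v \<in> S \<Longrightarrow> eval q v \<noteq> 0 \<Longrightarrow> f (pt v) = eval p v / eval q v"
    using assms(1) unfolding regular_at_def by blast
  obtain d' p' q' where h: "p' \<in> forms UNIV d'" "q' \<in> forms UNIV d'" "eval q' (rep x) \<noteq> 0"
    "\<And>v. v \<noteq> 0 \<Longrightarrow> pt v \<in> S \<Longrightarrow> eval q' v \<noteq> 0 \<Longrightarrow> h (pt v) = eval p' v / eval q' v"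
    using assms(2) unfolding regular_at_def by blast
  have "p * p' \<in> forms UNIV (d + d')" "q * q' \<in> forms UNIV (d + d')"
    using f h by (auto intro: forms_mult)
  moreover have "f (pt v) * h (pt v) = eval (p * p') v / eval (q * q') v"
    if "v \<noteq> 0" "pt v \<in> S" "eval (q * q') v \<noteq> 0" for v
    using that f(4)[of v] h(4)[of v] by (simp add: eval_mult)
  moreover have "eval (q * q') (rep x) \<noteq> 0" using f h by (simp add: eval_mult)
  ultimately show ?thesis unfolding regular_at_def by blast
qed

text \<open>Fixing one argument and the point in a biderivation leaves a derivation of the local ring with values in the residue
  field.\<close>

definition derivation_at :: "'n::finite proj set \<Rightarrow> 'n proj \<Rightarrow> (('n proj \<Rightarrow> complex) \<Rightarrow> complex) \<Rightarrow> bool" where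
  "derivation_at S x D \<longleftrightarrow> (\<forall>f. regular S f x \<longrightarrow> (\<forall>c. D (\<lambda>y. c * f y) = c * D f) \<and>
     (\<forall>h. regular S h x \<longrightarrow> D (\<lambda>y. f y + h y) = D f + D h \<and> D (\<lambda>y. f y * h y) = f x * D h + h x * D f))"

lemma section_derivation:
  assumes \<sigma>: "anticanonical_section k S \<sigma>" and x: "x \<in> S" and g: "regular S g x"
  shows "derivation_at S x (\<lambda>f. \<sigma> f g x)" "derivation_at S x (\<lambda>f. \<sigma> g f x)"
proof -
  have ax: "\<sigma> f g x = - \<sigma> g f x" "\<sigma> (\<lambda>y. c * f y) g x = c * \<sigma> f g x"
    "regular S h x \<Longrightarrow> \<sigma> (\<lambda>y. f y + h y) g x = \<sigma> f g x + \<sigma> h g x"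
    "regular S h x \<Longrightarrow> \<sigma> (\<lambda>y. f y * h y) g x = f x * \<sigma> h g x + h x * \<sigma> f g x"
    if "regular S f x" for f h c
    using \<sigma> x g that unfolding anticanonical_section_def by blast+
  then show 1: "derivation_at S x (\<lambda>f. \<sigma> f g x)" unfolding derivation_at_def by blast
  have neg: "\<sigma> g f x = - \<sigma> f g x" if "regular S f x" for f using ax(1)[OF that] by simp
  show "derivation_at S x (\<lambda>f. \<sigma> g f x)"
    unfolding derivation_at_def
  proof (intro allI impI conjI)
    fix f c
    assume f: "regular S f x"
    have "regular S (\<lambda>y. c * f y) x" using regular_mult[OF regular_const f] .
    then show "\<sigma> g (\<lambda>y. c * f y) x = c * \<sigma> g f x" using neg f ax(2) by simp
    fix h
    assume h: "regular S h x"
    show "\<sigma> g (\<lambda>y. f y + h y) x = \<sigma> g f x + \<sigma> g h x"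
      using neg[OF regular_add[OF f h]] neg f h ax(3) by simp
    show "\<sigma> g (\<lambda>y. f y * h y) x = f x * \<sigma> g h x + h x * \<sigma> g f x"
      using neg[OF regular_mult[OF f h]] neg f h ax(4) by simp
  qed
qed

lemma section_antisymmetric:
  assumes "anticanonical_section k S \<sigma>" "x \<in> S" "regular S f x" "regular S g x"
  shows "\<sigma> f f x = 0" "\<sigma> f g x = - \<sigma> g f x" "regular S (\<sigma> f g) x"
  using assms unfolding anticanonical_section_def by blast+

context
  fixes S :: "'n::finite proj set" and x :: "'n proj" and D :: "('n proj \<Rightarrow> complex) \<Rightarrow> complex"
  assumes D: "derivation_at S x D"
begin

lemma derivation_add: "regular S f x \<Longrightarrow> regular S h x \<Longrightarrow> D (\<lambda>y. f y + h y) = D f + D h"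
  and derivation_mult: "regular S f x \<Longrightarrow> regular S h x \<Longrightarrow> D (\<lambda>y. f y * h y) = f x * D h + h x * D f"
  and derivation_scale: "regular S f x \<Longrightarrow> D (\<lambda>y. c * f y) = c * D f"
  using D unfolding derivation_at_def by blast+

lemma derivation_const: "D (\<lambda>y. c) = 0"
  using derivation_mult[OF regular_const[of S 1] regular_const[of S 1]]
    derivation_scale[OF regular_const[of S 1], of c] by simp

text \<open>This makes derivations ignore functions that are locally constant for a trivial reason: indicator functions, and
  quotients \<open>z / z\<close> with the default value \<open>0\<close> at \<open>z = 0\<close>.\<close>

lemma derivation_idempotent:
  assumes e: "regular S e x" "\<And>y. e y * e y = e y"
  shows "D e = 0"
proof -
  have "D e = e x * D e + e x * D e" using derivation_mult[OF e(1) e(1)] e(2) by simp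
  moreover have "e x = 0 \<or> e x = 1" using e(2)[of x] by simp
  ultimately show ?thesis by auto
qed

text \<open>Derivations depend on germs only: \<open>f\<close> and \<open>h\<close> agree where the auxiliary function \<open>e\<close> does not vanish, so \<open>(f - h) e = 0\<close>, and
  the product rule at \<open>x\<close> gives \<open>e(x) D (f - h) = 0\<close>.\<close>

lemma derivation_local:
  assumes u: "regular S f x" "regular S h x" and e: "regular S e x" "e x \<noteq> 0"
    and eq: "\<And>y. e y \<noteq> 0 \<Longrightarrow> f y = h y"
  shows "D f = D h"
proof -
  have h': "regular S (\<lambda>y. -1 * h y) x" using regular_mult[OF regular_const u(2)] .
  have r: "regular S (\<lambda>y. f y + -1 * h y) x" by (rule regular_add[OF u(1) h'])
  have "(\<lambda>y. (f y + -1 * h y) * e y) = (\<lambda>y. 0)"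
    using eq by (auto simp: fun_eq_iff)
  then have "0 = (f x + -1 * h x) * D e + e x * D (\<lambda>y. f y + -1 * h y)"
    using derivation_mult[OF r e(1)] derivation_const[of 0] by simp
  also have "D (\<lambda>y. f y + -1 * h y) = D f - D h"
    using derivation_add[OF u(1) h'] derivation_scale[OF u(2), of "-1"] by simp
  finally show ?thesis using eq[OF e(2)] e(2) by simp
qed

end

text \<open>\<open>f\<close> has a chain rule with respect to \<open>X\<close> and \<open>Y\<close>: its differential at \<open>x\<close> is a combination of those of \<open>X\<close> and \<open>Y\<close>, with
  the same coefficients for all derivations.\<close>

definition spanned_by :: "'n::finite proj set \<Rightarrow> 'n proj \<Rightarrow> ('n proj \<Rightarrow> complex) \<Rightarrow> ('n proj \<Rightarrow> complex) \<Rightarrow> ('n proj \<Rightarrow> complex) \<Rightarrow> bool" where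
  "spanned_by S x X Y f \<longleftrightarrow> regular S f x \<and> (\<exists>A B. \<forall>D. derivation_at S x D \<longrightarrow> D f = A * D X + B * D Y)"

context
  fixes S :: "'n::finite proj set" and x :: "'n proj" and X Y :: "'n proj \<Rightarrow> complex"
begin

lemma spanned_by_const: "spanned_by S x X Y (\<lambda>y. c)"
  unfolding spanned_by_def by (auto intro!: exI[of _ 0] simp: regular_const derivation_const)

lemma spanned_by_idempotent: "regular S e x \<Longrightarrow> (\<And>y. e y * e y = e y) \<Longrightarrow> spanned_by S x X Y e"
  unfolding spanned_by_def by (auto intro!: exI[of _ 0] simp: derivation_idempotent)

lemma spanned_by_add:
  assumes "spanned_by S x X Y f" "spanned_by S x X Y h"
  shows "spanned_by S x X Y (\<lambda>y. f y + h y)"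
proof -
  obtain A B A' B' where AB: "\<And>D. derivation_at S x D \<Longrightarrow> D f = A * D X + B * D Y"
    "\<And>D. derivation_at S x D \<Longrightarrow> D h = A' * D X + B' * D Y" and r: "regular S f x" "regular S h x"
    using assms unfolding spanned_by_def by blast
  have "D (\<lambda>y. f y + h y) = (A + A') * D X + (B + B') * D Y" if "derivation_at S x D" for D
    unfolding derivation_add[OF that r] AB(1)[OF that] AB(2)[OF that] by (simp add: algebra_simps)
  then show ?thesis using regular_add[OF r] unfolding spanned_by_def by blast
qed

lemma spanned_by_mult:
  assumes "spanned_by S x X Y f" "spanned_by S x X Y h"
  shows "spanned_by S x X Y (\<lambda>y. f y * h y)"
proof -
  obtain A B A' B' where AB: "\<And>D. derivation_at S x D \<Longrightarrow> D f = A * D X + B * D Y"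
    "\<And>D. derivation_at S x D \<Longrightarrow> D h = A' * D X + B' * D Y" and r: "regular S f x" "regular S h x"
    using assms unfolding spanned_by_def by blast
  have "D (\<lambda>y. f y * h y) = (f x * A' + h x * A) * D X + (f x * B' + h x * B) * D Y" if "derivation_at S x D" for D
    unfolding derivation_mult[OF that r] AB(1)[OF that] AB(2)[OF that] by (simp add: algebra_simps)
  then show ?thesis using regular_mult[OF r] unfolding spanned_by_def by blast
qed

lemma spanned_by_sum: "(\<And>a. a \<in> A \<Longrightarrow> spanned_by S x X Y (f a)) \<Longrightarrow> spanned_by S x X Y (\<lambda>y. \<Sum>a\<in>A. f a y)"
  by (induction A rule: infinite_finite_induct) (simp_all add: spanned_by_const spanned_by_add)

lemma spanned_by_prod: "(\<And>a. a \<in> A \<Longrightarrow> spanned_by S x X Y (f a)) \<Longrightarrow> spanned_by S x X Y (\<lambda>y. \<Prod>a\<in>A. f a y)"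
  by (induction A rule: infinite_finite_induct) (simp_all add: spanned_by_const spanned_by_mult)

lemma spanned_by_power: "spanned_by S x X Y f \<Longrightarrow> spanned_by S x X Y (\<lambda>y. f y ^ m)"
  by (induction m) (simp_all add: spanned_by_const spanned_by_mult)

lemma spanned_by_eval:
  assumes "\<And>i. spanned_by S x X Y (\<lambda>y. t y $ i)"
  shows "spanned_by S x X Y (\<lambda>y. eval p (t y))"
  unfolding eval_def
  by (intro spanned_by_sum spanned_by_mult spanned_by_prod spanned_by_power spanned_by_const assms)

end

text \<open>A triple \<open>(k, i, j)\<close> stands for the chart \<open>v\<^sub>k \<noteq> 0\<close> of the plane with the coordinates \<open>v\<^sub>i / v\<^sub>k\<close> and \<open>v\<^sub>j / v\<^sub>k\<close>. The cyclic
  order of the indices fixes the signs in the transition from one chart to the next.\<close>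

definition cyclic_charts :: "(3 \<times> 3 \<times> 3) set" where
  "cyclic_charts = {(1, 2, 3), (2, 3, 1), (3, 1, 2)}"

text \<open>The quotient of two homogeneous coordinates of the plane, as a function on the surface. The map \<open>\<psi>\<close> is the inverse of
  a parametrization of the surface by the plane.\<close>

definition coord_ratio :: "('n proj \<Rightarrow> 3 proj) \<Rightarrow> 3 \<Rightarrow> 3 \<Rightarrow> 'n::finite proj \<Rightarrow> complex" where
  "coord_ratio \<psi> a b y = rep (\<psi> y) $ a / rep (\<psi> y) $ b"

lemma eval_homogeneous_eq_0_iff: "p \<in> forms UNIV d \<Longrightarrow> c \<noteq> 0 \<Longrightarrow> eval p (c *s v) = 0 \<longleftrightarrow> eval p v = 0"
  by (simp add: eval_homogeneous)

lemma eval_vec_homogeneous: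
  assumes "\<And>j. P j \<in> forms UNIV d"
  shows "(\<chi> j. eval (P j) (c *s v)) = c ^ d *s (\<chi> j. eval (P j) v)"
  by (simp add: vec_eq_iff eval_homogeneous[OF assms])

context
  fixes S :: "'n::finite proj set" and \<phi> :: "3 proj \<Rightarrow> 'n proj"
  assumes iso: "variety_iso UNIV UNIV S \<phi>"
begin

abbreviation "\<phi>_inv \<equiv> inv_into UNIV \<phi>"

lemma bij_\<phi>: "\<phi> y \<in> S" "\<phi>_inv (\<phi> y) = y" "x \<in> S \<Longrightarrow> \<phi> (\<phi>_inv x) = x"
  using iso unfolding variety_iso_def bij_betw_def by (auto simp: f_inv_into_f)

lemma local_forms_\<phi>:
  assumes "v0 \<noteq> 0"
  obtains P d where "\<And>j. P j \<in> forms UNIV d" "(\<chi> j. eval (P j) v0) \<noteq> 0"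
    "\<And>v. v \<noteq> 0 \<Longrightarrow> (\<chi> j. eval (P j) v) \<noteq> 0 \<Longrightarrow> \<phi> (pt v) = pt (\<chi> j. eval (P j) v)"
proof -
  obtain d P where P: "\<And>j. P j \<in> forms UNIV d" "(\<chi> j. eval (P j) (rep (pt v0))) \<noteq> 0"
    "\<And>v. v \<noteq> 0 \<Longrightarrow> (\<chi> j. eval (P j) v) \<noteq> 0 \<Longrightarrow> \<phi> (pt v) = pt (\<chi> j. eval (P j) v)"
    using iso unfolding variety_iso_def regular_map_def by (metis UNIV_I)
  obtain c where c: "c \<noteq> 0" "rep (pt v0) = c *s v0" by (rule rep_pt[OF assms])
  have "(\<chi> j. eval (P j) v0) \<noteq> 0"
    using P(2) unfolding c(2) eval_vec_homogeneous[OF P(1)] by auto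
  then show ?thesis using P that by blast
qed

lemma regular_coord_ratio:
  assumes x: "x \<in> S" and b: "rep (\<phi>_inv x) $ b \<noteq> 0"
  shows "regular S (coord_ratio \<phi>_inv a b) x"
proof -
  obtain d P where P: "\<And>j. P j \<in> forms UNIV d" "(\<chi> j. eval (P j) (rep x)) \<noteq> 0"
    "\<And>v. v \<noteq> 0 \<Longrightarrow> pt v \<in> S \<Longrightarrow> (\<chi> j. eval (P j) v) \<noteq> 0 \<Longrightarrow> \<phi>_inv (pt v) = pt (\<chi> j. eval (P j) v)"
    using iso x unfolding variety_iso_def regular_map_def by metis
  have rep: "\<exists>c. c \<noteq> 0 \<and> rep (\<phi>_inv (pt v)) = c *s (\<chi> j. eval (P j) v)"
    if "v \<noteq> 0" "pt v \<in> S" "(\<chi> j. eval (P j) v) \<noteq> 0" for v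
    using rep_pt[OF that(3)] P(3)[OF that] by metis
  obtain c where "rep (\<phi>_inv x) = c *s (\<chi> j. eval (P j) (rep x))"
    using rep[of "rep x"] P(2) rep_nonzero x by (auto simp: pt_rep)
  then have "eval (P b) (rep x) \<noteq> 0" using b by auto
  moreover have "coord_ratio \<phi>_inv a b (pt v) = eval (P a) v / eval (P b) v"
    if v: "v \<noteq> 0" "pt v \<in> S" "eval (P b) v \<noteq> 0" for v
  proof -
    have "(\<chi> j. eval (P j) v) \<noteq> 0" using v(3) by (auto simp: vec_eq_iff)
    from rep[OF v(1,2) this] show ?thesis by (auto simp: coord_ratio_def)
  qed
  ultimately show ?thesis unfolding regular_at_def using P(1) by blast
qed

text \<open>The surface has dimension two: near \<open>x\<close> it is parametrized by polynomials \<open>t\<close> in the two affine coordinates of the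
  plane, so a regular function \<open>f = p / q\<close> satisfies \<open>f q(t) = p(t)\<close> there. The product rule then expresses the
  derivative of \<open>f\<close> by those of the coordinates.\<close>

lemma regular_spanned_by_coords:
  assumes x: "x \<in> S" and k: "rep (\<phi>_inv x) $ k \<noteq> 0" and ijk: "UNIV = {k, i, j}" and f: "regular S f x"
  shows "spanned_by S x (coord_ratio \<phi>_inv i k) (coord_ratio \<phi>_inv j k) f"
proof -
  let ?X = "coord_ratio \<phi>_inv i k" and ?Y = "coord_ratio \<phi>_inv j k"
  let ?sp = "spanned_by S x ?X ?Y"
  define r :: "'n proj \<Rightarrow> complex ^ 3" where "r y = (\<chi> l. coord_ratio \<phi>_inv l k y)" for y
  have XY: "?sp ?X" "?sp ?Y"
    unfolding spanned_by_def
    by (rule conjI[OF regular_coord_ratio[OF x k]], rule exI[of _ 1], rule exI[of _ 0], simp)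
       (rule conjI[OF regular_coord_ratio[OF x k]], rule exI[of _ 0], rule exI[of _ 1], simp)
  have kk: "?sp (coord_ratio \<phi>_inv k k)"
    by (rule spanned_by_idempotent[OF regular_coord_ratio[OF x k]]) (simp add: coord_ratio_def)
  have r: "?sp (\<lambda>y. r y $ l)" for l
  proof -
    have "l \<in> {k, i, j}" using ijk by blast
    then show ?thesis using XY kk by (auto simp: r_def)
  qed
  have rr: "r y = inverse (rep (\<phi>_inv y) $ k) *s rep (\<phi>_inv y)" for y
    by (simp add: r_def coord_ratio_def vec_eq_iff divide_inverse mult.commute)
  have pt_r: "pt (r y) = \<phi>_inv y" "r y \<noteq> 0" if "rep (\<phi>_inv y) $ k \<noteq> 0" for y
    using that pt_scale[of "inverse (rep (\<phi>_inv y) $ k)" "rep (\<phi>_inv y)"] rep_nonzero[of "\<phi>_inv y"]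
    unfolding rr by (auto simp: pt_rep vec_eq_iff)
  obtain P d where P: "\<And>j. P j \<in> forms UNIV d" "(\<chi> j. eval (P j) (r x)) \<noteq> 0"
    "\<And>v. v \<noteq> 0 \<Longrightarrow> (\<chi> j. eval (P j) v) \<noteq> 0 \<Longrightarrow> \<phi> (pt v) = pt (\<chi> j. eval (P j) v)"
    by (rule local_forms_\<phi>[OF pt_r(2)[OF k]]) blast
  define t :: "'n proj \<Rightarrow> complex ^ 'n" where "t y = (\<chi> j. eval (P j) (r y))" for y
  have t: "?sp (\<lambda>y. t y $ l)" for l
    unfolding t_def by (simp add: spanned_by_eval r)
  have pt_t: "pt (t y) = y" if "y \<in> S" "rep (\<phi>_inv y) $ k \<noteq> 0" "t y \<noteq> 0" for y
    using P(3)[OF pt_r(2)[OF that(2)]] that(1,3) pt_r(1)[OF that(2)] bij_\<phi>(3)[OF that(1)] by (simp add: t_def)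
  obtain d' p q where pq: "q \<in> forms UNIV d'" "eval q (rep x) \<noteq> 0"
    "\<And>v. v \<noteq> 0 \<Longrightarrow> pt v \<in> S \<Longrightarrow> eval q v \<noteq> 0 \<Longrightarrow> f (pt v) = eval p v / eval q v"
    using f unfolding regular_at_def by blast
  have tx: "t x \<noteq> 0" using P(2) by (simp add: t_def)
  then obtain l where l: "t x $ l \<noteq> 0" by (auto simp: vec_eq_iff)
  obtain c where c: "c \<noteq> 0" "rep (pt (t x)) = c *s t x" by (rule rep_pt[OF tx])
  have qx: "eval q (t x) \<noteq> 0"
    using pq(2) eval_homogeneous_eq_0_iff[OF pq(1) c(1)] pt_t[OF x k tx] c(2) by metis
  have sa: "?sp (\<lambda>y. eval p (t y))" and sb: "?sp (\<lambda>y. eval q (t y))"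
    by (rule spanned_by_eval[OF t])+
  \<comment> \<open>\<open>e\<close> vanishes wherever the equation \<open>f q(t) = p(t)\<close> might fail because of default values\<close>
  define e where "e y = (if y \<in> S then 1 else 0) * (coord_ratio \<phi>_inv k k y * (t y $ l * eval q (t y)))" for y
  have "?sp e"
    unfolding e_def by (intro spanned_by_mult kk t sb spanned_by_idempotent regular_indicator) simp
  then have re: "regular S e x" by (simp add: spanned_by_def)
  have ex: "e x \<noteq> 0" using x k l qx by (simp add: e_def coord_ratio_def)
  have reg: "regular S (\<lambda>y. eval p (t y)) x" "regular S (\<lambda>y. eval q (t y)) x"
    using sa sb by (simp_all add: spanned_by_def)
  have eq: "f y * eval q (t y) = eval p (t y)" if "e y \<noteq> 0" for y
  proof -
    have y: "y \<in> S" "rep (\<phi>_inv y) $ k \<noteq> 0" "t y $ l \<noteq> 0" "eval q (t y) \<noteq> 0"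
      using that by (auto simp: e_def coord_ratio_def split: if_splits)
    then have "t y \<noteq> 0" by auto
    then have "f y = eval p (t y) / eval q (t y)" using pq(3)[of "t y"] pt_t[OF y(1,2)] y by simp
    then show ?thesis using y(4) by simp
  qed
  obtain A B A' B' where AB: "\<And>D. derivation_at S x D \<Longrightarrow> D (\<lambda>y. eval p (t y)) = A * D ?X + B * D ?Y"
    "\<And>D. derivation_at S x D \<Longrightarrow> D (\<lambda>y. eval q (t y)) = A' * D ?X + B' * D ?Y"
    using sa sb unfolding spanned_by_def by blast
  have "D f = ((A - f x * A') / eval q (t x)) * D ?X + ((B - f x * B') / eval q (t x)) * D ?Y"
    if D: "derivation_at S x D" for D
  proof -
    have "D (\<lambda>y. f y * eval q (t y)) = D (\<lambda>y. eval p (t y))"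
      by (rule derivation_local[OF D regular_mult[OF f reg(2)] reg(1) re ex eq])
    then have "f x * (A' * D ?X + B' * D ?Y) + eval q (t x) * D f = A * D ?X + B * D ?Y"
      using derivation_mult[OF D f reg(2)] AB[OF D] by simp
    then have "eval q (t x) * D f = (A - f x * A') * D ?X + (B - f x * B') * D ?Y"
      by (simp add: algebra_simps)
    then have "D f = ((A - f x * A') * D ?X + (B - f x * B') * D ?Y) / eval q (t x)"
      unfolding nonzero_eq_divide_eq[OF qx] by (subst mult.commute)
    then show ?thesis by (simp add: add_divide_distrib)
  qed
  then show ?thesis unfolding spanned_by_def using f by blast
qed

text \<open>The fibre of the anticanonical bundle is one-dimensional: by the chain rule, the value of a section at \<open>(f, g)\<close> is the
  Jacobian determinant of \<open>f, g\<close> times its value at the coordinates.\<close>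

lemma section_values_proportional:
  assumes x: "x \<in> S" and k: "rep (\<phi>_inv x) $ k \<noteq> 0" and ijk: "UNIV = {k, i, j}"
    and f: "regular S f x" and g: "regular S g x"
  obtains J where "\<And>k' \<sigma>. anticanonical_section k' S \<sigma> \<Longrightarrow> \<sigma> f g x = J * \<sigma> (coord_ratio \<phi>_inv i k) (coord_ratio \<phi>_inv j k) x"
proof -
  let ?X = "coord_ratio \<phi>_inv i k" and ?Y = "coord_ratio \<phi>_inv j k"
  obtain A B A' B' where AB: "\<And>D. derivation_at S x D \<Longrightarrow> D f = A * D ?X + B * D ?Y"
    "\<And>D. derivation_at S x D \<Longrightarrow> D g = A' * D ?X + B' * D ?Y"
    using regular_spanned_by_coords[OF x k ijk f] regular_spanned_by_coords[OF x k ijk g]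
    unfolding spanned_by_def by blast
  have "\<sigma> f g x = (A * B' - B * A') * \<sigma> ?X ?Y x" if \<sigma>: "anticanonical_section k' S \<sigma>" for k' \<sigma>
  proof -
    note X = regular_coord_ratio[OF x k, of i] and Y = regular_coord_ratio[OF x k, of j]
    have "\<sigma> f g x = A * \<sigma> ?X g x + B * \<sigma> ?Y g x"
      using AB(1)[OF section_derivation(1)[OF \<sigma> x g]] .
    also have "\<sigma> ?X g x = A' * \<sigma> ?X ?X x + B' * \<sigma> ?X ?Y x"
      using AB(2)[OF section_derivation(2)[OF \<sigma> x X]] .
    also have "\<sigma> ?Y g x = A' * \<sigma> ?Y ?X x + B' * \<sigma> ?Y ?Y x"
      using AB(2)[OF section_derivation(2)[OF \<sigma> x Y]] .
    finally show ?thesis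
      unfolding section_antisymmetric(1)[OF \<sigma> x X X] section_antisymmetric(1)[OF \<sigma> x Y Y]
        section_antisymmetric(2)[OF \<sigma> x Y X] by (simp add: algebra_simps)
  qed
  then show ?thesis by (rule that)
qed

text \<open>The value of a section in a chart, multiplied by the third power of the coordinate \<open>v\<^sub>k\<close>. This power makes the values
  in different charts agree, which is why anticanonical sections of the plane are cubic forms.\<close>

definition chart_value :: "'n biderivation \<Rightarrow> 3 \<Rightarrow> 3 \<Rightarrow> 3 \<Rightarrow> complex ^ 3 \<Rightarrow> complex" where
  "chart_value \<sigma> k i j v = v $ k ^ 3 * \<sigma> (coord_ratio \<phi>_inv i k) (coord_ratio \<phi>_inv j k) (\<phi> (pt v))"

text \<open>With \<open>X = v\<^sub>i / v\<^sub>k\<close> and \<open>Y = v\<^sub>j / v\<^sub>k\<close> the coordinates of the next chart are \<open>Y / X\<close> and \<open>1 / X\<close>, and the product rule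
  gives \<open>\<sigma> (Y / X) (1 / X) = X\<^sup>-\<^sup>3 \<sigma> X Y\<close>.\<close>

lemma chart_value_change:
  assumes \<sigma>: "anticanonical_section k' S \<sigma>" and v: "v $ k \<noteq> 0" "v $ i \<noteq> 0"
  shows "chart_value \<sigma> k i j v = chart_value \<sigma> i j k v"
proof -
  let ?x = "\<phi> (pt v)" and ?r = "coord_ratio \<phi>_inv"
  have "v \<noteq> 0" using v by auto
  then obtain c where c: "c \<noteq> 0" "rep (\<phi>_inv ?x) = c *s v" using rep_pt[of v] by (metis bij_\<phi>(2))
  have x: "?x \<in> S" by (rule bij_\<phi>)
  have k: "rep (\<phi>_inv ?x) $ k \<noteq> 0" and i: "rep (\<phi>_inv ?x) $ i \<noteq> 0" using c v by simp_all
  note reg = regular_coord_ratio[OF x k] regular_coord_ratio[OF x i]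
  have val: "?r a b ?x = v $ a / v $ b" for a b using c by (simp add: coord_ratio_def)
  have D: "derivation_at S ?x (\<lambda>f. \<sigma> f (?r k i) ?x)" "derivation_at S ?x (\<lambda>f. \<sigma> (?r j k) f ?x)"
    by (rule section_derivation[OF \<sigma> x] reg)+
  have e: "regular S (\<lambda>y. ?r k i y * ?r i k y) ?x" by (rule regular_mult[OF reg(2) reg(1)])
  have "\<sigma> (?r j i) (?r k i) ?x = \<sigma> (\<lambda>y. ?r j k y * ?r k i y) (?r k i) ?x"
    by (rule derivation_local[OF D(1) reg(2) regular_mult[OF reg(1,2)] e])
      (use v in \<open>auto simp: val\<close>, auto simp: coord_ratio_def)
  also have "\<dots> = ?r j k ?x * \<sigma> (?r k i) (?r k i) ?x + ?r k i ?x * \<sigma> (?r j k) (?r k i) ?x"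
    by (rule derivation_mult[OF D(1) reg(1,2)])
  also have "\<sigma> (?r k i) (?r k i) ?x = 0" using section_antisymmetric(1)[OF \<sigma> x reg(2) reg(2)] .
  finally have 1: "\<sigma> (?r j i) (?r k i) ?x = v $ k / v $ i * \<sigma> (?r j k) (?r k i) ?x" by (simp add: val)
  have "\<sigma> (?r j k) (\<lambda>y. ?r k i y * ?r i k y) ?x = 0"
    by (rule derivation_idempotent[OF D(2) e]) (simp add: coord_ratio_def)
  then have "v $ k / v $ i * \<sigma> (?r j k) (?r i k) ?x + v $ i / v $ k * \<sigma> (?r j k) (?r k i) ?x = 0"
    using derivation_mult[OF D(2) reg(2) reg(1)] by (simp add: val)
  then have 2: "\<sigma> (?r j k) (?r k i) ?x = - ((v $ k / v $ i) ^ 2 * \<sigma> (?r j k) (?r i k) ?x)"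
    using v by (simp add: field_simps power2_eq_square eq_neg_iff_add_eq_0)
  have 3: "\<sigma> (?r j k) (?r i k) ?x = - \<sigma> (?r i k) (?r j k) ?x"
    by (rule section_antisymmetric(2)[OF \<sigma> x reg(1) reg(1)])
  show ?thesis
    using v unfolding chart_value_def 1 2 3 by (simp add: field_simps power2_eq_square power3_eq_cube)
qed

lemma regular_holomorphic_along_line:
  assumes G: "regular S G (\<phi> (pt (v + t0 *s w)))" and k: "(v + t0 *s w) $ k \<noteq> 0"
  obtains U where "open U" "t0 \<in> U" "\<And>t. t \<in> U \<Longrightarrow> (v + t *s w) $ k \<noteq> 0"
    "(\<lambda>t. G (\<phi> (pt (v + t *s w)))) holomorphic_on U"
proof -
  define \<gamma> where "\<gamma> t = v + t *s w" for t
  have nz: "\<gamma> t0 \<noteq> 0" using k unfolding \<gamma>_def by (metis zero_index)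
  obtain P d where P: "\<And>j. P j \<in> forms UNIV d" "(\<chi> j. eval (P j) (\<gamma> t0)) \<noteq> 0"
    "\<And>v. v \<noteq> 0 \<Longrightarrow> (\<chi> j. eval (P j) v) \<noteq> 0 \<Longrightarrow> \<phi> (pt v) = pt (\<chi> j. eval (P j) v)"
    by (rule local_forms_\<phi>[OF nz]) blast
  define Q where "Q t = (\<chi> j. eval (P j) (\<gamma> t))" for t
  obtain d' p q where pq: "q \<in> forms UNIV d'" "eval q (rep (\<phi> (pt (\<gamma> t0)))) \<noteq> 0"
    "\<And>v. v \<noteq> 0 \<Longrightarrow> pt v \<in> S \<Longrightarrow> eval q v \<noteq> 0 \<Longrightarrow> G (pt v) = eval p v / eval q v"
    using G unfolding regular_at_def \<gamma>_def by blast
  obtain l where l: "Q t0 $ l \<noteq> 0" using P(2) by (auto simp: vec_eq_iff Q_def)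
  have Q0: "Q t0 \<noteq> 0" using P(2) by (simp add: Q_def)
  obtain c where c: "c \<noteq> 0" "rep (pt (Q t0)) = c *s Q t0" by (rule rep_pt[OF Q0])
  have q0: "eval q (Q t0) \<noteq> 0"
    using pq(2) eval_homogeneous_eq_0_iff[OF pq(1) c(1)] P(3)[OF nz P(2)] c(2) unfolding Q_def by metis
  have hol\<gamma>: "(\<lambda>t. \<gamma> t $ i) holomorphic_on A" for i A unfolding \<gamma>_def by (simp, intro holomorphic_intros)
  have holQ: "(\<lambda>t. Q t $ i) holomorphic_on A" for i A unfolding Q_def by (simp, intro eval_holomorphic hol\<gamma>)
  have holq: "(\<lambda>t. eval q (Q t)) holomorphic_on A" "(\<lambda>t. eval p (Q t)) holomorphic_on A" for A
    by (intro eval_holomorphic holQ)+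
  define U where "U = {t. \<gamma> t $ k \<noteq> 0} \<inter> {t. Q t $ l \<noteq> 0} \<inter> {t. eval q (Q t) \<noteq> 0}"
  have "open {t. f t \<noteq> 0}" if "f holomorphic_on UNIV" for f :: "complex \<Rightarrow> complex"
    by (rule open_Collect_neq) (use that holomorphic_on_imp_continuous_on in auto)
  then have "open U" unfolding U_def by (intro open_Int) (simp_all add: hol\<gamma> holQ holq)
  moreover have "t0 \<in> U" using k l q0 by (simp add: U_def \<gamma>_def)
  moreover have "(v + t *s w) $ k \<noteq> 0" if "t \<in> U" for t using that by (simp add: U_def \<gamma>_def)
  moreover have "(\<lambda>t. G (\<phi> (pt (\<gamma> t)))) holomorphic_on U"
  proof (rule holomorphic_transform)
    show "(\<lambda>t. eval p (Q t) / eval q (Q t)) holomorphic_on U"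
      by (intro holomorphic_on_divide holq) (simp add: U_def)
    fix t
    assume t: "t \<in> U"
    have "\<gamma> t \<noteq> 0" "Q t \<noteq> 0" "eval q (Q t) \<noteq> 0" using t by (auto simp: U_def)
    then show "eval p (Q t) / eval q (Q t) = G (\<phi> (pt (\<gamma> t)))"
      using pq(3)[of "Q t"] P(3)[of "\<gamma> t"] bij_\<phi>(1)[of "pt (\<gamma> t)"] by (simp add: Q_def)
  qed
  ultimately show ?thesis using that unfolding \<gamma>_def by blast
qed

text \<open>The chart values of a section glue to a homogeneous function of degree three on \<open>\<complex>\<^sup>3\<close>. It is holomorphic along lines
  away from the origin because it is locally a quotient of forms.\<close>

lemma section_cubic_form:
  assumes \<sigma>: "anticanonical_section k' S \<sigma>"
  shows "\<exists>r. \<forall>k i j v. (k, i, j) \<in> cyclic_charts \<longrightarrow> v $ k \<noteq> 0 \<longrightarrow>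
    chart_value \<sigma> k i j v = (\<Sum>n\<in>UNIV. r n * veronese v $ n)"
proof -
  define c where "c v = (if v $ 1 \<noteq> 0 then chart_value \<sigma> 1 2 3 v else if v $ 2 \<noteq> 0 then chart_value \<sigma> 2 3 1 v
    else if v $ 3 \<noteq> 0 then chart_value \<sigma> 3 1 2 v else 0)" for v
  have c: "c v = chart_value \<sigma> k i j v" if "(k, i, j) \<in> cyclic_charts" "v $ k \<noteq> 0" for v k i j
  proof -
    note change = chart_value_change[OF \<sigma>, of v]
    consider "(k, i, j) = (1, 2, 3)" | "(k, i, j) = (2, 3, 1)" | "(k, i, j) = (3, 1, 2)" using \<open>(k, i, j) \<in> cyclic_charts\<close> unfolding cyclic_charts_def by blast
    then show ?thesis
    proof cases
      case 1
      then show ?thesis using \<open>v $ k \<noteq> 0\<close> by (simp add: c_def)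
    next
      case 2
      show ?thesis
      proof (cases "v $ 1 = 0")
        case False
        then have "c v = chart_value \<sigma> 1 2 3 v" by (simp add: c_def)
        then show ?thesis using change[of 1 2 3] False 2 \<open>v $ k \<noteq> 0\<close> by simp
      qed (use 2 \<open>v $ k \<noteq> 0\<close> in \<open>simp add: c_def\<close>)
    next
      case 3
      consider "v $ 1 \<noteq> 0" | "v $ 1 = 0" "v $ 2 \<noteq> 0" | "v $ 1 = 0" "v $ 2 = 0" by blast
      then show ?thesis
      proof cases
        case 1
        then have "c v = chart_value \<sigma> 1 2 3 v" by (simp add: c_def)
        then show ?thesis using change[of 3 1 2] 1 3 \<open>v $ k \<noteq> 0\<close> by simp
      next
        case 2
        then have "c v = chart_value \<sigma> 2 3 1 v" by (simp add: c_def)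
        then show ?thesis using change[of 2 3 1] 2 3 \<open>v $ k \<noteq> 0\<close> by simp
      qed (use 3 \<open>v $ k \<noteq> 0\<close> in \<open>simp add: c_def\<close>)
    qed
  qed
  have c0: "c 0 = 0" by (simp add: c_def)
  have cyc: "\<exists>k i j. (k, i, j) \<in> cyclic_charts \<and> v $ k \<noteq> 0" if v: "v \<noteq> 0" for v :: "complex ^ 3"
  proof -
    obtain k where "v $ k \<noteq> 0" using v by (auto simp: vec_eq_iff)
    then show ?thesis using exhaust_3[of k] unfolding cyclic_charts_def by blast
  qed
  have hom: "c (a *s v) = a ^ 3 * c v" for a v
  proof (cases "a = 0 \<or> v = 0")
    case False
    then obtain k i j where kij: "(k, i, j) \<in> cyclic_charts" "v $ k \<noteq> 0" using cyc by blast
    have "c (a *s v) = chart_value \<sigma> k i j (a *s v)" by (rule c[OF kij(1)]) (use False kij in simp)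
    also have "\<dots> = a ^ 3 * chart_value \<sigma> k i j v"
      using False by (simp add: chart_value_def pt_scale power_mult_distrib)
    finally show ?thesis using c[OF kij] by simp
  qed (auto simp: c0)
  have hol: "(\<lambda>t. c (v + t *s w)) field_differentiable (at t)" if nz: "v + t *s w \<noteq> 0" for v w t
  proof -
    obtain k i j where kij: "(k, i, j) \<in> cyclic_charts" "(v + t *s w) $ k \<noteq> 0" using cyc[OF nz] by blast
    let ?x = "\<phi> (pt (v + t *s w))"
    obtain a where a: "a \<noteq> 0" "rep (pt (v + t *s w)) = a *s (v + t *s w)" by (rule rep_pt[OF nz])
    have "rep (\<phi>_inv ?x) $ k \<noteq> 0" unfolding bij_\<phi>(2) a(2) using kij(2) a(1) by (simp only: vector_smult_component mult_eq_0_iff simp_thms)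
    note reg = regular_coord_ratio[OF bij_\<phi>(1) this]
    have "regular S (\<sigma> (coord_ratio \<phi>_inv i k) (coord_ratio \<phi>_inv j k)) ?x"
      by (rule section_antisymmetric(3)[OF \<sigma> bij_\<phi>(1) reg reg])
    then obtain U where U: "open U" "t \<in> U" "\<And>t. t \<in> U \<Longrightarrow> (v + t *s w) $ k \<noteq> 0"
      "(\<lambda>t. \<sigma> (coord_ratio \<phi>_inv i k) (coord_ratio \<phi>_inv j k) (\<phi> (pt (v + t *s w)))) holomorphic_on U"
      using kij(2) by (rule regular_holomorphic_along_line) blast
    have "(\<lambda>t. c (v + t *s w)) holomorphic_on U"
    proof (rule holomorphic_transform)
      show "(\<lambda>t. (v $ k + t * w $ k) ^ 3 * \<sigma> (coord_ratio \<phi>_inv i k) (coord_ratio \<phi>_inv j k) (\<phi> (pt (v + t *s w)))) holomorphic_on U"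
        by (intro holomorphic_intros U(4))
      show "(v $ k + t * w $ k) ^ 3 * \<sigma> (coord_ratio \<phi>_inv i k) (coord_ratio \<phi>_inv j k) (\<phi> (pt (v + t *s w))) = c (v + t *s w)"
        if "t \<in> U" for t
        using c[OF kij(1) U(3)[OF that]] by (simp add: chart_value_def)
    qed
    then show ?thesis using U(1,2) by (rule holomorphic_on_imp_differentiable_at)
  qed
  obtain r where r: "\<And>v. c v = (\<Sum>n\<in>UNIV. r n * veronese v $ n)"
    using cubic_form_of_cubic_along[OF hom homogeneous_holomorphic_cubic_along[OF hom hol]] by metis
  have "chart_value \<sigma> k i j v = (\<Sum>n\<in>UNIV. r n * veronese v $ n)" if "(k, i, j) \<in> cyclic_charts" "v $ k \<noteq> 0" for k i j v
    using c[OF that] r by simp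
  then show ?thesis by blast
qed

end

text \<open>The rows of \<open>g\<close> are the coefficients of the cubic forms that belong to the ten sections. A kernel vector of the
  transpose of \<open>g\<close> is a linear form that vanishes on \<open>S\<close>, so \<open>g\<close> is invertible if \<open>S\<close> lies in no hyperplane. Then the
  sections have no common zero, and the image is all of \<open>g S0\<close>.\<close>

lemma anticanonical_image_eq_veronese_image:
  fixes S :: "10 proj set" and s :: "10 \<Rightarrow> 10 biderivation" and \<phi> :: "3 proj \<Rightarrow> 10 proj"
  assumes iso: "variety_iso UNIV UNIV S \<phi>" and s: "\<And>m. anticanonical_section k' S (s m)"
    and S: "S = anticanonical_image S s"
    and nondegenerate: "\<And>w. (\<And>p. p \<noteq> 0 \<Longrightarrow> pt p \<in> S \<Longrightarrow> (\<Sum>m\<in>UNIV. w $ m * p $ m) = 0) \<Longrightarrow> w = 0"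
  obtains g where "invertible g" "S = {pt (g *v veronese v) | v. v \<noteq> 0}"
proof -
  let ?\<psi> = "inv_into UNIV \<phi>"
  define X where "X a b = coord_ratio ?\<psi> a b" for a b
  have "\<forall>m. \<exists>r. \<forall>k i j v. (k, i, j) \<in> cyclic_charts \<longrightarrow> v $ k \<noteq> 0 \<longrightarrow>
      chart_value \<phi> (s m) k i j v = (\<Sum>n\<in>UNIV. r n * veronese v $ n)"
    using section_cubic_form[OF iso s] by blast
  from choice[OF this] obtain R where R: "\<And>m v k i j. (k, i, j) \<in> cyclic_charts \<Longrightarrow> v $ k \<noteq> 0 \<Longrightarrow>
    chart_value \<phi> (s m) k i j v = (\<Sum>n\<in>UNIV. R m n * veronese v $ n)" by blast
  define g :: "complex ^ 10 ^ 10" where "g = (\<chi> m n. R m n)"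
  have g: "v $ k ^ 3 *s (\<chi> m. s m (X i k) (X j k) (\<phi> (pt v))) = g *v veronese v"
    if "(k, i, j) \<in> cyclic_charts" "v $ k \<noteq> 0" for v k i j
    using R[OF that] by (simp add: vec_eq_iff chart_value_def[OF iso] X_def g_def matrix_vector_mult_def)
  have cyc: "\<exists>k i j. (k, i, j) \<in> cyclic_charts \<and> v $ k \<noteq> 0 \<and> UNIV = {k, i, j}" if v: "v \<noteq> 0" for v :: "complex ^ 3"
  proof -
    obtain k where "v $ k \<noteq> 0" using v by (auto simp: vec_eq_iff)
    moreover have "UNIV = {1, 2, 3 :: 3}" "UNIV = {2, 3, 1 :: 3}" "UNIV = {3, 1, 2 :: 3}"
      using UNIV_3 by blast+
    ultimately show ?thesis using exhaust_3[of k] unfolding cyclic_charts_def by blast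
  qed
  have sub: "\<exists>v. v \<noteq> 0 \<and> g *v veronese v \<noteq> 0 \<and> x' = pt (g *v veronese v)" if x': "x' \<in> S" for x'
  proof -
    have "x' \<in> anticanonical_image S s" using x' S by simp
    then obtain f h x where x: "x' = pt (\<chi> m. s m f h x)" "x \<in> S" "regular S f x" "regular S h x" "(\<chi> m. s m f h x) \<noteq> 0"
      unfolding anticanonical_image_def by blast
    define v where "v = rep (?\<psi> x)"
    have v: "v \<noteq> 0" "\<phi> (pt v) = x" using bij_\<phi>(3)[OF iso x(2)] by (simp_all add: v_def rep_nonzero pt_rep)
    obtain k i j where kij: "(k, i, j) \<in> cyclic_charts" "v $ k \<noteq> 0" "UNIV = {k, i, j}" using cyc[OF v(1)] by blast
    obtain J where J: "\<And>k' \<sigma>. anticanonical_section k' S \<sigma> \<Longrightarrow> \<sigma> f h x = J * \<sigma> (X i k) (X j k) x"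
      using section_values_proportional[OF iso x(2) _ kij(3) x(3,4)] kij(2) unfolding X_def v_def by metis
    have eq: "v $ k ^ 3 *s (\<chi> m. s m f h x) = J *s (g *v veronese v)"
      unfolding g[OF kij(1,2), symmetric] v(2) J[OF s] by (simp add: vec_eq_iff)
    then have nz: "J *s (g *v veronese v) \<noteq> 0" using x(5) kij(2) by (metis power_not_zero vector_mul_eq_0)
    then have "J \<noteq> 0" "g *v veronese v \<noteq> 0" by auto
    moreover have "x' = pt (J *s (g *v veronese v))"
      unfolding x(1) eq[symmetric] using x(5) kij(2) by (simp add: pt_scale)
    ultimately show ?thesis using v(1) by (auto simp: pt_scale)
  qed
  have inv: "invertible g"
  proof -
    have "w = 0" if w: "transpose g *v w = 0" for w
    proof (rule nondegenerate)
      fix p :: "complex ^ 10"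
      assume p: "p \<noteq> 0" "pt p \<in> S"
      obtain v where v: "g *v veronese v \<noteq> 0" "pt p = pt (g *v veronese v)" using sub[OF p(2)] by blast
      then obtain c where c: "g *v veronese v = c *s p" using pt_eq_iff[OF p(1) v(1)] by blast
      then have "c \<noteq> 0" using v(1) by auto
      have "(\<Sum>m\<in>UNIV. w $ m * (g *v veronese v) $ m) = (\<Sum>n\<in>UNIV. (transpose g *v w) $ n * veronese v $ n)"
        unfolding matrix_vector_mult_def transpose_def
        by (simp add: sum_distrib_left sum_distrib_right) (subst sum.swap, simp add: mult_ac)
      then have "(\<Sum>m\<in>UNIV. w $ m * (g *v veronese v) $ m) = 0" unfolding w by simp
      then have "c * (\<Sum>m\<in>UNIV. w $ m * p $ m) = 0" unfolding c by (simp add: sum_distrib_left mult_ac)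
      then show "(\<Sum>m\<in>UNIV. w $ m * p $ m) = 0" using \<open>c \<noteq> 0\<close> by simp
    qed
    then have "\<exists>B. B ** transpose g = mat 1" using matrix_left_invertible_ker by blast
    then show ?thesis using left_invertible_transpose invertible_right_inverse by blast
  qed
  have "pt (g *v veronese v) \<in> S" if v: "v \<noteq> 0" for v
  proof -
    obtain k i j where kij: "(k, i, j) \<in> cyclic_charts" "v $ k \<noteq> 0" using cyc[OF v] by blast
    have gv: "g *v veronese v \<noteq> 0" by (rule invertible_mult_nonzero[OF inv veronese_nonzero[OF v]])
    have x: "\<phi> (pt v) \<in> S" by (rule bij_\<phi>(1)[OF iso])
    obtain c where c: "c \<noteq> 0" "rep (pt v) = c *s v" by (rule rep_pt[OF v])
    then have "rep (?\<psi> (\<phi> (pt v))) $ k \<noteq> 0" using kij(2) by (simp add: bij_\<phi>(2)[OF iso])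
    note reg = regular_coord_ratio[OF iso x this]
    let ?w = "\<chi> m. s m (X i k) (X j k) (\<phi> (pt v))"
    have "?w \<noteq> 0" using g[OF kij] gv by auto
    then have "pt ?w \<in> anticanonical_image S s"
      unfolding anticanonical_image_def X_def using x reg by blast
    moreover have "pt ?w = pt (g *v veronese v)"
      using g[OF kij] pt_scale[of "v $ k ^ 3" ?w] \<open>?w \<noteq> 0\<close> kij(2) by simp
    ultimately show ?thesis using S by simp
  qed
  then have "S = {pt (g *v veronese v) | v. v \<noteq> 0}" using sub by blast
  then show ?thesis using inv that by blast
qed

section \<open>From the Lie algebra of a surface to its normal form\<close>

lemma monom_eval_single: "monom_eval (Poly_Mapping.single i 1) v = v $ i"
proof -
  have "v $ k ^ Poly_Mapping.lookup (Poly_Mapping.single i 1) k = (if k = i then v $ i else 1)" for k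
    by (simp add: lookup_single when_def)
  then show ?thesis by (simp add: monom_eval_def)
qed

definition bil :: "complex ^ 'n ^ 'n \<Rightarrow> complex ^ 'n \<Rightarrow> complex ^ 'n::finite \<Rightarrow> complex" where
  "bil A x y = (\<Sum>i\<in>UNIV. \<Sum>j\<in>UNIV. A $ i $ j * x $ i * y $ j)"

lemma eval_quadric: "eval (quadric A) v = bil A v v"
  by (simp add: quadric_def bil_def eval_sum eval_single monom_eval_add monom_eval_single mult.assoc del: One_nat_def)

definition linear_form :: "complex ^ 'n \<Rightarrow> 'n::finite poly_ring" where
  "linear_form w = (\<Sum>i\<in>UNIV. Poly_Mapping.single (Poly_Mapping.single i 1) (w $ i))"

lemma eval_linear_form: "eval (linear_form w) v = (\<Sum>i\<in>UNIV. w $ i * v $ i)"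
  by (simp add: linear_form_def eval_sum eval_single monom_eval_single del: One_nat_def)

lemma linear_form_in_forms:
  assumes "\<And>i. w $ i \<in> k" "0 \<in> k"
  shows "linear_form w \<in> forms k 1"
proof -
  have "Poly_Mapping.lookup (linear_form w) m = (if \<exists>i. m = Poly_Mapping.single i 1 then w $ (THE i. m = Poly_Mapping.single i 1) else 0)" for m
  proof (cases "\<exists>i. m = Poly_Mapping.single i 1")
    case True
    then obtain i where m: "m = Poly_Mapping.single i 1" by blast
    have inj: "Poly_Mapping.single j (1::nat) = Poly_Mapping.single i 1 \<longleftrightarrow> j = i" for j :: 'a
      by (metis lookup_single_eq lookup_single_not_eq zero_neq_one)
    have "Poly_Mapping.lookup (linear_form w) m = (\<Sum>j\<in>UNIV. if j = i then w $ i else 0)"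
      unfolding linear_form_def lookup_sum m by (rule sum.cong) (simp_all add: lookup_single when_def inj del: One_nat_def)
    moreover have "(THE j. m = Poly_Mapping.single j 1) = i" unfolding m by (rule the_equality) (use inj in metis)+
    ultimately show ?thesis using True by simp
  next
    case False
    then show ?thesis unfolding linear_form_def lookup_sum by (auto simp: lookup_single when_def intro!: sum.neutral)
  qed
  note lookup = this
  have "(\<Sum>j\<in>UNIV. Poly_Mapping.lookup (Poly_Mapping.single i (1::nat)) j) = 1" for i :: 'a
    by (simp add: lookup_single when_def)
  then show ?thesis unfolding forms_def using assms lookup by (auto simp: in_keys_iff split: if_splits)
qed

lemma bil_has_derivative:
  "((\<lambda>t. bil A (v + t *s w) (v + t *s w)) has_field_derivative (bil A w v + bil A v w)) (at 0)"
proof -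
  have "bil A (v + t *s w) (v + t *s w) = bil A v v + t * (bil A w v + bil A v w) + t ^ 2 * bil A w w" for t
    by (simp add: bil_def sum_distrib_left sum.distrib[symmetric] algebra_simps power2_eq_square)
  then show ?thesis by (auto intro!: derivative_eq_intros)
qed

lemma ideal_generated_induct [consumes 1, case_names zero step]:
  assumes "p \<in> ideal_generated G" "P 0" "\<And>r g q. g \<in> G \<Longrightarrow> P q \<Longrightarrow> P (r * g + q)"
  shows "P p"
proof -
  interpret module "(*) :: 'a poly_ring \<Rightarrow> 'a poly_ring \<Rightarrow> 'a poly_ring"
    by unfold_locales (simp_all add: algebra_simps)
  show ?thesis using assms unfolding ideal_generated_def by (rule span_induct_alt)
qed

lemma ideal_generated_base: "g \<in> G \<Longrightarrow> g \<in> ideal_generated G" for g :: "'a::finite poly_ring"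
proof -
  interpret module "(*) :: 'a poly_ring \<Rightarrow> 'a poly_ring \<Rightarrow> 'a poly_ring"
    by unfold_locales (simp_all add: algebra_simps)
  show "g \<in> G \<Longrightarrow> g \<in> ideal_generated G" unfolding ideal_generated_def by (rule span_base)
qed

text \<open>\<open>p\<close> vanishes at \<open>v\<close> together with its derivative in the direction \<open>w\<close>. For fixed \<open>v\<close> and \<open>w\<close> this is an ideal condition, so it
  passes from generators to the whole ideal.\<close>

definition vanishes_along :: "'n::finite poly_ring \<Rightarrow> complex ^ 'n \<Rightarrow> complex ^ 'n \<Rightarrow> bool" where
  "vanishes_along p v w \<longleftrightarrow> eval p v = 0 \<and> ((\<lambda>t. eval p (v + t *s w)) has_field_derivative 0) (at 0)"

lemma ideal_vanishes_along:
  assumes "p \<in> ideal_generated G" and G: "\<And>g. g \<in> G \<Longrightarrow> vanishes_along g v w"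
  shows "vanishes_along p v w"
  using assms(1)
proof (induction rule: ideal_generated_induct)
  case zero
  then show ?case by (simp add: vanishes_along_def eval_zero)
next
  case (step r g q)
  have "(\<lambda>t. eval r (v + t *s w)) holomorphic_on UNIV"
    by (rule eval_holomorphic) (simp, intro holomorphic_intros)
  then obtain r' where r': "((\<lambda>t. eval r (v + t *s w)) has_field_derivative r') (at 0)"
    by (metis UNIV_I holomorphic_on_imp_differentiable_at open_UNIV field_differentiable_def)
  have g: "eval g v = 0" "((\<lambda>t. eval g (v + t *s w)) has_field_derivative 0) (at 0)"
    using G[OF step(1)] by (simp_all add: vanishes_along_def)
  have q: "eval q v = 0" "((\<lambda>t. eval q (v + t *s w)) has_field_derivative 0) (at 0)"
    using step(2) by (simp_all add: vanishes_along_def)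
  have "((\<lambda>t. eval r (v + t *s w) * eval g (v + t *s w) + eval q (v + t *s w)) has_field_derivative 0) (at 0)"
    using DERIV_add[OF DERIV_mult[OF r' g(2)] q(2)] g(1) by simp
  then show ?case using g(1) q(1) by (simp add: vanishes_along_def eval_add eval_mult)
qed

lemma quadric_vanishes_along: "vanishes_along (quadric A) v w \<longleftrightarrow> bil A v v = 0 \<and> bil A w v + bil A v w = 0"
proof -
  have "((\<lambda>t. bil A (v + t *s w) (v + t *s w)) has_field_derivative 0) (at 0) \<longleftrightarrow> bil A w v + bil A v w = 0"
    using DERIV_unique[OF bil_has_derivative[of A v w], of 0] bil_has_derivative[of A v w] by auto
  then show ?thesis by (simp add: vanishes_along_def eval_quadric)
qed

text \<open>Quadrics vanish to second order at the origin, so all elements of the ideal have derivative zero there. A linear form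
  with derivative zero is zero.\<close>

lemma quadric_generators_nondegenerate:
  assumes A: "quadric_generators k S A"
    and w: "\<And>p. p \<noteq> 0 \<Longrightarrow> pt p \<in> S \<Longrightarrow> (\<Sum>m\<in>UNIV. w $ m * p $ m) = 0"
  shows "w = 0"
proof -
  have "linear_form w \<in> vanishing_ideal S"
    using w by (simp add: vanishing_ideal_def eval_linear_form)
  then have lf: "linear_form w \<in> ideal_generated (range (\<lambda>i. quadric (A i)))"
    using A by (simp add: quadric_generators_def)
  have "w $ m = 0" for m
  proof -
    have "vanishes_along (linear_form w) 0 (axis m 1)"
      by (rule ideal_vanishes_along[OF lf]) (auto simp: quadric_vanishes_along bil_def)
    moreover have "(\<Sum>i\<in>UNIV. w $ i * (t * axis m 1 $ i)) = w $ m * t" for t :: complex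
    proof -
      have "w $ i * (t * axis m 1 $ i) = (if i = m then w $ m * t else 0)" for i by (simp add: axis_def)
      then show ?thesis by simp
    qed
    ultimately have "((\<lambda>t. w $ m * t) has_field_derivative 0) (at 0)"
      by (simp add: vanishes_along_def eval_linear_form)
    moreover have "((\<lambda>t. w $ m * t) has_field_derivative w $ m) (at 0)"
      by (auto intro!: derivative_eq_intros)
    ultimately show ?thesis using DERIV_unique by blast
  qed
  then show ?thesis by (simp add: vec_eq_iff)
qed

lemma bil_infinitesimal: "bil (transpose X ** A + A ** X) p p = bil A (X *v p) p + bil A p (X *v p)"
proof -
  have 1: "bil (transpose X ** A) p p = bil A (X *v p) p"
  proof -
    have "bil (transpose X ** A) p p = (\<Sum>a\<in>UNIV. \<Sum>b\<in>UNIV. \<Sum>c\<in>UNIV. X $ c $ a * A $ c $ b * p $ a * p $ b)"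
      by (simp add: bil_def matrix_matrix_mult_def transpose_def sum_distrib_right)
    also have "\<dots> = (\<Sum>c\<in>UNIV. \<Sum>b\<in>UNIV. \<Sum>a\<in>UNIV. X $ c $ a * A $ c $ b * p $ a * p $ b)"
      by (subst sum.swap, subst (2) sum.swap, subst sum.swap) (rule refl)
    also have "\<dots> = bil A (X *v p) p"
      by (simp add: bil_def matrix_vector_mult_def sum_distrib_left sum_distrib_right mult_ac)
    finally show ?thesis .
  qed
  have 2: "bil (A ** X) p p = bil A p (X *v p)"
  proof -
    have "bil (A ** X) p p = (\<Sum>a\<in>UNIV. \<Sum>b\<in>UNIV. \<Sum>c\<in>UNIV. A $ a $ c * X $ c $ b * p $ a * p $ b)"
      by (simp add: bil_def matrix_matrix_mult_def sum_distrib_right)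
    also have "\<dots> = (\<Sum>a\<in>UNIV. \<Sum>c\<in>UNIV. \<Sum>b\<in>UNIV. A $ a $ c * X $ c $ b * p $ a * p $ b)"
      by (subst (2) sum.swap) (rule refl)
    also have "\<dots> = bil A p (X *v p)"
      by (simp add: bil_def matrix_vector_mult_def sum_distrib_left sum_distrib_right mult_ac)
    finally show ?thesis .
  qed
  have "bil (M + N) p p = bil M p p + bil N p p" for M N
    by (simp add: bil_def distrib_right sum.distrib)
  then show ?thesis by (simp add: 1 2)
qed

text \<open>The derivative of the quadric \<open>p\<^sup>T A\<^sub>i p\<close> in the direction \<open>X p\<close> is \<open>p\<^sup>T (X\<^sup>T A\<^sub>i + A\<^sub>i X) p\<close>, a combination of the values of the
  quadrics \<open>A\<^sub>j\<close> at \<open>p\<close>.\<close>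

lemma lie_algebra_vanishes_along:
  assumes X: "X \<in> lie_algebra_of S k" and p: "p \<noteq> 0" "pt p \<in> S" and q: "q \<in> vanishing_ideal S"
  shows "vanishes_along q p (X *v p)"
proof -
  obtain A l where A: "quadric_generators k S A"
    and l: "\<And>i. transpose X ** A i + A i ** X = (\<Sum>j\<in>UNIV. scale (l i j) (A j))"
    using X unfolding lie_algebra_of_def by blast
  have I: "vanishing_ideal S = ideal_generated (range (\<lambda>i. quadric (A i)))"
    using A by (simp add: quadric_generators_def)
  have zero: "bil (A i) p p = 0" for i
  proof -
    have "quadric (A i) \<in> vanishing_ideal S" unfolding I by (rule ideal_generated_base) simp
    then show ?thesis using p by (simp add: vanishing_ideal_def eval_quadric)
  qed
  have sum: "bil (\<Sum>j\<in>J. scale (c j) (A j)) p p = (\<Sum>j\<in>J. c j * bil (A j) p p)" for c J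
  proof (induction J rule: infinite_finite_induct)
    case (insert j J)
    have "bil (scale c M + N) p p = c * bil M p p + bil N p p" for c M N
      by (simp add: bil_def scale_def distrib_right sum.distrib sum_distrib_left mult.assoc)
    then show ?case using insert by simp
  qed (simp_all add: bil_def)
  have "bil (A i) (X *v p) p + bil (A i) p (X *v p) = 0" for i
    using bil_infinitesimal[of X "A i" p] by (simp add: l sum zero)
  then have "vanishes_along g p (X *v p)" if "g \<in> range (\<lambda>i. quadric (A i))" for g
    using that zero by (auto simp: quadric_vanishes_along)
  then show ?thesis using ideal_vanishes_along[of q] q unfolding I by blast
qed

text \<open>In the coordinates given by \<open>g\<close> the binomials of the Veronese cone become quadrics in the ideal of \<open>S\<close>.\<close>

lemma lie_algebra_tangent:
  assumes g: "invertible g" and S: "S = {pt (g *v veronese v) | v. v \<noteq> 0}" and X: "X \<in> lie_algebra_of S k"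
  shows "tangent_to_cone (matrix_inv g ** X ** g)"
  unfolding tangent_to_cone_def
proof (intro allI impI)
  fix p q r s v
  assume rel: "\<forall>u. veronese u $ p * veronese u $ q = veronese u $ r * veronese u $ s"
  let ?G = "matrix_inv g" and ?Z = "matrix_inv g ** X ** g" and ?n = "veronese v"
  show "(?Z *v ?n) $ p * ?n $ q + ?n $ p * (?Z *v ?n) $ q = (?Z *v ?n) $ r * ?n $ s + ?n $ r * (?Z *v ?n) $ s"
  proof (cases "v = 0")
    case True
    have "veronese 0 = 0" by (rule vec10_eqI) (simp add: veronese_idx)
    then show ?thesis using True by simp
  next
    case False
    define B :: "complex ^ 10 ^ 10" where "B = (\<chi> a b. ?G $ p $ a * ?G $ q $ b - ?G $ r $ a * ?G $ s $ b)"
    have B: "bil B x y = (?G *v x) $ p * (?G *v y) $ q - (?G *v x) $ r * (?G *v y) $ s" for x y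
      by (simp add: bil_def B_def matrix_vector_mult_def sum_product left_diff_distrib sum_subtractf) (simp add: mult_ac)
    have Gg: "?G *v (g *v x) = x" for x
      by (simp add: matrix_vector_mul_assoc matrix_inv_mult[OF g])
    have "quadric B \<in> vanishing_ideal S"
      unfolding vanishing_ideal_def mem_Collect_eq
    proof (intro allI impI)
      fix x
      assume x: "x \<noteq> 0 \<and> pt x \<in> S"
      then obtain u where u: "u \<noteq> 0" "pt x = pt (g *v veronese u)" using S by blast
      then obtain c where c: "x = c *s (g *v veronese u)"
        using pt_eq_iff[of "g *v veronese u" x] x invertible_mult_nonzero[OF g veronese_nonzero] by metis
      have "?G *v x = c *s veronese u" unfolding c vector_scalar_commute Gg ..
      then show "eval (quadric B) x = 0" using rel by (simp add: eval_quadric B)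
    qed
    moreover have "g *v ?n \<noteq> 0" "pt (g *v ?n) \<in> S"
      using invertible_mult_nonzero[OF g veronese_nonzero[OF False]] S False by blast+
    ultimately have "vanishes_along (quadric B) (g *v ?n) (X *v (g *v ?n))"
      using lie_algebra_vanishes_along[OF X] by blast
    then have "bil B (X *v (g *v ?n)) (g *v ?n) + bil B (g *v ?n) (X *v (g *v ?n)) = 0"
      by (simp only: quadric_vanishes_along)
    moreover have "?G *v (X *v (g *v ?n)) = ?Z *v ?n" by (simp only: matrix_vector_mul_assoc matrix_mul_assoc)
    ultimately show ?thesis by (simp only: B Gg) (simp add: algebra_simps)
  qed
qed

section \<open>Normal forms and their intertwiners\<close>

text \<open>The standard representation (\<open>\<epsilon>\<close> true) or its dual.\<close>

definition twist :: "bool \<Rightarrow> complex ^ 3 ^ 3 \<Rightarrow> complex ^ 3 ^ 3" where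
  "twist \<epsilon> X = (if \<epsilon> then X else - transpose X)"

lemma twist_in_sl: "X \<in> sl \<rat> \<Longrightarrow> twist \<epsilon> X \<in> sl \<rat>"
  by (auto simp: twist_def sl_def matrices_def trace_def transpose_def sum_negf)

lemma twist_twist: "twist \<epsilon> (twist \<epsilon>' X) = twist (\<epsilon> = \<epsilon>') X"
  by (auto simp: twist_def transpose_def vec_eq_iff)

lemma rho_inject: "rho A = rho B \<Longrightarrow> A = B"
proof -
  assume eq: "rho A = rho B"
  have "rho (A + scale (-1) B) = 0"
    unfolding rho_add rho_scale eq by (simp add: scale_def vec_eq_iff)
  then have "A + scale (-1) B = 0" by (rule rho_eq_0D)
  then show "A = B" by (simp add: scale_def vec_eq_iff)
qed

lemma sym3_invertible: "invertible b \<Longrightarrow> invertible (sym3 b)"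
  unfolding invertible_def[of "sym3 b"]
  by (rule exI[of _ "sym3 (matrix_inv b)"]) (simp add: sym3_mult matrix_inv_mult sym3_one)

lemma veronese_image_sym3:
  assumes b: "invertible b"
  shows "{pt ((g ** sym3 b) *v veronese v) | v. v \<noteq> 0} = {pt (g *v veronese v) | v. v \<noteq> 0}"
proof -
  have eq: "(g ** sym3 b) *v veronese v = g *v veronese (b *v v)" for v
    by (simp add: matrix_vector_mul_assoc[symmetric] sym3_veronese)
  have inv: "invertible (matrix_inv b)" using matrix_inv_mult[OF b] unfolding invertible_def by blast
  have bb: "b *v (matrix_inv b *v v) = v" for v
    by (simp add: matrix_vector_mul_assoc matrix_inv_mult[OF b])
  have "pt (g *v veronese v) \<in> {pt ((g ** sym3 b) *v veronese v) | v. v \<noteq> 0}" if "v \<noteq> 0" for v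
  proof -
    have "pt (g *v veronese v) = pt ((g ** sym3 b) *v veronese (matrix_inv b *v v))" by (simp only: eq bb)
    then show ?thesis using invertible_mult_nonzero[OF inv that] by blast
  qed
  moreover have "pt ((g ** sym3 b) *v veronese v) \<in> {pt (g *v veronese v) | v. v \<noteq> 0}" if "v \<noteq> 0" for v
    using invertible_mult_nonzero[OF b that] unfolding eq by blast
  ultimately show ?thesis by blast
qed

text \<open>\<open>a\<close> identifies \<open>S0\<close> with \<open>S\<close>, and at the same time \<open>rho\<close> or its twist by the dual with the representation \<open>\<phi>\<close>.\<close>

definition normal_form :: "10 proj set \<Rightarrow> (complex ^ 3 ^ 3 \<Rightarrow> complex ^ 10 ^ 10) \<Rightarrow> bool \<Rightarrow> complex ^ 10 ^ 10 \<Rightarrow> bool" where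
  "normal_form S \<phi> \<epsilon> a \<longleftrightarrow> invertible a \<and> S = {pt (a *v veronese v) | v. v \<noteq> 0} \<and>
     (\<forall>X\<in>sl \<rat>. \<phi> X ** a = a ** rho (twist \<epsilon> X))"

text \<open>Transport by \<open>g\<close> turns \<open>\<phi>\<close> into \<open>rho \<circ> \<gamma>\<close> for an injective homomorphism \<open>\<gamma>\<close> into the \<open>3 \<times> 3\<close> matrices. If \<open>\<gamma>\<close> is conjugate by
  \<open>b\<close> to the standard representation or its dual, then \<open>g sym3(b)\<close> is a normal form, because \<open>sym3 b\<close> maps \<open>S0\<close> to itself.\<close>

lemma normal_form_exists:
  assumes g: "invertible g" and S: "S = {pt (g *v veronese v) | v. v \<noteq> 0}"
    and \<phi>: "lie_iso \<rat> (sl \<rat>) (traceless (lie_algebra_of S \<rat>)) \<phi>"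
  obtains \<epsilon> a where "normal_form S \<phi> \<epsilon> a"
proof -
  let ?C = "\<lambda>M. matrix_inv g ** M ** g"
  have bij: "bij_betw \<phi> (sl \<rat>) (traceless (lie_algebra_of S \<rat>))"
    and hom: "\<And>X Y. X \<in> sl \<rat> \<Longrightarrow> Y \<in> sl \<rat> \<Longrightarrow> \<phi> (X + Y) = \<phi> X + \<phi> Y"
      "\<And>X Y. X \<in> sl \<rat> \<Longrightarrow> Y \<in> sl \<rat> \<Longrightarrow> \<phi> (bracket X Y) = bracket (\<phi> X) (\<phi> Y)"
      "\<And>c X. c \<in> \<rat> \<Longrightarrow> X \<in> sl \<rat> \<Longrightarrow> \<phi> (scale c X) = scale c (\<phi> X)"
    using \<phi> unfolding lie_iso_def by blast+
  have "\<exists>Y. ?C (\<phi> X) = rho Y" if "X \<in> sl \<rat>" for X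
  proof -
    have "\<phi> X \<in> lie_algebra_of S \<rat>" using bij that by (auto simp: bij_betw_def traceless_def)
    from lie_algebra_tangent[OF g S this] show ?thesis by (metis tangent_to_cone_imp_rho)
  qed
  then obtain \<gamma> where \<gamma>: "\<And>X. X \<in> sl \<rat> \<Longrightarrow> ?C (\<phi> X) = rho (\<gamma> X)" by metis
  have C: "?C (M + N) = ?C M + ?C N" "?C (scale c M) = scale c (?C M)" "?C (bracket M N) = bracket (?C M) (?C N)" for M N c
  proof -
    have m: "?C (A ** B) = ?C A ** ?C B" for A B
    proof -
      have "?C A ** ?C B = matrix_inv g ** A ** (g ** matrix_inv g) ** B ** g" by (simp only: matrix_mul_assoc)
      then show ?thesis by (simp add: matrix_inv_mult[OF g] matrix_mul_assoc)
    qed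
    show "?C (M + N) = ?C M + ?C N" "?C (scale c M) = scale c (?C M)"
      by (simp_all add: matrix_add_mult_left matrix_add_ldistrib scale_mult_left scale_mult_right)
    have "?C (A - B) = ?C A - ?C B" for A B
      by (simp add: matrix_diff_mult_left matrix_diff_mult_right)
    then show "?C (bracket M N) = bracket (?C M) (?C N)" unfolding bracket_def by (simp only: m)
  qed
  have \<phi>g: "\<phi> X ** g = g ** rho (\<gamma> X)" if "X \<in> sl \<rat>" for X
  proof -
    have "g ** rho (\<gamma> X) = (g ** matrix_inv g) ** \<phi> X ** g"
      unfolding \<gamma>[OF that, symmetric] by (simp only: matrix_mul_assoc)
    then show ?thesis by (simp add: matrix_inv_mult[OF g])
  qed
  have \<gamma>hom: "\<gamma> (X + Y) = \<gamma> X + \<gamma> Y" "\<gamma> (bracket X Y) = bracket (\<gamma> X) (\<gamma> Y)" if "X \<in> sl \<rat>" "Y \<in> sl \<rat>" for X Y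
    using sl_closed[OF that] by (auto intro!: rho_inject simp: \<gamma>[symmetric] that rho_add rho_bracket hom C)
  have \<gamma>sc: "\<gamma> (scale c X) = scale c (\<gamma> X)" if "c \<in> \<rat>" "X \<in> sl \<rat>" for c X
    using sl_closed(3)[OF that(2) that(2) that(1)] by (auto intro!: rho_inject simp: \<gamma>[symmetric] that rho_scale hom C)
  have inj: "inj_on \<gamma> (sl \<rat>)"
  proof (rule inj_onI)
    fix X Y
    assume XY: "X \<in> sl \<rat>" "Y \<in> sl \<rat>" "\<gamma> X = \<gamma> Y"
    then have "\<phi> X ** g ** matrix_inv g = \<phi> Y ** g ** matrix_inv g" by (simp only: \<phi>g)
    then have "\<phi> X = \<phi> Y" by (simp add: matrix_mul_assoc[symmetric] matrix_inv_mult[OF g])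
    then show "X = Y" using bij XY by (auto simp: bij_betw_def dest: inj_onD)
  qed
  have "\<exists>b \<epsilon>. invertible b \<and> (\<forall>X\<in>sl \<rat>. \<gamma> X = b ** twist \<epsilon> X ** matrix_inv b)"
    by (rule sl3_hom_classification[OF \<gamma>hom \<gamma>sc inj]) (auto simp: twist_def)
  then obtain b \<epsilon> where b: "invertible b" "\<And>X. X \<in> sl \<rat> \<Longrightarrow> \<gamma> X = b ** twist \<epsilon> X ** matrix_inv b" by blast
  have "\<phi> X ** (g ** sym3 b) = (g ** sym3 b) ** rho (twist \<epsilon> X)" if X: "X \<in> sl \<rat>" for X
  proof -
    have "\<phi> X ** (g ** sym3 b) = g ** (rho (\<gamma> X) ** sym3 b)" by (simp add: matrix_mul_assoc \<phi>g[OF X])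
    also have "rho (\<gamma> X) ** sym3 b = sym3 b ** rho (twist \<epsilon> X)" unfolding b(2)[OF X] sym3_rho[OF b(1)] ..
    finally show ?thesis by (simp add: matrix_mul_assoc)
  qed
  then have "normal_form S \<phi> \<epsilon> (g ** sym3 b)"
    unfolding normal_form_def veronese_image_sym3[OF b(1)]
    using S invertible_mult[OF g sym3_invertible[OF b(1)]] by blast
  then show ?thesis by (rule that)
qed

text \<open>If \<open>\<tau>\<close> were conjugation by a matrix, it would preserve the trace of products, and exchanging \<open>h\<^sub>1\<close> and \<open>h\<^sub>2\<close> contradicts
  \<open>chevalley_basis_cubic_trace\<close>.\<close>

lemma swap_automorphism_outer:
  fixes h :: "2 \<Rightarrow> complex ^ 3 ^ 3"
  assumes cb: "chevalley_basis \<rat> (sl \<rat>) H h e" and \<tau>: "lie_iso \<rat> (sl \<rat>) (sl \<rat>) \<tau>" "\<tau> (h 1) = h 2" "\<tau> (h 2) = h 1"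
  obtains b where "invertible b" "\<And>X. X \<in> sl \<rat> \<Longrightarrow> \<tau> X = b ** twist False X ** matrix_inv b"
proof -
  have hK: "h i \<in> sl \<rat>" for i
    using cb is_basis_memD(1)[of "sl \<rat>" _ "h i"] unfolding chevalley_basis_def by blast
  have hom: "\<And>X Y. X \<in> sl \<rat> \<Longrightarrow> Y \<in> sl \<rat> \<Longrightarrow> \<tau> (X + Y) = \<tau> X + \<tau> Y"
      "\<And>X Y. X \<in> sl \<rat> \<Longrightarrow> Y \<in> sl \<rat> \<Longrightarrow> \<tau> (bracket X Y) = bracket (\<tau> X) (\<tau> Y)"
      "\<And>c X. c \<in> \<rat> \<Longrightarrow> X \<in> sl \<rat> \<Longrightarrow> \<tau> (scale c X) = scale c (\<tau> X)"
      "inj_on \<tau> (sl \<rat>)"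
    using \<tau>(1) unfolding lie_iso_def bij_betw_def by blast+
  show ?thesis
  proof (rule sl3_hom_classification[OF hom])
    fix b
    assume b: "invertible b" "\<And>X. X \<in> sl \<rat> \<Longrightarrow> \<tau> X = b ** X ** matrix_inv b"
    have h: "h 2 = b ** h 1 ** matrix_inv b" "h 1 = b ** h 2 ** matrix_inv b"
      using b(2)[OF hK[of 1]] b(2)[OF hK[of 2]] \<tau>(2,3) by simp_all
    have "h 2 ** h 2 ** h 1 = (b ** h 1 ** matrix_inv b) ** (b ** h 1 ** matrix_inv b) ** (b ** h 2 ** matrix_inv b)"
      by (simp only: h(1)[symmetric] h(2)[symmetric])
    also have "\<dots> = b ** h 1 ** (matrix_inv b ** b) ** h 1 ** (matrix_inv b ** b) ** h 2 ** matrix_inv b"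
      by (simp only: matrix_mul_assoc)
    also have "\<dots> = (b ** (h 1 ** h 1 ** h 2)) ** matrix_inv b"
      by (simp add: matrix_inv_mult[OF b(1)] matrix_mul_assoc)
    finally have "trace (h 2 ** h 2 ** h 1) = trace (matrix_inv b ** (b ** (h 1 ** h 1 ** h 2)))"
      by (simp only: trace_mul_sym[of "b ** (h 1 ** h 1 ** h 2)"])
    also have "matrix_inv b ** (b ** (h 1 ** h 1 ** h 2)) = h 1 ** h 1 ** h 2"
      by (simp only: matrix_mul_assoc matrix_inv_mult[OF b(1)] matrix_mul_lid)
    finally show thesis using chevalley_basis_cubic_trace[OF cb] by simp
  next
    fix b
    assume "invertible b" "\<And>X. X \<in> sl \<rat> \<Longrightarrow> \<tau> X = b ** (- transpose X) ** matrix_inv b"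
    then show thesis using that by (simp add: twist_def)
  qed
qed

lemma twist_conjugate:
  assumes b: "invertible b"
  obtains c where "invertible c" "\<And>X. twist \<epsilon> (b ** X ** matrix_inv b) = c ** twist \<epsilon> X ** matrix_inv c"
proof (cases \<epsilon>)
  case True
  then show ?thesis using that b by (simp add: twist_def)
next
  case False
  let ?c = "transpose (matrix_inv b)"
  have 1: "?c ** transpose b = mat 1" "transpose b ** ?c = mat 1"
    by (simp_all add: matrix_transpose_mul[symmetric] matrix_inv_mult[OF b] transpose_mat)
  then have c: "invertible ?c" unfolding invertible_def by blast
  have "matrix_inv ?c = matrix_inv ?c ** (?c ** transpose b)" using 1 by simp
  then have 2: "matrix_inv ?c = transpose b" by (simp only: matrix_mul_assoc matrix_inv_mult[OF c] matrix_mul_lid)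
  have "twist \<epsilon> (b ** X ** matrix_inv b) = ?c ** twist \<epsilon> X ** matrix_inv ?c" for X
  proof -
    have "?c ** (- transpose X) ** transpose b = - (?c ** transpose X ** transpose b)"
      by (simp add: matrix_matrix_mult_def vec_eq_iff sum_negf)
    then show ?thesis unfolding 2 using False by (simp add: twist_def matrix_transpose_mul matrix_mul_assoc)
  qed
  then show ?thesis using that c by blast
qed

lemma normal_form_swap:
  assumes nf: "normal_form S \<phi> \<epsilon> a" and b: "invertible b" "\<And>X. X \<in> sl \<rat> \<Longrightarrow> \<tau> X = b ** twist False X ** matrix_inv b"
    and \<tau>: "\<And>X. X \<in> sl \<rat> \<Longrightarrow> \<tau> X \<in> sl \<rat>"
  obtains a' where "normal_form S (\<phi> \<circ> \<tau>) (\<not> \<epsilon>) a'"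
proof -
  obtain c where c: "invertible c" "\<And>X. twist \<epsilon> (b ** X ** matrix_inv b) = c ** twist \<epsilon> X ** matrix_inv c"
    using twist_conjugate[OF b(1)] by metis
  have a: "invertible a" "S = {pt (a *v veronese v) | v. v \<noteq> 0}" "\<And>X. X \<in> sl \<rat> \<Longrightarrow> \<phi> X ** a = a ** rho (twist \<epsilon> X)"
    using nf unfolding normal_form_def by blast+
  have "\<phi> (\<tau> X) ** (a ** sym3 c) = (a ** sym3 c) ** rho (twist (\<not> \<epsilon>) X)" if X: "X \<in> sl \<rat>" for X
  proof -
    have "\<phi> (\<tau> X) ** (a ** sym3 c) = a ** (rho (twist \<epsilon> (\<tau> X)) ** sym3 c)"
      by (simp add: matrix_mul_assoc a(3)[OF \<tau>[OF X]])
    also have "twist \<epsilon> (\<tau> X) = c ** twist (\<not> \<epsilon>) X ** matrix_inv c"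
      unfolding b(2)[OF X] c(2) twist_twist by simp
    also have "rho (c ** twist (\<not> \<epsilon>) X ** matrix_inv c) ** sym3 c = sym3 c ** rho (twist (\<not> \<epsilon>) X)"
      unfolding sym3_rho[OF c(1)] ..
    finally show ?thesis by (simp add: matrix_mul_assoc)
  qed
  then have "normal_form S (\<phi> \<circ> \<tau>) (\<not> \<epsilon>) (a ** sym3 c)"
    unfolding normal_form_def veronese_image_sym3[OF c(1)] comp_def
    using a(2) invertible_mult[OF a(1) sym3_invertible[OF c(1)]] by blast
  then show ?thesis by (rule that)
qed

text \<open>Between normal forms an intertwiner becomes a matrix \<open>m\<close> that intertwines \<open>rho\<close> with \<open>rho\<close> or with its dual. So either
  Schur's lemma applies, or \<open>m\<close> is not invertible.\<close>

lemma intertwiner_scalar: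
  assumes nf: "normal_form S \<phi> \<epsilon> a" and nf': "normal_form S' \<phi>' \<epsilon>' a'"
    and f: "\<And>X. X \<in> sl \<rat> \<Longrightarrow> f ** \<phi> X = \<phi>' X ** f"
  shows "\<epsilon> = \<epsilon>' \<Longrightarrow> \<exists>c. f ** a = scale c a'" and "invertible f \<Longrightarrow> \<epsilon> = \<epsilon>'"
proof -
  have a: "invertible a" "\<And>X. X \<in> sl \<rat> \<Longrightarrow> \<phi> X ** a = a ** rho (twist \<epsilon> X)"
    and a': "invertible a'" "\<And>X. X \<in> sl \<rat> \<Longrightarrow> \<phi>' X ** a' = a' ** rho (twist \<epsilon>' X)"
    using nf nf' unfolding normal_form_def by blast+
  define m where "m = matrix_inv a' ** f ** a"
  have am: "a' ** m = f ** a" unfolding m_def by (simp add: matrix_mul_assoc matrix_inv_mult[OF a'(1)])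
  have m: "m ** rho (twist \<epsilon> X) = rho (twist \<epsilon>' X) ** m" if X: "X \<in> sl \<rat>" for X
  proof -
    have "a' ** (m ** rho (twist \<epsilon> X)) = a' ** (rho (twist \<epsilon>' X) ** m)"
    proof -
      have "a' ** (m ** rho (twist \<epsilon> X)) = f ** a ** rho (twist \<epsilon> X)" by (simp add: matrix_mul_assoc am)
      also have "\<dots> = f ** \<phi> X ** a" using a(2)[OF X] by (metis matrix_mul_assoc)
      also have "\<dots> = \<phi>' X ** (a' ** m)" unfolding f[OF X] am by (simp add: matrix_mul_assoc)
      also have "\<dots> = a' ** (rho (twist \<epsilon>' X) ** m)" using a'(2)[OF X] by (metis matrix_mul_assoc)
      finally show ?thesis .
    qed
    then have "matrix_inv a' ** (a' ** (m ** rho (twist \<epsilon> X))) = matrix_inv a' ** (a' ** (rho (twist \<epsilon>' X) ** m))" by simp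
    then show ?thesis by (simp only: matrix_mul_assoc matrix_inv_mult[OF a'(1)] matrix_mul_lid)
  qed
  have m': "m ** rho Z = rho (twist (\<epsilon>' = \<epsilon>) Z) ** m" if "Z \<in> sl \<rat>" for Z
    using m[OF twist_in_sl[OF that, of \<epsilon>]] unfolding twist_twist by (simp add: twist_def)
  show "\<exists>c. f ** a = scale c a'" if "\<epsilon> = \<epsilon>'"
  proof -
    have "m ** rho Z = rho Z ** m" if "Z \<in> sl \<rat>" for Z
      using m'[OF that] \<open>\<epsilon> = \<epsilon>'\<close> by (simp add: twist_def)
    then obtain c where c: "\<And>x. m *v x = c *s x" using rho_irreducible[of m] by metis
    have "f ** a = scale c a'"
      unfolding am[symmetric] matrix_eq
      by (simp add: matrix_vector_mul_assoc[symmetric] c vector_scalar_commute scale_mult_vec)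
    then show ?thesis by blast
  qed
  show "\<epsilon> = \<epsilon>'" if inv: "invertible f"
  proof (rule ccontr)
    assume "\<epsilon> \<noteq> \<epsilon>'"
    then have "m ** rho Z = rho (- transpose Z) ** m" if "Z \<in> sl \<rat>" for Z
      using m'[OF that] by (auto simp: twist_def)
    then have "\<not> invertible m" by (rule rho_not_self_dual)
    moreover have "invertible (matrix_inv a')" using matrix_inv_mult[OF a'(1)] unfolding invertible_def by blast
    ultimately show False using inv a(1) invertible_mult unfolding m_def by blast
  qed
qed

text \<open>A \<open>\<rat>\<close>-linear projection of the complex numbers onto \<open>\<rat>\<close>. Applied to the entries of a complex solution of a rational
  linear system it gives a rational solution.\<close>

lemma rational_functional:
  obtains \<pi> :: "complex \<Rightarrow> complex" where "\<And>x y. \<pi> (x + y) = \<pi> x + \<pi> y" "\<And>q x. q \<in> \<rat> \<Longrightarrow> \<pi> (q * x) = q * \<pi> x"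
    "\<And>x. \<pi> x \<in> \<rat>" "\<pi> 1 = 1"
proof -
  interpret vector_space_pair "\<lambda>(q :: rat) (z :: complex). of_rat q * z" "(*) :: rat \<Rightarrow> rat \<Rightarrow> rat"
    by unfold_locales (simp_all add: of_rat_add of_rat_mult algebra_simps)
  have "vs1.independent {1 :: complex}" by (simp add: vs1.dependent_single)
  from linear_independent_extend[OF this, of "\<lambda>_. 1"] obtain g where g: "Vector_Spaces.linear (\<lambda>(q :: rat) (z :: complex). of_rat q * z) (*) g" "g 1 = 1" by auto
  show ?thesis
  proof (rule that[of "\<lambda>z. of_rat (g z)"])
    show "(of_rat (g (x + y)) :: complex) = of_rat (g x) + of_rat (g y)" for x y
      using linear_add[OF g(1), of x y] by (simp add: of_rat_add)
    show "(of_rat (g (q * x)) :: complex) = q * of_rat (g x)" if "q \<in> \<rat>" for q x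
    proof -
      obtain r where r: "q = of_rat r" using \<open>q \<in> \<rat>\<close> by (auto elim: Rats_cases)
      show ?thesis using linear_scale[OF g(1), of r x] by (simp add: r of_rat_mult)
    qed
  qed (simp_all add: g(2))
qed

lemma rational_functional_matrix_mult:
  fixes A M :: "complex ^ 'n ^ 'n"
  assumes \<pi>: "\<And>x y. \<pi> (x + y) = \<pi> x + \<pi> y" "\<And>q x. q \<in> \<rat> \<Longrightarrow> \<pi> (q * x) = q * \<pi> x" and A: "A \<in> matrices \<rat>"
  shows "(\<chi> i j. \<pi> ((A ** M) $ i $ j)) = A ** (\<chi> i j. \<pi> (M $ i $ j))"
    and "(\<chi> i j. \<pi> ((M ** A) $ i $ j)) = (\<chi> i j. \<pi> (M $ i $ j)) ** A"
proof -
  have "\<pi> 0 = 0" using \<pi>(1)[of 0 0] by simp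
  then have sum: "\<pi> (sum u B) = (\<Sum>b\<in>B. \<pi> (u b))" for u :: "'n \<Rightarrow> complex" and B
    by (induction B rule: infinite_finite_induct) (simp_all add: \<pi>(1))
  have A': "A $ i $ j \<in> \<rat>" for i j using A by (simp add: matrices_def)
  have "\<pi> (x * A $ i $ j) = \<pi> x * A $ i $ j" for x i j using \<pi>(2)[OF A'] by (metis mult.commute)
  then show "(\<chi> i j. \<pi> ((A ** M) $ i $ j)) = A ** (\<chi> i j. \<pi> (M $ i $ j))"
    "(\<chi> i j. \<pi> ((M ** A) $ i $ j)) = (\<chi> i j. \<pi> (M $ i $ j)) ** A"
    by (simp_all add: vec_eq_iff matrix_matrix_mult_def sum \<pi>(2)[OF A'])
qed

text \<open>The inverse is the unique solution of a rational linear system, so it does not change when a \<open>\<rat>\<close>-linear projection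
  onto \<open>\<rat>\<close> is applied to its entries.\<close>

lemma matrix_inv_rational:
  fixes f :: "complex ^ 'n ^ 'n"
  assumes f: "invertible f" "f \<in> matrices \<rat>"
  shows "matrix_inv f \<in> matrices \<rat>"
proof -
  obtain \<pi> :: "complex \<Rightarrow> complex" where \<pi>: "\<And>x y. \<pi> (x + y) = \<pi> x + \<pi> y" "\<And>q x. q \<in> \<rat> \<Longrightarrow> \<pi> (q * x) = q * \<pi> x"
    "\<And>x. \<pi> x \<in> \<rat>" "\<pi> 1 = 1" using rational_functional by metis
  let ?G = "\<chi> i j. \<pi> (matrix_inv f $ i $ j)"
  have "\<pi> 0 = 0" using \<pi>(1)[of 0 0] by simp
  then have "(\<chi> i j. \<pi> ((mat 1 :: complex ^ 'n ^ 'n) $ i $ j)) = mat 1" using \<pi>(4) by (simp add: mat_def vec_eq_iff)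
  then have "f ** ?G = mat 1"
    using rational_functional_matrix_mult(1)[where \<pi> = \<pi>, OF \<pi>(1,2) f(2), of "matrix_inv f"] by (simp add: matrix_inv_mult[OF f(1)])
  then have "matrix_inv f ** (f ** ?G) = matrix_inv f" by simp
  then have "?G = matrix_inv f" by (simp only: matrix_mul_assoc matrix_inv_mult[OF f(1)] matrix_mul_lid)
  moreover have "?G \<in> matrices \<rat>" using \<pi>(3) by (simp add: matrices_def)
  ultimately show ?thesis by simp
qed

text \<open>The complex intertwiner \<open>F\<close> is scaled to have an entry \<open>1\<close>, so that its image under \<open>\<pi>\<close> is not zero. This image is a
  rational intertwiner, and by Schur's lemma it is a nonzero multiple of \<open>F\<close>, hence invertible.\<close>

lemma normal_forms_isomorphic:
  assumes nf: "normal_form S \<phi> \<epsilon> a" and nf': "normal_form S' \<phi>' \<epsilon> a'"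
    and rat: "\<And>X. X \<in> sl \<rat> \<Longrightarrow> \<phi> X \<in> matrices \<rat>" "\<And>X. X \<in> sl \<rat> \<Longrightarrow> \<phi>' X \<in> matrices \<rat>"
  shows "reps_isomorphic \<rat> (sl \<rat>) \<phi> \<phi>'"
proof -
  have a: "invertible a" "\<And>X. X \<in> sl \<rat> \<Longrightarrow> \<phi> X ** a = a ** rho (twist \<epsilon> X)"
    and a': "invertible a'" "\<And>X. X \<in> sl \<rat> \<Longrightarrow> \<phi>' X ** a' = a' ** rho (twist \<epsilon> X)"
    using nf nf' unfolding normal_form_def by blast+
  define F where "F = a' ** matrix_inv a"
  have inva: "invertible (matrix_inv a)" using matrix_inv_mult[OF a(1)] unfolding invertible_def by blast
  have invF: "invertible F" unfolding F_def by (rule invertible_mult[OF a'(1) inva])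
  have F: "F ** \<phi> X = \<phi>' X ** F" if X: "X \<in> sl \<rat>" for X
  proof -
    have "\<phi> X = a ** rho (twist \<epsilon> X) ** matrix_inv a"
      unfolding a(2)[OF X, symmetric] by (simp add: matrix_mul_assoc[symmetric] matrix_inv_mult[OF a(1)])
    then have "F ** \<phi> X = a' ** (matrix_inv a ** a) ** rho (twist \<epsilon> X) ** matrix_inv a"
      by (simp only: F_def matrix_mul_assoc)
    also have "\<dots> = (a' ** rho (twist \<epsilon> X)) ** matrix_inv a" by (simp add: matrix_inv_mult[OF a(1)])
    finally show ?thesis unfolding a'(2)[OF X, symmetric] F_def by (simp add: matrix_mul_assoc)
  qed
  obtain p q where pq: "F $ p $ q \<noteq> 0"
  proof -
    have "F \<noteq> 0"
    proof
      assume "F = 0"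
      then have "F *v axis 1 1 = 0" by simp
      then show False using invertible_mult_nonzero[OF invF, of "axis 1 1"] by (simp add: axis_eq_0_iff)
    qed
    then show ?thesis using that by (auto simp: vec_eq_iff)
  qed
  define f where "f = scale (inverse (F $ p $ q)) F"
  obtain \<pi> :: "complex \<Rightarrow> complex" where \<pi>: "\<And>x y. \<pi> (x + y) = \<pi> x + \<pi> y" "\<And>q x. q \<in> \<rat> \<Longrightarrow> \<pi> (q * x) = q * \<pi> x"
    "\<And>x. \<pi> x \<in> \<rat>" "\<pi> 1 = 1" using rational_functional by metis
  define f' where "f' = (\<chi> i j. \<pi> (f $ i $ j))"
  have f': "f' ** \<phi> X = \<phi>' X ** f'" if X: "X \<in> sl \<rat>" for X
  proof -
    have "f ** \<phi> X = \<phi>' X ** f" unfolding f_def scale_mult_left scale_mult_right F[OF X] ..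
    then show ?thesis
      using rational_functional_matrix_mult(2)[where \<pi> = \<pi>, OF \<pi>(1,2) rat(1)[OF X], of f]
        rational_functional_matrix_mult(1)[where \<pi> = \<pi>, OF \<pi>(1,2) rat(2)[OF X], of f] unfolding f'_def by metis
  qed
  obtain c where "f' ** a = scale c a'" using intertwiner_scalar(1)[OF nf nf' f' refl] by blast
  then have "f' ** a ** matrix_inv a = scale c F" by (simp add: scale_mult_left F_def)
  then have fF: "f' = scale c F" by (simp add: matrix_mul_assoc[symmetric] matrix_inv_mult[OF a(1)])
  have "f' $ p $ q = 1" using pq \<pi>(4) by (simp add: f'_def f_def scale_def)
  then have "c \<noteq> 0" unfolding fF by (auto simp: scale_def)
  have "f' ** scale (inverse c) (matrix_inv F) = mat 1"
    unfolding fF scale_mult_left scale_mult_right matrix_inv_mult[OF invF] using \<open>c \<noteq> 0\<close> by (simp add: scale_def vec_eq_iff)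
  then have "invertible f'" using invertible_right_inverse by blast
  moreover have "f' \<in> matrices \<rat>" using \<pi>(3) by (simp add: f'_def matrices_def)
  ultimately have "module_iso \<rat> (sl \<rat>) \<phi> \<phi>' f'"
    unfolding module_iso_def using f' by (simp add: matrix_vector_mul_assoc)
  then show ?thesis unfolding reps_isomorphic_def by blast
qed

lemma proj_map_pt: "invertible f \<Longrightarrow> v \<noteq> 0 \<Longrightarrow> proj_map f (pt v) = pt (f *v v)"
proof -
  assume f: "invertible f" and v: "v \<noteq> 0"
  obtain c where c: "c \<noteq> 0" "rep (pt v) = c *s v" by (rule rep_pt[OF v])
  then show ?thesis
    using pt_scale[OF c(1) invertible_mult_nonzero[OF f v]] by (simp add: proj_map_def vector_scalar_commute)
qed

lemma regular_map_proj_map: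
  fixes f :: "complex ^ 'n ^ 'n"
  assumes f: "invertible f" "f \<in> matrices \<rat>" and \<theta>: "\<And>x. x \<in> S \<Longrightarrow> \<theta> x = proj_map f x"
  shows "regular_map \<rat> S \<theta>"
  unfolding regular_map_def
proof (rule ballI)
  fix x
  assume "x \<in> S"
  have forms: "\<forall>j. linear_form (f $ j) \<in> forms \<rat> 1"
    by (intro allI linear_form_in_forms) (use f(2) in \<open>auto simp: matrices_def\<close>)
  have eval: "(\<chi> j. eval (linear_form (f $ j)) v) = f *v v" for v
    by (simp add: eval_linear_form matrix_vector_mult_def)
  show "\<exists>d P. (\<forall>j. P j \<in> forms \<rat> d) \<and> (\<chi> j. eval (P j) (rep x)) \<noteq> 0 \<and>
     (\<forall>v. v \<noteq> 0 \<and> pt v \<in> S \<and> (\<chi> j. eval (P j) v) \<noteq> 0 \<longrightarrow> \<theta> (pt v) = pt (\<chi> j. eval (P j) v))"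
    by (rule exI[of _ 1], rule exI[of _ "\<lambda>j. linear_form (f $ j)"])
      (simp add: forms eval invertible_mult_nonzero[OF f(1) rep_nonzero] \<theta> proj_map_pt[OF f(1)] del: One_nat_def)
qed

text \<open>A rational projective transformation and its inverse are given by rational linear forms.\<close>

lemma variety_iso_proj_map:
  fixes f :: "complex ^ 'n ^ 'n"
  assumes f: "invertible f" "f \<in> matrices \<rat>" and T: "T = proj_map f ` S"
  shows "variety_iso \<rat> S T (proj_map f)"
proof -
  have G: "invertible (matrix_inv f)" using matrix_inv_mult[OF f(1)] unfolding invertible_def by blast
  have inv: "proj_map (matrix_inv f) (proj_map f x) = x" for x
  proof -
    have "proj_map (matrix_inv f) (proj_map f x) = pt (matrix_inv f *v (f *v rep x))"
      unfolding proj_map_def[of f] by (rule proj_map_pt[OF G invertible_mult_nonzero[OF f(1) rep_nonzero]])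
    then show ?thesis by (simp add: matrix_vector_mul_assoc matrix_inv_mult[OF f(1)] pt_rep)
  qed
  have bij: "bij_betw (proj_map f) S T"
    unfolding bij_betw_def T by (metis inj_on_inverseI inv)
  have "inv_into S (proj_map f) y = proj_map (matrix_inv f) y" if "y \<in> T" for y
    using that bij inv by (metis bij_betw_inv_into_right)
  then have "regular_map \<rat> T (inv_into S (proj_map f))"
    by (rule regular_map_proj_map[OF G matrix_inv_rational[OF f]])
  moreover have "regular_map \<rat> S (proj_map f)" by (rule regular_map_proj_map[OF f refl])
  ultimately show ?thesis using bij unfolding variety_iso_def by blast
qed

text \<open>By \<open>intertwiner_scalar\<close> the intertwiner is a multiple of the one that maps \<open>S\<close> to \<open>S'\<close>.\<close>

lemma module_iso_variety_iso:
  assumes nf: "normal_form S \<phi> \<epsilon> a" and nf': "normal_form S' \<phi>' \<epsilon>' a'"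
    and f: "module_iso \<rat> (sl \<rat>) \<phi> \<phi>' f"
  shows "variety_iso \<rat> S S' (proj_map f)"
proof -
  have S: "S = {pt (a *v veronese v) | v. v \<noteq> 0}" "invertible a" and S': "S' = {pt (a' *v veronese v) | v. v \<noteq> 0}" "invertible a'"
    using nf nf' unfolding normal_form_def by blast+
  have fX: "f ** \<phi> X = \<phi>' X ** f" if "X \<in> sl \<rat>" for X
    using f that unfolding module_iso_def by (auto simp: matrix_eq matrix_vector_mul_assoc)
  have inv: "invertible f" and rat: "f \<in> matrices \<rat>" using f unfolding module_iso_def by blast+
  have "\<epsilon> = \<epsilon>'" by (rule intertwiner_scalar(2)[OF nf nf' fX inv])
  then obtain c where c: "f ** a = scale c a'" using intertwiner_scalar(1)[OF nf nf' fX] by blast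
  have img: "proj_map f (pt (a *v veronese v)) = pt (a' *v veronese v)" if v: "v \<noteq> 0" for v
  proof -
    have nz: "a *v veronese v \<noteq> 0" "a' *v veronese v \<noteq> 0"
      using invertible_mult_nonzero veronese_nonzero[OF v] S(2) S'(2) by blast+
    have "f *v (a *v veronese v) = c *s (a' *v veronese v)"
      by (simp add: matrix_vector_mul_assoc c scale_mult_vec)
    moreover have "f *v (a *v veronese v) \<noteq> 0" by (rule invertible_mult_nonzero[OF inv nz(1)])
    ultimately show ?thesis using pt_scale[of c, OF _ nz(2)] proj_map_pt[OF inv nz(1)] by auto
  qed
  have "S' = proj_map f ` S"
  proof -
    have "proj_map f ` S = {proj_map f (pt (a *v veronese v)) | v. v \<noteq> 0}" unfolding S(1) by blast
    also have "\<dots> = S'" unfolding S'(1) using img by metis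
    finally show ?thesis ..
  qed
  then show ?thesis by (rule variety_iso_proj_map[OF inv rat])
qed

theorem theorem3p5:
  fixes S :: "10 proj set"
    and K H :: "(complex ^ 3 ^ 3) set"
    and L0 L :: "(complex ^ 10 ^ 10) set"
    and \<phi>0 \<phi> :: "complex ^ 3 ^ 3 \<Rightarrow> complex ^ 10 ^ 10"
    and h :: "2 \<Rightarrow> complex ^ 3 ^ 3"
    and e :: "(2 \<Rightarrow> complex) \<Rightarrow> complex ^ 3 ^ 3"
    and \<tau> :: "complex ^ 3 ^ 3 \<Rightarrow> complex ^ 3 ^ 3"
  assumes S: "anticanonically_embedded_severi_brauer_surface \<rat> S"
    and L0: "L0 = lie_algebra_of S0 \<rat>"
    and L: "L = lie_algebra_of S \<rat>"
    and iso: "\<exists>\<psi>. lie_iso \<rat> L0 L \<psi>"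
    and K: "K = sl \<rat>"
    and \<phi>0: "lie_iso \<rat> K (traceless L0) \<phi>0"
    and \<phi>: "lie_iso \<rat> K (traceless L) \<phi>"
    and H: "cartan_subalgebra \<rat> K H"
    and h: "chevalley_basis \<rat> K H h e"
    and \<tau>: "lie_iso \<rat> K K \<tau>" "\<tau> (h 1) = h 2" "\<tau> (h 2) = h 1"
  shows "(reps_isomorphic \<rat> K \<phi>0 \<phi> \<or> reps_isomorphic \<rat> K \<phi>0 (\<phi> \<circ> \<tau>)) \<and>
    (\<forall>f. module_iso \<rat> K \<phi>0 (if reps_isomorphic \<rat> K \<phi>0 \<phi> then \<phi> else \<phi> \<circ> \<tau>) f \<longrightarrow>
       variety_iso \<rat> S0 S (proj_map f))"
proof -
  have zero: "0 \<in> sl \<rat>" by (simp add: sl_def matrices_def trace_def)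
  have mem: "X \<in> sl \<rat> \<Longrightarrow> \<phi>0 X \<in> lie_algebra_of S0 \<rat>" "X \<in> sl \<rat> \<Longrightarrow> \<phi> X \<in> lie_algebra_of S \<rat>"
    "X \<in> sl \<rat> \<Longrightarrow> \<tau> X \<in> sl \<rat>" for X
    using \<phi>0 \<phi> \<tau>(1) unfolding K L0 L lie_iso_def bij_betw_def traceless_def by blast+
  have rat: "X \<in> sl \<rat> \<Longrightarrow> \<phi>0 X \<in> matrices \<rat>" "X \<in> sl \<rat> \<Longrightarrow> \<phi> X \<in> matrices \<rat>" for X
    using mem[of X] unfolding lie_algebra_of_def by blast+
  obtain A where A: "quadric_generators \<rat> S A"
    using mem(2)[OF zero] unfolding lie_algebra_of_def by blast
  obtain \<eta> where \<eta>: "variety_iso UNIV (UNIV :: 3 proj set) S \<eta>"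
    using S unfolding anticanonically_embedded_severi_brauer_surface_def severi_brauer_surface_def by blast
  obtain s :: "10 \<Rightarrow> 10 biderivation" where s: "anticanonical_basis \<rat> S s" "S = anticanonical_image S s"
    using S unfolding anticanonically_embedded_severi_brauer_surface_def by blast
  have sec: "anticanonical_section \<rat> S (s m)" for m using s(1) unfolding anticanonical_basis_def by blast
  obtain g where g: "invertible g" "S = {pt (g *v veronese v) | v. v \<noteq> 0}"
    using anticanonical_image_eq_veronese_image[OF \<eta> sec s(2) quadric_generators_nondegenerate[OF A]] by blast
  obtain \<epsilon> a where nf: "normal_form S \<phi> \<epsilon> a"
    using normal_form_exists[OF g \<phi>[unfolded K L]] by blast
  have "invertible (mat 1 :: complex ^ 10 ^ 10)" unfolding invertible_def by (rule exI[of _ "mat 1"]) simp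
  moreover have "S0 = {pt (mat 1 *v veronese v) | v. v \<noteq> 0}" by (simp add: S0_def)
  ultimately obtain \<epsilon>0 a0 where nf0: "normal_form S0 \<phi>0 \<epsilon>0 a0"
    using normal_form_exists[OF _ _ \<phi>0[unfolded K L0]] by blast
  obtain b where b: "invertible b" "\<And>X. X \<in> sl \<rat> \<Longrightarrow> \<tau> X = b ** twist False X ** matrix_inv b"
    using swap_automorphism_outer[OF h[unfolded K] \<tau>(1)[unfolded K] \<tau>(2,3)] by blast
  obtain a' where nf': "normal_form S (\<phi> \<circ> \<tau>) (\<not> \<epsilon>) a'"
    using normal_form_swap[OF nf b mem(3)] by blast
  have "reps_isomorphic \<rat> K \<phi>0 \<phi> \<or> reps_isomorphic \<rat> K \<phi>0 (\<phi> \<circ> \<tau>)"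
  proof (cases "\<epsilon>0 = \<epsilon>")
    case True
    then have "normal_form S \<phi> \<epsilon>0 a" using nf by simp
    from normal_forms_isomorphic[OF nf0 this] rat have "reps_isomorphic \<rat> (sl \<rat>) \<phi>0 \<phi>" by blast
    then show ?thesis unfolding K by blast
  next
    case False
    then have nf'': "normal_form S (\<phi> \<circ> \<tau>) \<epsilon>0 a'" using nf' by (cases \<epsilon>; cases \<epsilon>0) simp_all
    have "(\<phi> \<circ> \<tau>) X \<in> matrices \<rat>" if "X \<in> sl \<rat>" for X using rat(2)[OF mem(3)[OF that]] by simp
    with normal_forms_isomorphic[OF nf0 nf''] rat(1) have "reps_isomorphic \<rat> (sl \<rat>) \<phi>0 (\<phi> \<circ> \<tau>)" by blast
    then show ?thesis unfolding K by blast
  qed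
  moreover have "variety_iso \<rat> S0 S (proj_map f)"
    if "module_iso \<rat> K \<phi>0 (if reps_isomorphic \<rat> K \<phi>0 \<phi> then \<phi> else \<phi> \<circ> \<tau>) f" for f
    using that module_iso_variety_iso[OF nf0 nf] module_iso_variety_iso[OF nf0 nf'] unfolding K
    by (auto split: if_splits)
  ultimately show ?thesis by blast
qed

end
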